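(* Let $p$ be a prime, let $R$ be a ring satisfying the Hypothesis (H) of the context, and let $G$ be a finite group. The natural map $$\mathrm{Det}(\mathrm{K}_1(R[G]))\longrightarrow \widehat{\mathrm{Det}}(\mathrm{K}_1(R[G]))$$ is an isomorphism, and the homomorphism $\mathrm{Det}$ gives an exact sequence $$1\to \widehat{\mathrm{SK}}_1(R[G])\to \widehat{\mathrm{K}}_1(R[G])\to \widehat{\mathrm{Det}}(\mathrm{K}_1(R[G]))\to 1 .$$
   Context: Hypothesis (H) on $R$ (for the prime $p$): (i) $R$ is an integral domain which is torsion free as an abelian group; (ii) the natural map $R\to\varprojlim_n R/p^nR$ is an isomorphism; (iii) $R$ has a lift of Frobenius, i.e. a ring endomorphism $F:R\to R$ with $F(r)\equiv r^p \bmod pR$ for all $r\in R$. Let $N$ be the field of fractions of $R$ and $N^c$ an algebraic closure. $\mathrm{Det}:\mathrm{K}_1(R[G])\to \mathrm{K}_1(N^c[G])=\prod_\chi N^{c\times}$ (product over the irreducible $N^c$-valued characters of $G$) is induced by $R[G]\subset N^c[G]$; $\mathrm{SK}_1(R[G])=\ker(\mathrm{Det})$. For a subset $X$ of $\mathrm{GL}(R[G])=\varinjlim_n\mathrm{GL}_n(R[G])$, $\mathrm{Det}(X)$ is its image under $\mathrm{GL}(R[G])\to\mathrm{K}_1(R[G])\to\prod_\chi N^{c\times}$, and $\mathrm{Det}(\mathrm{GL}(R[G]))=\mathrm{Det}(\mathrm{K}_1(R[G]))$. Write $\mathrm{M}(R[G])=\varinjlim_n \mathrm{M}_n(R[G])$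 for matrices, so that $1+p^n\mathrm{M}(R[G])$ is a subgroup of $\mathrm{GL}(R[G])$ for $n\ge 1$. Define $$\widehat{\mathrm{K}}_1(R[G])=\varprojlim_n \mathrm{K}_1((R/p^nR)[G]),\qquad \widehat{\mathrm{Det}}(\mathrm{K}_1(R[G]))=\varprojlim_n \frac{\mathrm{Det}(\mathrm{GL}(R[G]))}{\mathrm{Det}(1+p^n\mathrm{M}(R[G]))},$$ and let $\widehat{\mathrm{SK}}_1(R[G])$ be the closure of (the image of) $\mathrm{SK}_1(R[G])$ in $\widehat{\mathrm{K}}_1(R[G])$, i.e. the inverse limit over $n$ of the images of $\mathrm{SK}_1(R[G])$ in $\mathrm{K}_1((R/p^nR)[G])$. *)

theory Defs
  imports
    "HOL-Algebra.Algebra"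
    "HOL-Algebra.Algebraic_Closure_Type"
    "HOL-Computational_Algebra.Fraction_Field"
    "Jordan_Normal_Form.Determinant"
begin

section \<open>Inverse limits of towers, maps on cosets, exact sequences\<close>

text \<open>Towers are indexed by the integers \<open>n \<ge> 1\<close>; \<open>\<pi> n\<close> is the transition map from
  level \<open>n + 1\<close> to level \<open>n\<close>.\<close>

definition inverse_limit_set :: "(nat \<Rightarrow> 'a set) \<Rightarrow> (nat \<Rightarrow> 'a \<Rightarrow> 'a) \<Rightarrow> (nat \<Rightarrow> 'a) set" where
  "inverse_limit_set A \<pi> = {x \<in> (\<Pi>\<^sub>E n\<in>{1..}. A n). \<forall>n\<ge>1. \<pi> n (x (Suc n)) = x n}"

definition inverse_limit_group ::
    "(nat \<Rightarrow> ('a, 'm) monoid_scheme) \<Rightarrow> (nat \<Rightarrow> 'a \<Rightarrow> 'a) \<Rightarrow> (nat \<Rightarrow> 'a) monoid" where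
  "inverse_limit_group H \<pi> =
     (product_group {1..} H)\<lparr>carrier := inverse_limit_set (\<lambda>n. carrier (H n)) \<pi>\<rparr>"

definition inverse_limit_ring ::
    "(nat \<Rightarrow> ('a, 'm) ring_scheme) \<Rightarrow> (nat \<Rightarrow> 'a \<Rightarrow> 'a) \<Rightarrow> (nat \<Rightarrow> 'a) ring" where
  "inverse_limit_ring S \<pi> =
     \<lparr>carrier = inverse_limit_set (\<lambda>n. carrier (S n)) \<pi>,
      monoid.mult = (\<lambda>x y. \<lambda>n\<in>{1..}. x n \<otimes>\<^bsub>S n\<^esub> y n),
      monoid.one = (\<lambda>n\<in>{1..}. \<one>\<^bsub>S n\<^esub>),
      ring.zero = (\<lambda>n\<in>{1..}. \<zero>\<^bsub>S n\<^esub>),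
      ring.add = (\<lambda>x y. \<lambda>n\<in>{1..}. x n \<oplus>\<^bsub>S n\<^esub> y n)\<rparr>"

text \<open>The map on cosets induced by a map \<open>f\<close> that is constant on each coset.\<close>

definition on_cosets :: "('a \<Rightarrow> 'b) \<Rightarrow> 'a set \<Rightarrow> 'b" where
  "on_cosets f Y = the_elem (f ` Y)"

text \<open>Exactness of \<open>1 \<rightarrow> A \<rightarrow> B \<rightarrow> C \<rightarrow> 1\<close>. The library's \<^const>\<open>exact_seq\<close> requires all groups to
  have the same element type.\<close>

definition short_exact ::
    "('a, 'k) monoid_scheme \<Rightarrow> ('a \<Rightarrow> 'b) \<Rightarrow> ('b, 'l) monoid_scheme \<Rightarrow> ('b \<Rightarrow> 'c) \<Rightarrow>
     ('c, 'm) monoid_scheme \<Rightarrow> bool" where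
  "short_exact A f B g C \<longleftrightarrow>
     group_hom A B f \<and> group_hom B C g \<and>
     inj_on f (carrier A) \<and> f ` carrier A = kernel B C g \<and> g ` carrier B = carrier C"


section \<open>The rings \<open>R/p\<^sup>nR\<close> and the hypothesis on \<open>R\<close>\<close>

definition ppow_ideal :: "nat \<Rightarrow> 'r ring \<Rightarrow> nat \<Rightarrow> 'r set" where
  "ppow_ideal p R n = PIdl\<^bsub>R\<^esub> (add_pow R (p ^ n) \<one>\<^bsub>R\<^esub>)"

definition ppow_quot :: "nat \<Rightarrow> 'r ring \<Rightarrow> nat \<Rightarrow> 'r set ring" where
  "ppow_quot p R n = R Quot ppow_ideal p R n"

definition reduction :: "nat \<Rightarrow> 'r ring \<Rightarrow> nat \<Rightarrow> 'r \<Rightarrow> 'r set" where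
  "reduction p R n r = ppow_ideal p R n +>\<^bsub>R\<^esub> r"

definition ppow_trans :: "nat \<Rightarrow> 'r ring \<Rightarrow> nat \<Rightarrow> 'r set \<Rightarrow> 'r set" where
  "ppow_trans p R n = on_cosets (reduction p R n)"

definition hypothesis_H :: "nat \<Rightarrow> 'r ring \<Rightarrow> bool" where
  "hypothesis_H p R \<longleftrightarrow>
     domain R \<and>
     (\<forall>k::nat. \<forall>r\<in>carrier R. k > 0 \<and> add_pow R k r = \<zero>\<^bsub>R\<^esub> \<longrightarrow> r = \<zero>\<^bsub>R\<^esub>) \<and>
     (\<lambda>r. \<lambda>n\<in>{1..}. reduction p R n r)
       \<in> ring_iso R (inverse_limit_ring (ppow_quot p R) (ppow_trans p R)) \<and>
     (\<exists>F\<in>Ring.ring_hom R R. \<forall>r\<in>carrier R.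
        F r \<ominus>\<^bsub>R\<^esub> r [^]\<^bsub>R\<^esub> p \<in> PIdl\<^bsub>R\<^esub> (add_pow R p \<one>\<^bsub>R\<^esub>))"


section \<open>Group rings\<close>

text \<open>Only meant for finite groups: elements are all functions from the group to the coefficients.\<close>

definition group_ring :: "'r ring \<Rightarrow> ('g, 'm) monoid_scheme \<Rightarrow> ('g \<Rightarrow> 'r) ring" where
  "group_ring R G =
     \<lparr>carrier = carrier G \<rightarrow>\<^sub>E carrier R,
      monoid.mult = (\<lambda>a b. \<lambda>g\<in>carrier G.
        \<Oplus>\<^bsub>R\<^esub>h\<in>carrier G. a h \<otimes>\<^bsub>R\<^esub> b (inv\<^bsub>G\<^esub> h \<otimes>\<^bsub>G\<^esub> g)),
      monoid.one = (\<lambda>g\<in>carrier G. if g = \<one>\<^bsub>G\<^esub> then \<one>\<^bsub>R\<^esub> else \<zero>\<^bsub>R\<^esub>),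
      ring.zero = (\<lambda>g\<in>carrier G. \<zero>\<^bsub>R\<^esub>),
      ring.add = (\<lambda>a b. \<lambda>g\<in>carrier G. a g \<oplus>\<^bsub>R\<^esub> b g)\<rparr>"

definition group_ring_map :: "('g, 'm) monoid_scheme \<Rightarrow> ('r \<Rightarrow> 's) \<Rightarrow> ('g \<Rightarrow> 'r) \<Rightarrow> 'g \<Rightarrow> 's" where
  "group_ring_map G f a = (\<lambda>g\<in>carrier G. f (a g))"


section \<open>The stable general linear group and \<open>K\<^sub>1\<close>\<close>

text \<open>The direct limit of the \<open>GL\<^sub>n(A)\<close> along \<open>M \<mapsto> M \<oplus> 1\<close> is realised by the infinite matrices
  that agree with the identity outside a finite upper left block, the direct limit of the
  \<open>M\<^sub>n(A)\<close> along \<open>M \<mapsto> M \<oplus> 0\<close> by those that vanish outside such a block.\<close>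

definition in_block :: "'a ring \<Rightarrow> nat \<Rightarrow> (nat \<Rightarrow> nat \<Rightarrow> 'a) \<Rightarrow> bool" where
  "in_block A n M \<longleftrightarrow>
     (\<forall>i j. M i j \<in> carrier A) \<and>
     (\<forall>i j. i \<ge> n \<or> j \<ge> n \<longrightarrow> M i j = (if i = j then \<one>\<^bsub>A\<^esub> else \<zero>\<^bsub>A\<^esub>))"

text \<open>The index set of the sum is finite for the matrices in the carrier; \<^const>\<open>finsum\<close> over an
  infinite index set would be trivial.\<close>

definition stable_matrices :: "'a ring \<Rightarrow> (nat \<Rightarrow> nat \<Rightarrow> 'a) monoid" where
  "stable_matrices A =
     \<lparr>carrier = {M. \<exists>n. in_block A n M},
      monoid.mult = (\<lambda>M N i j. \<Oplus>\<^bsub>A\<^esub>k\<in>{k. M i k \<noteq> \<zero>\<^bsub>A\<^esub>}. M i k \<otimes>\<^bsub>A\<^esub> N k j),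
      monoid.one = (\<lambda>i j. if i = j then \<one>\<^bsub>A\<^esub> else \<zero>\<^bsub>A\<^esub>)\<rparr>"

definition GL :: "'a ring \<Rightarrow> (nat \<Rightarrow> nat \<Rightarrow> 'a) monoid" where
  "GL A = units_of (stable_matrices A)"

definition M_infinity :: "'a ring \<Rightarrow> (nat \<Rightarrow> nat \<Rightarrow> 'a) set" where
  "M_infinity A =
     {Y. (\<forall>i j. Y i j \<in> carrier A) \<and> (\<exists>n. \<forall>i j. i \<ge> n \<or> j \<ge> n \<longrightarrow> Y i j = \<zero>\<^bsub>A\<^esub>)}"

text \<open>The set \<open>1 + p\<^sup>n M(A)\<close>.\<close>

definition congruence_matrices :: "nat \<Rightarrow> 'a ring \<Rightarrow> nat \<Rightarrow> (nat \<Rightarrow> nat \<Rightarrow> 'a) set" where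
  "congruence_matrices p A n =
     (\<lambda>Y i j. (if i = j then \<one>\<^bsub>A\<^esub> else \<zero>\<^bsub>A\<^esub>) \<oplus>\<^bsub>A\<^esub> add_pow A (p ^ n) (Y i j)) ` M_infinity A"

definition K1 :: "'a ring \<Rightarrow> (nat \<Rightarrow> nat \<Rightarrow> 'a) set monoid" where
  "K1 A = GL A Mod derived (GL A) (carrier (GL A))"

definition K1_class :: "'a ring \<Rightarrow> (nat \<Rightarrow> nat \<Rightarrow> 'a) \<Rightarrow> (nat \<Rightarrow> nat \<Rightarrow> 'a) set" where
  "K1_class A M = derived (GL A) (carrier (GL A)) #>\<^bsub>GL A\<^esub> M"

text \<open>The homomorphism from \<open>K\<^sub>1\<close> of the source to \<open>K\<^sub>1(B)\<close> induced by a ring homomorphism \<open>f\<close>.\<close>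

definition K1_map ::
    "'b ring \<Rightarrow> ('a \<Rightarrow> 'b) \<Rightarrow> (nat \<Rightarrow> nat \<Rightarrow> 'a) set \<Rightarrow> (nat \<Rightarrow> nat \<Rightarrow> 'b) set" where
  "K1_map B f = on_cosets (\<lambda>M. K1_class B (\<lambda>i j. f (M i j)))"


section \<open>Irreducible characters over an algebraically closed field\<close>

definition matrix_rep :: "('g, 'm) monoid_scheme \<Rightarrow> nat \<Rightarrow> ('g \<Rightarrow> 'k::field mat) \<Rightarrow> bool" where
  "matrix_rep G d \<rho> \<longleftrightarrow> \<rho> \<in> hom G (units_of (ring_mat TYPE('k) d ()))"

definition irreducible_rep :: "('g, 'm) monoid_scheme \<Rightarrow> nat \<Rightarrow> ('g \<Rightarrow> 'k::field mat) \<Rightarrow> bool" where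
  "irreducible_rep G d \<rho> \<longleftrightarrow>
     matrix_rep G d \<rho> \<and> d > 0 \<and>
     (\<forall>W \<subseteq> carrier_vec d.
        0\<^sub>v d \<in> W \<and> (\<forall>v\<in>W. \<forall>w\<in>W. v + w \<in> W) \<and> (\<forall>c. \<forall>v\<in>W. c \<cdot>\<^sub>v v \<in> W) \<and>
        (\<forall>g\<in>carrier G. \<forall>v\<in>W. \<rho> g *\<^sub>v v \<in> W)
        \<longrightarrow> W = {0\<^sub>v d} \<or> W = carrier_vec d)"

definition rep_character ::
    "('g, 'm) monoid_scheme \<Rightarrow> nat \<Rightarrow> ('g \<Rightarrow> 'k::field mat) \<Rightarrow> 'g \<Rightarrow> 'k" where
  "rep_character G d \<rho> = (\<lambda>g\<in>carrier G. \<Sum>i<d. \<rho> g $$ (i, i))"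

definition affords ::
    "('g, 'm) monoid_scheme \<Rightarrow> ('g \<Rightarrow> 'k::field) \<Rightarrow> nat \<times> ('g \<Rightarrow> 'k mat) \<Rightarrow> bool" where
  "affords G \<chi> = (\<lambda>(d, \<rho>). irreducible_rep G d \<rho> \<and> rep_character G d \<rho> = \<chi>)"

definition irr_characters :: "('g, 'm) monoid_scheme \<Rightarrow> ('g \<Rightarrow> 'k::field) set" where
  "irr_characters G = {\<chi>. \<exists>d\<rho>. affords G \<chi> d\<rho>}"


section \<open>Determinants\<close>

text \<open>The determinant of the matrix obtained from \<open>M\<close> by replacing each entry
  \<open>\<Sum>\<^sub>g a\<^sub>g g\<close> by the \<open>d \<times> d\<close> block \<open>\<Sum>\<^sub>g a\<^sub>g \<rho>(g)\<close>. Any \<open>n\<close> with \<^term>\<open>in_block A n M\<close> gives the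
  same value.\<close>

definition Det_rep ::
    "('g, 'm) monoid_scheme \<Rightarrow> nat \<times> ('g \<Rightarrow> 'k::field mat) \<Rightarrow> (nat \<Rightarrow> nat \<Rightarrow> 'g \<Rightarrow> 'k) \<Rightarrow> 'k" where
  "Det_rep G = (\<lambda>(d, \<rho>) M.
     let n = (LEAST n. in_block (group_ring ring_of_type_algebra G) n M)
     in det (mat (n * d) (n * d) (\<lambda>(i, j).
          \<Sum>g\<in>carrier G. M (i div d) (j div d) g * \<rho> g $$ (i mod d, j mod d))))"

text \<open>The identification of \<open>K\<^sub>1(k[G])\<close> with the product of copies of \<open>k\<^sup>\<times>\<close> indexed by the irreducible
  characters, for \<open>k\<close> algebraically closed of characteristic zero. A character determines its
  representation up to conjugation, so the choice of a representation does not matter.\<close>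

definition Det_alg_closed ::
    "('g, 'm) monoid_scheme \<Rightarrow> (nat \<Rightarrow> nat \<Rightarrow> 'g \<Rightarrow> 'k::field) set \<Rightarrow> ('g \<Rightarrow> 'k) \<Rightarrow> 'k" where
  "Det_alg_closed G Y =
     (\<lambda>\<chi>\<in>irr_characters G. on_cosets (Det_rep G (SOME d\<rho>. affords G \<chi> d\<rho>)) Y)"

definition Det_codomain :: "('g, 'm) monoid_scheme \<Rightarrow> (('g \<Rightarrow> 'k::field) \<Rightarrow> 'k) monoid" where
  "Det_codomain G = product_group (irr_characters G) (\<lambda>_. units_of ring_of_type_algebra)"

text \<open>From here on \<open>R\<close> is the ring structure of a type \<^typ>\<open>'r\<close> of class \<^class>\<open>idom\<close>. Its field of
  fractions is \<^typ>\<open>'r fract\<close>, with algebraic closure \<^typ>\<open>'r fract alg_closure\<close>. The structure itself enters through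
  \<^const>\<open>ring_of_type_algebra\<close>.\<close>

definition to_closure :: "'r::idom \<Rightarrow> 'r fract alg_closure" where
  "to_closure r = to_ac (Fract r 1)"

definition Det ::
    "('g, 'm) monoid_scheme \<Rightarrow> (nat \<Rightarrow> nat \<Rightarrow> 'g \<Rightarrow> 'r::idom) set \<Rightarrow>
     ('g \<Rightarrow> 'r fract alg_closure) \<Rightarrow> 'r fract alg_closure" where
  "Det G Y = Det_alg_closed G
     (K1_map (group_ring ring_of_type_algebra G) (group_ring_map G to_closure) Y)"

definition SK1 :: "'r::idom ring \<Rightarrow> ('g, 'm) monoid_scheme \<Rightarrow> (nat \<Rightarrow> nat \<Rightarrow> 'g \<Rightarrow> 'r) set set" where
  "SK1 R G = kernel (K1 (group_ring R G)) (Det_codomain G) (Det G)"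

definition Det_K1 ::
    "'r::idom ring \<Rightarrow> ('g, 'm) monoid_scheme \<Rightarrow>
     (('g \<Rightarrow> 'r fract alg_closure) \<Rightarrow> 'r fract alg_closure) monoid" where
  "Det_K1 R G = (Det_codomain G)\<lparr>carrier := Det G ` carrier (K1 (group_ring R G))\<rparr>"

text \<open>The subgroup \<open>Det(1 + p\<^sup>n M(R[G]))\<close>.\<close>

definition Det_congruence ::
    "nat \<Rightarrow> 'r::idom ring \<Rightarrow> ('g, 'm) monoid_scheme \<Rightarrow> nat \<Rightarrow>
     (('g \<Rightarrow> 'r fract alg_closure) \<Rightarrow> 'r fract alg_closure) set" where
  "Det_congruence p R G n =
     (\<lambda>M. Det G (K1_class (group_ring R G) M)) ` congruence_matrices p (group_ring R G) n"

definition Det_proj ::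
    "nat \<Rightarrow> 'r::idom ring \<Rightarrow> ('g, 'm) monoid_scheme \<Rightarrow> nat \<Rightarrow>
     (('g \<Rightarrow> 'r fract alg_closure) \<Rightarrow> 'r fract alg_closure) \<Rightarrow>
     (('g \<Rightarrow> 'r fract alg_closure) \<Rightarrow> 'r fract alg_closure) set" where
  "Det_proj p R G n x = Det_congruence p R G n #>\<^bsub>Det_K1 R G\<^esub> x"


section \<open>Completions\<close>

definition K1_level ::
    "nat \<Rightarrow> 'r ring \<Rightarrow> ('g, 'm) monoid_scheme \<Rightarrow> nat \<Rightarrow>
     (nat \<Rightarrow> nat \<Rightarrow> 'g \<Rightarrow> 'r set) set monoid" where
  "K1_level p R G n = K1 (group_ring (ppow_quot p R n) G)"

definition K1_trans ::
    "nat \<Rightarrow> 'r ring \<Rightarrow> ('g, 'm) monoid_scheme \<Rightarrow> nat \<Rightarrow>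
     (nat \<Rightarrow> nat \<Rightarrow> 'g \<Rightarrow> 'r set) set \<Rightarrow> (nat \<Rightarrow> nat \<Rightarrow> 'g \<Rightarrow> 'r set) set" where
  "K1_trans p R G n =
     K1_map (group_ring (ppow_quot p R n) G) (group_ring_map G (ppow_trans p R n))"

definition K1_reduction ::
    "nat \<Rightarrow> 'r ring \<Rightarrow> ('g, 'm) monoid_scheme \<Rightarrow> nat \<Rightarrow>
     (nat \<Rightarrow> nat \<Rightarrow> 'g \<Rightarrow> 'r) set \<Rightarrow> (nat \<Rightarrow> nat \<Rightarrow> 'g \<Rightarrow> 'r set) set" where
  "K1_reduction p R G n =
     K1_map (group_ring (ppow_quot p R n) G) (group_ring_map G (reduction p R n))"

definition K1_hat ::
    "nat \<Rightarrow> 'r ring \<Rightarrow> ('g, 'm) monoid_scheme \<Rightarrow>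
     (nat \<Rightarrow> (nat \<Rightarrow> nat \<Rightarrow> 'g \<Rightarrow> 'r set) set) monoid" where
  "K1_hat p R G = inverse_limit_group (K1_level p R G) (K1_trans p R G)"

definition SK1_hat ::
    "nat \<Rightarrow> 'r::idom ring \<Rightarrow> ('g, 'm) monoid_scheme \<Rightarrow>
     (nat \<Rightarrow> (nat \<Rightarrow> nat \<Rightarrow> 'g \<Rightarrow> 'r set) set) monoid" where
  "SK1_hat p R G =
     inverse_limit_group
       (\<lambda>n. (K1_level p R G n)\<lparr>carrier := K1_reduction p R G n ` SK1 R G\<rparr>) (K1_trans p R G)"

definition Det_hat ::
    "nat \<Rightarrow> 'r::idom ring \<Rightarrow> ('g, 'm) monoid_scheme \<Rightarrow>
     (nat \<Rightarrow> (('g \<Rightarrow> 'r fract alg_closure) \<Rightarrow> 'r fract alg_closure) set) monoid" where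
  "Det_hat p R G =
     inverse_limit_group (\<lambda>n. Det_K1 R G Mod Det_congruence p R G n)
       (\<lambda>n. on_cosets (Det_proj p R G n))"

definition Det_to_Det_hat ::
    "nat \<Rightarrow> 'r::idom ring \<Rightarrow> ('g, 'm) monoid_scheme \<Rightarrow>
     (('g \<Rightarrow> 'r fract alg_closure) \<Rightarrow> 'r fract alg_closure) \<Rightarrow>
     nat \<Rightarrow> (('g \<Rightarrow> 'r fract alg_closure) \<Rightarrow> 'r fract alg_closure) set" where
  "Det_to_Det_hat p R G x = (\<lambda>n\<in>{1..}. Det_proj p R G n x)"

text \<open>At level \<open>n\<close> a class in \<open>K\<^sub>1((R/p\<^sup>nR)[G])\<close> is lifted to \<open>K\<^sub>1(R[G])\<close>, and \<open>Det\<close> of the lift is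
  taken modulo \<open>Det(1 + p\<^sup>n M(R[G]))\<close>.\<close>

definition K1_hat_to_Det_hat ::
    "nat \<Rightarrow> 'r::idom ring \<Rightarrow> ('g, 'm) monoid_scheme \<Rightarrow>
     (nat \<Rightarrow> (nat \<Rightarrow> nat \<Rightarrow> 'g \<Rightarrow> 'r set) set) \<Rightarrow>
     nat \<Rightarrow> (('g \<Rightarrow> 'r fract alg_closure) \<Rightarrow> 'r fract alg_closure) set" where
  "K1_hat_to_Det_hat p R G x = (\<lambda>n\<in>{1..}.
     on_cosets (\<lambda>Y. Det_proj p R G n (Det G Y))
       {Y \<in> carrier (K1 (group_ring R G)). K1_reduction p R G n Y = x n})"

end

theory Submission
  imports Defs
begin

text \<open>
  Write \<open>A = R[G]\<close>, \<open>N\<close> for the field of fractions of \<open>R\<close>, \<open>N\<^sup>c\<close> for its algebraic closure, and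
  \<open>C\<^sub>n\<close> for the subgroup \<open>Det(1 + p\<^sup>n M(A))\<close> of \<open>D = Det(K\<^sub>1(A))\<close>. Three facts carry the proof.

  First, \<open>A\<close> is \<open>p\<close>-adically complete, so \<open>1 + a\<close> is a unit for every \<open>a \<in> pA\<close> (geometric series, lemma
  \<open>one_plus_J_unit\<close>). Hence every matrix over \<open>A\<close> that is invertible modulo \<open>p\<^sup>n\<close> is invertible, and
  \<open>K\<^sub>1(A) \<rightarrow> K\<^sub>1(A/p\<^sup>n)\<close> is surjective with the classes of \<open>1 + p\<^sup>n M(A)\<close> as kernel (\<open>K1_map_surj\<close>,
  \<open>K1_map_kernel\<close>). So \<open>Det\<close> induces \<open>K\<^sub>1(A/p\<^sup>n) \<rightarrow> D/C\<^sub>n\<close>, and the kernel of this map is the image of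
  \<open>SK\<^sub>1(A)\<close>.

  Second, \<open>D\<close> is complete for the filtration by the \<open>C\<^sub>n\<close> (\<open>Det_complete\<close>). Elimination of columns reduces
  a matrix in \<open>1 + p\<^sup>n M(A)\<close> by elementary matrices to a single entry \<open>1 + a\<close> with \<open>a \<in> p\<^sup>nA\<close>
  (\<open>reduce_columns\<close>), so \<open>C\<^sub>n = Det(1 + p\<^sup>nA)\<close>. A compatible sequence in the quotients \<open>D/C\<^sub>n\<close> therefore
  moves from one level to the next by factors \<open>Det(1 + a\<^sub>n)\<close> with \<open>a\<^sub>n \<in> p\<^sup>nA\<close>, and the product of the
  \<open>1 + a\<^sub>n\<close> converges in \<open>A\<close> (\<open>infinite_product\<close>).

  Third, the \<open>C\<^sub>n\<close> intersect in the trivial group (\<open>Det_separated\<close>). For a representation \<open>\<rho>\<close> of degree \<open>d\<close>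
  the determinant of \<open>1 + p\<^sup>n \<Sum> a\<^sub>g \<rho>(g)\<close> is a polynomial of degree at most \<open>d\<close> in the \<open>p\<^sup>n a\<^sub>g\<close> with constant
  term \<open>1\<close>, whose coefficients in \<open>N\<^sup>c\<close> depend only on \<open>\<rho>\<close>. So it lies in \<open>1 + p\<^sup>nS\<close> for a finitely
  generated \<open>R\<close>-submodule \<open>S\<close> of \<open>N\<^sup>c\<close> that depends only on \<open>\<rho>\<close> (\<open>Det_rep_unit_class\<close>). Such an \<open>S\<close> is
  \<open>p\<close>-adically separated: an \<open>N\<close>-linear functional \<open>N\<^sup>c \<rightarrow> N\<close> maps it into \<open>R\<close> up to a common denominator,
  and \<open>R\<close> is separated (\<open>coeff_span_separated\<close>).

  Given these facts, both assertions are statements about towers of abelian groups, proved in the locale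
  \<open>congruence_tower\<close>.
\<close>

section \<open>Towers of quotients of abelian groups\<close>

lemma on_cosets_eq:
  assumes "y \<in> Y" and "\<And>z. z \<in> Y \<Longrightarrow> f z = f y"
  shows "on_cosets f Y = f y"
proof -
  have "f ` Y = {f y}" using assms by blast
  then show ?thesis by (simp add: on_cosets_def)
qed

lemma (in normal) on_cosets_rcos:
  assumes "x \<in> carrier G" and "\<And>h y. h \<in> H \<Longrightarrow> y \<in> carrier G \<Longrightarrow> f (h \<otimes> y) = f y"
  shows "on_cosets f (H #> x) = f x"
proof (rule on_cosets_eq)
  show "x \<in> H #> x" by (rule rcos_self[OF assms(1) subgroup_axioms])
  show "f z = f x" if z: "z \<in> H #> x" for z
  proof -
    obtain h where "h \<in> H" "z = h \<otimes> x" using z by (auto simp: r_coset_def)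
    then show ?thesis using assms(2)[OF _ assms(1)] by simp
  qed
qed

lemma inverse_limit_setI:
  assumes "x \<in> extensional {1..}" "\<And>n. n \<ge> 1 \<Longrightarrow> x n \<in> A n"
    and "\<And>n. n \<ge> 1 \<Longrightarrow> \<pi> n (x (Suc n)) = x n"
  shows "x \<in> inverse_limit_set A \<pi>"
  using assms by (auto simp: inverse_limit_set_def PiE_iff)

lemma inverse_limit_setD:
  assumes "x \<in> inverse_limit_set A \<pi>"
  shows "x \<in> extensional {1..}" "\<And>n. n \<ge> 1 \<Longrightarrow> x n \<in> A n"
    and "\<And>n. n \<ge> 1 \<Longrightarrow> \<pi> n (x (Suc n)) = x n"
  using assms by (auto simp: inverse_limit_set_def PiE_iff)

lemma carrier_inverse_limit_group [simp]:
  "carrier (inverse_limit_group H \<pi>) = inverse_limit_set (\<lambda>n. carrier (H n)) \<pi>"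
  by (simp add: inverse_limit_group_def)

lemma mult_inverse_limit_group [simp]:
  "monoid.mult (inverse_limit_group H \<pi>) = (\<lambda>x y. \<lambda>n\<in>{1..}. x n \<otimes>\<^bsub>H n\<^esub> y n)"
  by (simp add: inverse_limit_group_def product_group_def)

lemma one_inverse_limit_group [simp]:
  "one (inverse_limit_group H \<pi>) = (\<lambda>n\<in>{1..}. \<one>\<^bsub>H n\<^esub>)"
  by (simp add: inverse_limit_group_def product_group_def)

lemma inverse_limit_group_is_group:
  assumes H: "\<And>n. n \<ge> 1 \<Longrightarrow> Group.group (H n)"
    and \<pi>: "\<And>n. n \<ge> 1 \<Longrightarrow> \<pi> n \<in> hom (H (Suc n)) (H n)"
  shows "Group.group (inverse_limit_group H \<pi>)"
proof -
  have P: "Group.group (product_group {1..} H)" by (rule product_group) (use H in auto)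
  have "subgroup (inverse_limit_set (\<lambda>n. carrier (H n)) \<pi>) (product_group {1..} H)"
  proof (rule group.subgroupI[OF P])
    show "inverse_limit_set (\<lambda>n. carrier (H n)) \<pi> \<subseteq> carrier (product_group {1..} H)"
      by (auto simp: inverse_limit_set_def)
    have h1: "\<pi> n \<one>\<^bsub>H (Suc n)\<^esub> = \<one>\<^bsub>H n\<^esub>" if "n \<ge> 1" for n
      using that \<pi> H hom_one by fastforce
    have "(\<lambda>n\<in>{1..}. \<one>\<^bsub>H n\<^esub>) \<in> inverse_limit_set (\<lambda>n. carrier (H n)) \<pi>"
      by (rule inverse_limit_setI) (auto simp: h1 H group.is_monoid)
    then show "inverse_limit_set (\<lambda>n. carrier (H n)) \<pi> \<noteq> {}" by blast
  next
    fix a assume a: "a \<in> inverse_limit_set (\<lambda>n. carrier (H n)) \<pi>"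
    note a' = inverse_limit_setD[OF a]
    have ac: "a \<in> (\<Pi>\<^sub>E n\<in>{1..}. carrier (H n))" using a by (auto simp: inverse_limit_set_def)
    have "\<pi> n (inv\<^bsub>H (Suc n)\<^esub> a (Suc n)) = inv\<^bsub>H n\<^esub> a n" if n: "n \<ge> 1" for n
      using group_hom.hom_inv[of "H (Suc n)" "H n" "\<pi> n" "a (Suc n)"] n a' H \<pi>
      by (auto simp: group_hom_def group_hom_axioms_def)
    then show "inv\<^bsub>product_group {1..} H\<^esub> a \<in> inverse_limit_set (\<lambda>n. carrier (H n)) \<pi>"
      using a' H ac by (subst inv_product_group) (auto intro!: inverse_limit_setI)
  next
    fix a b assume a: "a \<in> inverse_limit_set (\<lambda>n. carrier (H n)) \<pi>"
      and b: "b \<in> inverse_limit_set (\<lambda>n. carrier (H n)) \<pi>"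
    note a' = inverse_limit_setD[OF a] and b' = inverse_limit_setD[OF b]
    have "\<pi> n (a (Suc n) \<otimes>\<^bsub>H (Suc n)\<^esub> b (Suc n)) = a n \<otimes>\<^bsub>H n\<^esub> b n" if n: "n \<ge> 1" for n
      using hom_mult[OF \<pi>[OF n], of "a (Suc n)" "b (Suc n)"] n a' b' by auto
    then show "a \<otimes>\<^bsub>product_group {1..} H\<^esub> b \<in> inverse_limit_set (\<lambda>n. carrier (H n)) \<pi>"
      using a' b' H by (auto intro!: inverse_limit_setI monoid.m_closed group.is_monoid)
  qed
  from subgroup.subgroup_is_group[OF this P] show ?thesis
    by (simp add: inverse_limit_group_def)
qed

lemma inverse_limit_group_homI:
  assumes f: "\<And>n. n \<ge> 1 \<Longrightarrow> f n \<in> hom A (H n)"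
    and c: "\<And>n x. n \<ge> 1 \<Longrightarrow> x \<in> carrier A \<Longrightarrow> \<pi> n (f (Suc n) x) = f n x"
  shows "(\<lambda>x. \<lambda>n\<in>{1..}. f n x) \<in> hom A (inverse_limit_group H \<pi>)"
proof (rule homI)
  fix x assume "x \<in> carrier A"
  then show "(\<lambda>n\<in>{1..}. f n x) \<in> carrier (inverse_limit_group H \<pi>)"
    using c hom_in_carrier[OF f] by (auto intro!: inverse_limit_setI)
next
  fix x y assume "x \<in> carrier A" "y \<in> carrier A"
  then show "(\<lambda>n\<in>{1..}. f n (x \<otimes>\<^bsub>A\<^esub> y))
     = (\<lambda>n\<in>{1..}. f n x) \<otimes>\<^bsub>inverse_limit_group H \<pi>\<^esub> (\<lambda>n\<in>{1..}. f n y)"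
    using f by (auto simp: hom_mult intro!: restrict_ext)
qed

text \<open>The formal part of the proof. In the application \<open>K\<close> is \<open>K\<^sub>1(A)\<close>, \<open>\<delta>\<close> is \<open>Det\<close> onto its image \<open>D\<close>, and
  \<open>Q n\<close> is \<open>K\<^sub>1(A/p\<^sup>n)\<close>. The last two assumptions say that \<open>D\<close> is Hausdorff and complete for the
  filtration by the subgroups \<open>C n\<close>.\<close>

locale congruence_tower =
  K: comm_group K + D: comm_group D + delta: group_hom K D \<delta>
  for K :: "'k monoid" and D :: "'d monoid" and \<delta> :: "'k \<Rightarrow> 'd" +
  fixes Q :: "nat \<Rightarrow> 'q monoid" and \<pi> :: "nat \<Rightarrow> 'k \<Rightarrow> 'q" and t :: "nat \<Rightarrow> 'q \<Rightarrow> 'q"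
    and C :: "nat \<Rightarrow> 'd set"
  assumes delta_surj: "\<delta> ` carrier K = carrier D"
    and Q_group: "\<And>n. n \<ge> 1 \<Longrightarrow> Group.group (Q n)"
    and pi_hom: "\<And>n. n \<ge> 1 \<Longrightarrow> \<pi> n \<in> hom K (Q n)"
    and pi_surj: "\<And>n. n \<ge> 1 \<Longrightarrow> \<pi> n ` carrier K = carrier (Q n)"
    and pi_compat: "\<And>n Y. n \<ge> 1 \<Longrightarrow> Y \<in> carrier K \<Longrightarrow> t n (\<pi> (Suc n) Y) = \<pi> n Y"
    and C_eq: "\<And>n. n \<ge> 1 \<Longrightarrow> C n = \<delta> ` kernel K (Q n) (\<pi> n)"
    and separated: "\<And>d. (\<And>n. n \<ge> 1 \<Longrightarrow> d \<in> C n) \<Longrightarrow> d = \<one>\<^bsub>D\<^esub>"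
    and complete: "\<And>d. (\<And>n. n \<ge> 1 \<Longrightarrow> d n \<in> carrier D) \<Longrightarrow>
       (\<And>n. n \<ge> 1 \<Longrightarrow> d (Suc n) \<in> C n #>\<^bsub>D\<^esub> d n) \<Longrightarrow>
       \<exists>e\<in>carrier D. \<forall>n\<ge>1. e \<in> C n #>\<^bsub>D\<^esub> d n"
begin

lemma pi_group_hom: "n \<ge> 1 \<Longrightarrow> group_hom K (Q n) (\<pi> n)"
  by (simp add: group_hom_def group_hom_axioms_def Q_group pi_hom K.is_group)

lemma t_hom:
  assumes "n \<ge> 1"
  shows "t n \<in> hom (Q (Suc n)) (Q n)"
proof (rule homI)
  fix x assume "x \<in> carrier (Q (Suc n))"
  then obtain Y where "Y \<in> carrier K" "x = \<pi> (Suc n) Y" using pi_surj[of "Suc n"] by auto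
  then show "t n x \<in> carrier (Q n)" using assms pi_compat pi_surj[of n] by auto
next
  fix x y assume "x \<in> carrier (Q (Suc n))" "y \<in> carrier (Q (Suc n))"
  then obtain Z Y where *: "Z \<in> carrier K" "x = \<pi> (Suc n) Z" "Y \<in> carrier K" "y = \<pi> (Suc n) Y"
    using pi_surj[of "Suc n"] by (metis imageE le_add1 plus_1_eq_Suc)
  then have "x \<otimes>\<^bsub>Q (Suc n)\<^esub> y = \<pi> (Suc n) (Z \<otimes>\<^bsub>K\<^esub> Y)"
    using hom_mult[OF pi_hom[of "Suc n"]] by auto
  then show "t n (x \<otimes>\<^bsub>Q (Suc n)\<^esub> y) = t n x \<otimes>\<^bsub>Q n\<^esub> t n y"
    using * assms pi_compat hom_mult[OF pi_hom[of n]] by auto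
qed

lemma C_subgroup:
  assumes "n \<ge> 1" shows "subgroup (C n) D"
  using assms C_eq delta.subgroup_img_is_subgroup group_hom.subgroup_kernel[OF pi_group_hom] by simp

lemma C_normal: "n \<ge> 1 \<Longrightarrow> normal (C n) D"
  by (simp add: C_subgroup D.subgroup_imp_normal)

lemma C_decreasing: "n \<ge> 1 \<Longrightarrow> C (Suc n) \<subseteq> C n"
proof -
  assume n: "n \<ge> 1"
  have "kernel K (Q (Suc n)) (\<pi> (Suc n)) \<subseteq> kernel K (Q n) (\<pi> n)"
  proof
    fix Y assume "Y \<in> kernel K (Q (Suc n)) (\<pi> (Suc n))"
    then have Y: "Y \<in> carrier K" "\<pi> (Suc n) Y = \<one>\<^bsub>Q (Suc n)\<^esub>" by (auto simp: kernel_def)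
    have "\<pi> n Y = t n \<one>\<^bsub>Q (Suc n)\<^esub>" using pi_compat[OF n Y(1)] Y(2) by simp
    also have "\<dots> = \<one>\<^bsub>Q n\<^esub>" using hom_one[OF t_hom[OF n]] Q_group n by simp
    finally show "Y \<in> kernel K (Q n) (\<pi> n)" using Y by (auto simp: kernel_def)
  qed
  then show ?thesis using C_eq n by auto
qed

lemma coset_eq_iff:
  assumes "n \<ge> 1" "x \<in> carrier D" "y \<in> carrier D"
  shows "C n #>\<^bsub>D\<^esub> x = C n #>\<^bsub>D\<^esub> y \<longleftrightarrow> x \<in> C n #>\<^bsub>D\<^esub> y"
  using D.repr_independence[OF _ assms(3) C_subgroup[OF assms(1)]]
    D.rcos_self[OF assms(2) C_subgroup[OF assms(1)]] by metis

lemma coset_mem_iff: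
  assumes "n \<ge> 1" "x \<in> carrier D" "y \<in> carrier D"
  shows "x \<in> C n #>\<^bsub>D\<^esub> y \<longleftrightarrow> x \<otimes>\<^bsub>D\<^esub> inv\<^bsub>D\<^esub> y \<in> C n"
  using subgroup.rcos_module[OF C_subgroup[OF assms(1)] D.is_group assms(3,2)] .

abbreviation proj :: "nat \<Rightarrow> 'd \<Rightarrow> 'd set" where "proj n x \<equiv> C n #>\<^bsub>D\<^esub> x"
abbreviation D_hat where "D_hat \<equiv> inverse_limit_group (\<lambda>n. D Mod C n) (\<lambda>n. on_cosets (proj n))"

lemma trans_proj:
  assumes n: "n \<ge> 1" and x: "x \<in> carrier D"
  shows "on_cosets (proj n) (proj (Suc n) x) = proj n x"
proof (rule normal.on_cosets_rcos[OF C_normal x])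
  fix h y assume h: "h \<in> C (Suc n)" and y: "y \<in> carrier D"
  then have hC: "h \<in> C n" using C_decreasing n by auto
  then have "h \<otimes>\<^bsub>D\<^esub> y \<in> proj n y" by (auto simp: r_coset_def)
  then show "proj n (h \<otimes>\<^bsub>D\<^esub> y) = proj n y"
    using D.repr_independence[OF _ y C_subgroup[OF n]] by metis
qed simp

lemma D_hat_group: "Group.group D_hat"
proof (rule inverse_limit_group_is_group)
  fix n :: nat assume n: "n \<ge> 1"
  show "Group.group (D Mod C n)" using C_normal[OF n] by (rule normal.factorgroup_is_group)
  have "Suc n \<ge> 1" by simp
  note S = C_normal[OF this]
  show "on_cosets (proj n) \<in> hom (D Mod C (Suc n)) (D Mod C n)"
  proof (rule homI)
    fix Z assume "Z \<in> carrier (D Mod C (Suc n))"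
    then show "on_cosets (proj n) Z \<in> carrier (D Mod C n)"
      using n trans_proj by (auto simp: carrier_FactGroup)
  next
    fix Z Y assume "Z \<in> carrier (D Mod C (Suc n))" "Y \<in> carrier (D Mod C (Suc n))"
    then obtain x y where "x \<in> carrier D" "Z = proj (Suc n) x" "y \<in> carrier D" "Y = proj (Suc n) y"
      by (auto simp: carrier_FactGroup)
    then show "on_cosets (proj n) (Z \<otimes>\<^bsub>D Mod C (Suc n)\<^esub> Y)
        = on_cosets (proj n) Z \<otimes>\<^bsub>D Mod C n\<^esub> on_cosets (proj n) Y"
      using n by (simp add: normal.rcos_sum[OF S] normal.rcos_sum[OF C_normal[OF n]] trans_proj)
  qed
qed

lemma to_D_hat_hom: "(\<lambda>x. \<lambda>n\<in>{1..}. proj n x) \<in> hom D D_hat"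
proof (rule inverse_limit_group_homI)
  show "proj n \<in> hom D (D Mod C n)" if "n \<ge> 1" for n
    using normal.r_coset_hom_Mod[OF C_normal[OF that]] .
qed (rule trans_proj)

lemma D_hat_surj:
  assumes y: "y \<in> carrier D_hat"
  obtains e where "e \<in> carrier D" "y = (\<lambda>n\<in>{1..}. proj n e)"
proof -
  note y' = inverse_limit_setD[OF y[simplified]]
  have "\<exists>d. d \<in> carrier D \<and> y n = proj n d" if "n \<ge> 1" for n
    using y'(2)[OF that] by (auto simp: carrier_FactGroup)
  then obtain d where d: "\<And>n. n \<ge> 1 \<Longrightarrow> d n \<in> carrier D" "\<And>n. n \<ge> 1 \<Longrightarrow> y n = proj n (d n)"
    by metis
  have "d (Suc n) \<in> proj n (d n)" if n: "n \<ge> 1" for n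
  proof -
    have "proj n (d (Suc n)) = proj n (d n)"
      using y'(3)[OF n] d n trans_proj[OF n, of "d (Suc n)"] by simp
    then show ?thesis using coset_eq_iff d n by simp
  qed
  from complete[OF d(1) this] obtain e where e: "e \<in> carrier D" "\<And>n. n \<ge> 1 \<Longrightarrow> e \<in> proj n (d n)"
    by blast
  have "y = (\<lambda>n\<in>{1..}. proj n e)"
  proof (rule extensionalityI[OF y'(1)])
    fix n :: nat assume "n \<in> {1..}"
    then show "y n = (\<lambda>n\<in>{1..}. proj n e) n" using coset_eq_iff[of n e "d n"] e d by simp
  qed simp
  then show thesis using that e(1) by blast
qed

text \<open>Injectivity is the separatedness of the filtration, surjectivity its completeness.\<close>

theorem to_D_hat_iso: "(\<lambda>x. \<lambda>n\<in>{1..}. proj n x) \<in> iso D D_hat"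
proof -
  interpret h: group_hom D D_hat "\<lambda>x. \<lambda>n\<in>{1..}. proj n x"
    using to_D_hat_hom D_hat_group D.is_group by (simp only: group_hom_def group_hom_axioms_def)
  show ?thesis unfolding h.iso_iff
  proof (intro conjI ballI impI subsetI)
    fix y assume "y \<in> carrier D_hat"
    then show "y \<in> (\<lambda>x. \<lambda>n\<in>{1..}. proj n x) ` carrier D" by (elim D_hat_surj) simp
  next
    fix x assume x: "x \<in> carrier D" and "(\<lambda>n\<in>{1..}. proj n x) = \<one>\<^bsub>D_hat\<^esub>"
    then have eq: "proj n x = C n" if "n \<ge> 1" for n
      using that by (auto dest!: fun_cong[where x=n])
    show "x = \<one>\<^bsub>D\<^esub>"
    proof (rule separated)
      fix n :: nat assume n: "n \<ge> 1"
      show "x \<in> C n" using eq[OF n] D.rcos_self[OF x C_subgroup[OF n]] by simp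
    qed
  qed
qed

definition level_map :: "nat \<Rightarrow> 'q \<Rightarrow> 'd set" where
  "level_map n q = on_cosets (\<lambda>Y. proj n (\<delta> Y)) {Y \<in> carrier K. \<pi> n Y = q}"

text \<open>Two lifts of an element of \<open>Q n\<close> differ by an element of the kernel of \<open>\<pi> n\<close>, and \<open>\<delta>\<close> sends that kernel
  onto \<open>C n\<close>; so the value does not depend on the lift.\<close>

lemma level_map_pi:
  assumes n: "n \<ge> 1" and Y: "Y \<in> carrier K"
  shows "level_map n (\<pi> n Y) = proj n (\<delta> Y)"
  unfolding level_map_def
proof (rule on_cosets_eq)
  show "Y \<in> {Y' \<in> carrier K. \<pi> n Y' = \<pi> n Y}" using Y by simp
  fix Z assume "Z \<in> {Y' \<in> carrier K. \<pi> n Y' = \<pi> n Y}"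
  then have Z: "Z \<in> carrier K" "\<pi> n Z = \<pi> n Y" by auto
  interpret pin: group_hom K "Q n" "\<pi> n" by (rule pi_group_hom[OF n])
  have "Z \<otimes>\<^bsub>K\<^esub> inv\<^bsub>K\<^esub> Y \<in> kernel K (Q n) (\<pi> n)"
    using Z Y by (simp add: kernel_def)
  then have "\<delta> (Z \<otimes>\<^bsub>K\<^esub> inv\<^bsub>K\<^esub> Y) \<in> C n" using C_eq[OF n] by simp
  then have "\<delta> Z \<otimes>\<^bsub>D\<^esub> inv\<^bsub>D\<^esub> \<delta> Y \<in> C n" using Z Y by simp
  then show "proj n (\<delta> Z) = proj n (\<delta> Y)"
    using Z Y n by (simp add: coset_eq_iff coset_mem_iff)
qed

lemma level_map_hom:
  assumes n: "n \<ge> 1" shows "level_map n \<in> hom (Q n) (D Mod C n)"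
proof (rule homI)
  fix x assume "x \<in> carrier (Q n)"
  then obtain Y where "Y \<in> carrier K" "x = \<pi> n Y" using pi_surj[OF n] by auto
  then show "level_map n x \<in> carrier (D Mod C n)"
    using n by (auto simp: level_map_pi carrier_FactGroup)
next
  fix x y assume "x \<in> carrier (Q n)" "y \<in> carrier (Q n)"
  then obtain Z Y where *: "Z \<in> carrier K" "x = \<pi> n Z" "Y \<in> carrier K" "y = \<pi> n Y"
    using pi_surj[OF n] by (metis imageE)
  then have "x \<otimes>\<^bsub>Q n\<^esub> y = \<pi> n (Z \<otimes>\<^bsub>K\<^esub> Y)" using hom_mult[OF pi_hom[OF n]] by auto
  then show "level_map n (x \<otimes>\<^bsub>Q n\<^esub> y) = level_map n x \<otimes>\<^bsub>D Mod C n\<^esub> level_map n y"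
    using * n by (simp add: level_map_pi normal.rcos_sum[OF C_normal])
qed

text \<open>If \<open>\<delta> Y = \<delta> g\<close> with \<open>g\<close> in the kernel of \<open>\<pi> n\<close>, then \<open>Y g\<^sup>-\<^sup>1\<close> lies in the kernel of \<open>\<delta>\<close> and has the same
  image as \<open>Y\<close> in \<open>Q n\<close>.\<close>

lemma level_map_one_iff:
  assumes n: "n \<ge> 1" and q: "q \<in> carrier (Q n)"
  shows "level_map n q = C n \<longleftrightarrow> q \<in> \<pi> n ` kernel K D \<delta>"
proof -
  interpret pin: group_hom K "Q n" "\<pi> n" by (rule pi_group_hom[OF n])
  obtain Y where Y: "Y \<in> carrier K" "q = \<pi> n Y" using pi_surj[OF n] q by auto
  have "level_map n q = C n \<longleftrightarrow> \<delta> Y \<in> C n"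
    using D.coset_join1[OF _ _ C_subgroup[OF n]] D.coset_join2[OF _ C_subgroup[OF n]] Y n
    by (metis level_map_pi delta.hom_closed)
  also have "\<dots> \<longleftrightarrow> q \<in> \<pi> n ` kernel K D \<delta>"
  proof
    assume "\<delta> Y \<in> C n"
    then obtain g where g: "g \<in> carrier K" "\<pi> n g = \<one>\<^bsub>Q n\<^esub>" "\<delta> Y = \<delta> g"
      unfolding C_eq[OF n] by (auto simp: kernel_def)
    have "Y \<otimes>\<^bsub>K\<^esub> inv\<^bsub>K\<^esub> g \<in> kernel K D \<delta>" using g Y by (simp add: kernel_def)
    moreover have "q = \<pi> n (Y \<otimes>\<^bsub>K\<^esub> inv\<^bsub>K\<^esub> g)" using g Y by simp
    ultimately show "q \<in> \<pi> n ` kernel K D \<delta>" by blast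
  next
    assume "q \<in> \<pi> n ` kernel K D \<delta>"
    then obtain s where s: "s \<in> carrier K" "\<delta> s = \<one>\<^bsub>D\<^esub>" "\<pi> n s = \<pi> n Y"
      using Y by (auto simp: kernel_def)
    then have "Y \<otimes>\<^bsub>K\<^esub> inv\<^bsub>K\<^esub> s \<in> kernel K (Q n) (\<pi> n)" using Y by (simp add: kernel_def)
    then have "\<delta> (Y \<otimes>\<^bsub>K\<^esub> inv\<^bsub>K\<^esub> s) \<in> C n" using C_eq[OF n] by simp
    then show "\<delta> Y \<in> C n" using s Y by simp
  qed
  finally show ?thesis .
qed

lemma level_map_trans:
  assumes n: "n \<ge> 1" and q: "q \<in> carrier (Q (Suc n))"
  shows "on_cosets (proj n) (level_map (Suc n) q) = level_map n (t n q)"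
proof -
  obtain Y where Y: "Y \<in> carrier K" "q = \<pi> (Suc n) Y" using pi_surj[of "Suc n"] q by auto
  then show ?thesis using n by (simp add: level_map_pi trans_proj pi_compat)
qed

text \<open>The kernel in the limit is formed level by level, where \<open>level_map_one_iff\<close> describes it. Surjectivity in
  the limit does not follow from surjectivity at the levels; instead, a compatible sequence comes from
  one element of \<open>D\<close> by completeness, and that element lifts to \<open>K\<close>.\<close>

theorem tower_short_exact:
  "short_exact (inverse_limit_group (\<lambda>n. (Q n)\<lparr>carrier := \<pi> n ` kernel K D \<delta>\<rparr>) t) (\<lambda>x. x)
     (inverse_limit_group Q t) (\<lambda>x. \<lambda>n\<in>{1..}. level_map n (x n)) D_hat"
proof -
  let ?S = "\<lambda>n. (Q n)\<lparr>carrier := \<pi> n ` kernel K D \<delta>\<rparr>"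
  let ?h = "\<lambda>x. \<lambda>n\<in>{1..}. level_map n (x n)"
  have sub: "subgroup (\<pi> n ` kernel K D \<delta>) (Q n)" if "n \<ge> 1" for n
    using group_hom.subgroup_img_is_subgroup[OF pi_group_hom[OF that] delta.subgroup_kernel] .
  have Sg: "Group.group (?S n)" if "n \<ge> 1" for n
    using subgroup.subgroup_is_group[OF sub Q_group] that by simp
  have St: "t n \<in> hom (?S (Suc n)) (?S n)" if n: "n \<ge> 1" for n
  proof (rule homI)
    fix x assume "x \<in> carrier (?S (Suc n))"
    then show "t n x \<in> carrier (?S n)" using pi_compat[OF n] by (auto simp: kernel_def)
  next
    fix x y assume "x \<in> carrier (?S (Suc n))" "y \<in> carrier (?S (Suc n))"
    then have "x \<in> carrier (Q (Suc n))" "y \<in> carrier (Q (Suc n))"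
      using subgroup.mem_carrier[OF sub[of "Suc n"]] by auto
    then show "t n (x \<otimes>\<^bsub>?S (Suc n)\<^esub> y) = t n x \<otimes>\<^bsub>?S n\<^esub> t n y"
      using hom_mult[OF t_hom[OF n]] by simp
  qed
  have gS: "Group.group (inverse_limit_group ?S t)"
    using inverse_limit_group_is_group[of ?S t] Sg St by simp
  have gQ: "Group.group (inverse_limit_group Q t)"
    using inverse_limit_group_is_group[of Q t] Q_group t_hom by simp
  have incl: "x \<in> carrier (inverse_limit_group Q t)" if "x \<in> carrier (inverse_limit_group ?S t)" for x
    using inverse_limit_setD[OF that[simplified]] subgroup.mem_carrier[OF sub]
    by (auto intro!: inverse_limit_setI)
  have id_hom: "(\<lambda>x. x) \<in> hom (inverse_limit_group ?S t) (inverse_limit_group Q t)"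
    by (rule homI) (use incl in auto)
  have h_hom: "?h \<in> hom (inverse_limit_group Q t) D_hat"
  proof (rule inverse_limit_group_homI)
    fix n :: nat assume n: "n \<ge> 1"
    show "(\<lambda>x. level_map n (x n)) \<in> hom (inverse_limit_group Q t) (D Mod C n)"
    proof (rule homI)
      fix x assume "x \<in> carrier (inverse_limit_group Q t)"
      then show "level_map n (x n) \<in> carrier (D Mod C n)"
        using hom_in_carrier[OF level_map_hom[OF n]]
          inverse_limit_setD(2)[of x "\<lambda>n. carrier (Q n)" t, OF _ n] by simp
    next
      fix x y assume "x \<in> carrier (inverse_limit_group Q t)" "y \<in> carrier (inverse_limit_group Q t)"
      then show "level_map n ((x \<otimes>\<^bsub>inverse_limit_group Q t\<^esub> y) n)
          = level_map n (x n) \<otimes>\<^bsub>D Mod C n\<^esub> level_map n (y n)"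
        using hom_mult[OF level_map_hom[OF n]] n
          inverse_limit_setD(2)[of _ "\<lambda>n. carrier (Q n)" t, OF _ n]
        by (simp del: mult_FactGroup)
    qed
    fix x assume "x \<in> carrier (inverse_limit_group Q t)"
    then show "on_cosets (proj n) (level_map (Suc n) (x (Suc n))) = level_map n (x n)"
      using n inverse_limit_setD[of x "\<lambda>n. carrier (Q n)" t] by (simp add: level_map_trans)
  qed
  have ker: "carrier (inverse_limit_group ?S t) = kernel (inverse_limit_group Q t) D_hat ?h"
  proof (intro equalityI subsetI)
    fix x assume x: "x \<in> carrier (inverse_limit_group ?S t)"
    then have "x n \<in> \<pi> n ` kernel K D \<delta>" if "n \<ge> 1" for n
      using inverse_limit_setD(2)[OF x[simplified] that] by simp
    then have "level_map n (x n) = C n" if "n \<ge> 1" for n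
      using that subgroup.mem_carrier[OF sub[OF that]] level_map_one_iff[OF that] by simp
    then show "x \<in> kernel (inverse_limit_group Q t) D_hat ?h"
      using incl[OF x] by (auto simp: kernel_def intro!: restrict_ext)
  next
    fix x assume "x \<in> kernel (inverse_limit_group Q t) D_hat ?h"
    then have x: "x \<in> carrier (inverse_limit_group Q t)" and e: "?h x = \<one>\<^bsub>D_hat\<^esub>"
      by (auto simp: kernel_def)
    note x' = inverse_limit_setD[OF x[simplified]]
    have "level_map n (x n) = C n" if "n \<ge> 1" for n
      using that fun_cong[OF e, of n] by simp
    then have "x n \<in> \<pi> n ` kernel K D \<delta>" if "n \<ge> 1" for n
      using that level_map_one_iff[OF that x'(2)[OF that]] by simp
    then show "x \<in> carrier (inverse_limit_group ?S t)"
      using x' by (auto intro!: inverse_limit_setI)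
  qed
  have surj: "?h ` carrier (inverse_limit_group Q t) = carrier D_hat"
  proof (intro equalityI subsetI)
    fix y assume "y \<in> ?h ` carrier (inverse_limit_group Q t)"
    then show "y \<in> carrier D_hat" using hom_in_carrier[OF h_hom] by auto
  next
    fix y assume "y \<in> carrier D_hat"
    then obtain e where e: "e \<in> carrier D" "y = (\<lambda>n\<in>{1..}. proj n e)" by (rule D_hat_surj)
    then obtain Y where Y: "Y \<in> carrier K" "e = \<delta> Y" using delta_surj by auto
    let ?x = "\<lambda>n\<in>{1..}. \<pi> n Y"
    have "?x \<in> carrier (inverse_limit_group Q t)"
      using Y pi_compat hom_in_carrier[OF pi_hom] by (auto intro!: inverse_limit_setI)
    moreover have "?h ?x = y" using e Y by (auto simp: level_map_pi intro!: restrict_ext)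
    ultimately show "y \<in> ?h ` carrier (inverse_limit_group Q t)" by blast
  qed
  show ?thesis unfolding short_exact_def
  proof (intro conjI)
    show "group_hom (inverse_limit_group ?S t) (inverse_limit_group Q t) (\<lambda>x. x)"
      using gS gQ id_hom by (simp add: group_hom_def group_hom_axioms_def)
    show "group_hom (inverse_limit_group Q t) D_hat ?h"
      using gQ D_hat_group h_hom by (simp add: group_hom_def group_hom_axioms_def)
  qed (use ker surj in auto)
qed

end

section \<open>Stable matrices over a ring\<close>

lemma (in abelian_monoid) finsum_swap:
  assumes "finite I" "finite J" "\<And>i j. i \<in> I \<Longrightarrow> j \<in> J \<Longrightarrow> f i j \<in> carrier G"
  shows "(\<Oplus>i\<in>I. \<Oplus>j\<in>J. f i j) = (\<Oplus>j\<in>J. \<Oplus>i\<in>I. f i j)"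
  using assms(1,3)
proof (induction I)
  case (insert k I)
  have "(\<Oplus>i\<in>insert k I. \<Oplus>j\<in>J. f i j) = (\<Oplus>j\<in>J. f k j) \<oplus> (\<Oplus>i\<in>I. \<Oplus>j\<in>J. f i j)"
    using insert by (intro finsum_insert) (auto intro!: finsum_closed)
  also have "\<dots> = (\<Oplus>j\<in>J. f k j) \<oplus> (\<Oplus>j\<in>J. \<Oplus>i\<in>I. f i j)"
    using insert by simp
  also have "\<dots> = (\<Oplus>j\<in>J. f k j \<oplus> (\<Oplus>i\<in>I. f i j))"
    using insert by (intro finsum_addf[symmetric]) (auto intro!: finsum_closed)
  also have "\<dots> = (\<Oplus>j\<in>J. \<Oplus>i\<in>insert k I. f i j)"
    using insert by (intro finsum_cong' refl finsum_insert[symmetric]) (auto intro!: finsum_closed)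
  finally show ?case .
qed simp

lemma (in abelian_monoid) finsum_single:
  assumes "finite S" "k \<in> S" "f k \<in> carrier G" "\<And>l. l \<in> S \<Longrightarrow> l \<noteq> k \<Longrightarrow> f l = \<zero>"
  shows "finsum G f S = f k"
proof -
  have "finsum G f S = finsum G f {k}"
  proof (rule add.finprod_mono_neutral_cong_right)
    show "f \<in> S \<rightarrow> carrier G"
    proof
      fix x assume "x \<in> S"
      then show "f x \<in> carrier G" using assms by (cases "x = k") auto
    qed
  qed (use assms in auto)
  then show ?thesis using assms by simp
qed

locale matrix_ring = ring A for A :: "'a ring" (structure)
begin

abbreviation SM where "SM \<equiv> stable_matrices A"

lemma in_block_carrier: "in_block A n M \<Longrightarrow> M i j \<in> carrier A"
  by (simp add: in_block_def)

lemma in_block_mono: "in_block A n M \<Longrightarrow> n \<le> m \<Longrightarrow> in_block A m M"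
  by (simp add: in_block_def)

lemma in_block_outside:
  "in_block A n M \<Longrightarrow> i \<ge> n \<or> j \<ge> n \<Longrightarrow> M i j = (if i = j then \<one> else \<zero>)"
  unfolding in_block_def by blast

lemma in_block_row: "in_block A n M \<Longrightarrow> {k. M i k \<noteq> \<zero>} \<subseteq> insert i {..<n}"
  using in_block_outside[of n M i] by (force simp: not_less[symmetric])

lemma carrier_SM: "M \<in> carrier SM \<longleftrightarrow> (\<exists>n. in_block A n M)"
  by (simp add: stable_matrices_def)

lemma SM_entry: "M \<in> carrier SM \<Longrightarrow> M i j \<in> carrier A"
  using carrier_SM in_block_carrier by blast

lemma one_SM: "\<one>\<^bsub>SM\<^esub> = (\<lambda>i j. if i = j then \<one> else \<zero>)"
  by (simp add: stable_matrices_def)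

text \<open>The defining sum runs over the support of a row. Computations with several factors need the same
  index set for all of them, hence the freedom to enlarge it.\<close>

lemma SM_mult_eq:
  assumes "finite S" "{k. M i k \<noteq> \<zero>} \<subseteq> S"
    and "\<And>k. M i k \<in> carrier A" "\<And>k. N k j \<in> carrier A"
  shows "(M \<otimes>\<^bsub>SM\<^esub> N) i j = (\<Oplus>k\<in>S. M i k \<otimes> N k j)"
  unfolding stable_matrices_def monoid.simps partial_object.simps
  by (rule add.finprod_mono_neutral_cong_left) (use assms in auto)

lemma in_block_one: "in_block A 0 \<one>\<^bsub>SM\<^esub>"
  by (simp add: in_block_def one_SM)

lemma in_block_mult:
  assumes M: "in_block A n M" and N: "in_block A n N"
  shows "in_block A n (M \<otimes>\<^bsub>SM\<^esub> N)"
proof -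
  note c = in_block_carrier[OF M] in_block_carrier[OF N]
  have eq: "(M \<otimes>\<^bsub>SM\<^esub> N) i j = (\<Oplus>k\<in>insert i (insert j {..<n}). M i k \<otimes> N k j)" for i j
    by (rule SM_mult_eq) (use in_block_row[OF M] c in auto)
  show ?thesis unfolding in_block_def
  proof (intro conjI allI impI)
    fix i j show "(M \<otimes>\<^bsub>SM\<^esub> N) i j \<in> carrier A"
      unfolding eq using c by (auto intro!: finsum_closed)
  next
    fix i j assume "n \<le> i \<or> n \<le> j"
    then show "(M \<otimes>\<^bsub>SM\<^esub> N) i j = (if i = j then \<one> else \<zero>)"
    proof
      assume i: "n \<le> i"
      have "(M \<otimes>\<^bsub>SM\<^esub> N) i j = M i i \<otimes> N i j" unfolding eq
        by (rule finsum_single) (use c i in_block_outside[OF M, of i] in auto)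
      then show ?thesis using i c in_block_outside[OF M, of i i] in_block_outside[OF N, of i j] by simp
    next
      assume j: "n \<le> j"
      have "(M \<otimes>\<^bsub>SM\<^esub> N) i j = M i j \<otimes> N j j" unfolding eq
        by (rule finsum_single) (use c j in_block_outside[OF N, of _ j] in auto)
      then show ?thesis using j c in_block_outside[OF M, of i j] in_block_outside[OF N, of j j] by simp
    qed
  qed
qed

lemma SM_common_block:
  assumes "M \<in> carrier SM" "N \<in> carrier SM"
  obtains n where "in_block A n M" "in_block A n N"
  using assms unfolding carrier_SM by (meson in_block_mono max.cobounded1 max.cobounded2)

lemma SM_mult_closed:
  assumes "M \<in> carrier SM" "N \<in> carrier SM" shows "M \<otimes>\<^bsub>SM\<^esub> N \<in> carrier SM"
  using assms SM_common_block in_block_mult carrier_SM by metis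

lemma SM_assoc:
  assumes M: "M \<in> carrier SM" and N: "N \<in> carrier SM" and P: "P \<in> carrier SM"
  shows "M \<otimes>\<^bsub>SM\<^esub> N \<otimes>\<^bsub>SM\<^esub> P = M \<otimes>\<^bsub>SM\<^esub> (N \<otimes>\<^bsub>SM\<^esub> P)"
proof (intro ext)
  fix i j
  obtain n where n: "in_block A n M" "in_block A n N" using M N by (rule SM_common_block)
  note c[simp] = SM_entry[OF M] SM_entry[OF N] SM_entry[OF P]
  let ?S = "insert i {..<n}"
  have MN: "(M \<otimes>\<^bsub>SM\<^esub> N) i k = (\<Oplus>l\<in>?S. M i l \<otimes> N l k)" for k
    by (rule SM_mult_eq) (use in_block_row[OF n(1)] in auto)
  have NP: "(N \<otimes>\<^bsub>SM\<^esub> P) l j = (\<Oplus>k\<in>?S. N l k \<otimes> P k j)" if "l \<in> ?S" for l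
    by (rule SM_mult_eq) (use that in_block_row[OF n(2)] in auto)
  have "(M \<otimes>\<^bsub>SM\<^esub> N \<otimes>\<^bsub>SM\<^esub> P) i j = (\<Oplus>k\<in>?S. (M \<otimes>\<^bsub>SM\<^esub> N) i k \<otimes> P k j)"
    by (rule SM_mult_eq)
      (use in_block_row[OF in_block_mult[OF n]] SM_entry[OF SM_mult_closed[OF M N]] in auto)
  also have "\<dots> = (\<Oplus>k\<in>?S. \<Oplus>l\<in>?S. M i l \<otimes> N l k \<otimes> P k j)"
    unfolding MN by (intro finsum_cong' refl) (auto intro!: finsum_ldistr finsum_closed)
  also have "\<dots> = (\<Oplus>l\<in>?S. \<Oplus>k\<in>?S. M i l \<otimes> N l k \<otimes> P k j)"
    by (rule finsum_swap) auto
  also have "\<dots> = (\<Oplus>l\<in>?S. \<Oplus>k\<in>?S. M i l \<otimes> (N l k \<otimes> P k j))"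
    by (simp add: m_assoc)
  also have "\<dots> = (\<Oplus>l\<in>?S. M i l \<otimes> (N \<otimes>\<^bsub>SM\<^esub> P) l j)"
    by (intro finsum_cong' refl) (auto simp: NP finsum_rdistr intro!: finsum_closed)
  also have "\<dots> = (M \<otimes>\<^bsub>SM\<^esub> (N \<otimes>\<^bsub>SM\<^esub> P)) i j"
    by (rule SM_mult_eq[symmetric])
      (use in_block_row[OF n(1)] SM_entry[OF SM_mult_closed[OF N P]] in auto)
  finally show "(M \<otimes>\<^bsub>SM\<^esub> N \<otimes>\<^bsub>SM\<^esub> P) i j = (M \<otimes>\<^bsub>SM\<^esub> (N \<otimes>\<^bsub>SM\<^esub> P)) i j" .
qed

lemma SM_monoid: "Group.monoid SM"
proof (rule monoidI)
  show "\<one>\<^bsub>SM\<^esub> \<in> carrier SM" using in_block_one carrier_SM by blast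
  fix M assume M: "M \<in> carrier SM"
  then obtain n where n: "in_block A n M" using carrier_SM by blast
  note c[simp] = SM_entry[OF M]
  show "\<one>\<^bsub>SM\<^esub> \<otimes>\<^bsub>SM\<^esub> M = M"
  proof (intro ext)
    fix i j
    have "(\<one>\<^bsub>SM\<^esub> \<otimes>\<^bsub>SM\<^esub> M) i j = (\<Oplus>k\<in>{i}. \<one>\<^bsub>SM\<^esub> i k \<otimes> M k j)"
      by (rule SM_mult_eq) (auto simp: one_SM)
    then show "(\<one>\<^bsub>SM\<^esub> \<otimes>\<^bsub>SM\<^esub> M) i j = M i j" by (simp add: one_SM)
  qed
  show "M \<otimes>\<^bsub>SM\<^esub> \<one>\<^bsub>SM\<^esub> = M"
  proof (intro ext)
    fix i j
    have "(M \<otimes>\<^bsub>SM\<^esub> \<one>\<^bsub>SM\<^esub>) i j = (\<Oplus>k\<in>insert j (insert i {..<n}). M i k \<otimes> \<one>\<^bsub>SM\<^esub> k j)"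
      by (rule SM_mult_eq) (use in_block_row[OF n] in \<open>auto simp: one_SM\<close>)
    also have "\<dots> = M i j \<otimes> \<one>\<^bsub>SM\<^esub> j j" by (rule finsum_single) (auto simp: one_SM)
    finally show "(M \<otimes>\<^bsub>SM\<^esub> \<one>\<^bsub>SM\<^esub>) i j = M i j" by (simp add: one_SM)
  qed
qed (auto simp: SM_mult_closed SM_assoc)

sublocale SM: Group.monoid SM by (rule SM_monoid)

lemma carrier_GL: "carrier (GL A) = Units SM" by (simp add: GL_def units_of_carrier)
lemma mult_GL: "monoid.mult (GL A) = monoid.mult SM" by (simp add: GL_def units_of_mult)
lemma one_GL: "one (GL A) = one SM" by (simp add: GL_def units_of_one)

lemma GL_group: "Group.group (GL A)" unfolding GL_def by (rule SM.units_group)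

sublocale GL: Group.group "GL A" by (rule GL_group)

lemma GL_SM: "M \<in> carrier (GL A) \<Longrightarrow> M \<in> carrier SM"
  by (simp add: carrier_GL SM.Units_closed)

lemma GL_I:
  assumes "M \<in> carrier SM" "N \<in> carrier SM" "M \<otimes>\<^bsub>SM\<^esub> N = \<one>\<^bsub>SM\<^esub>" "N \<otimes>\<^bsub>SM\<^esub> M = \<one>\<^bsub>SM\<^esub>"
  shows "M \<in> carrier (GL A)"
  using assms by (auto simp: carrier_GL Units_def)

section \<open>The group K1\<close>

abbreviation E where "E \<equiv> derived (GL A) (carrier (GL A))"

lemma E_normal: "E \<lhd> GL A" by (rule GL.derived_self_is_normal)

lemma E_subgroup: "subgroup E (GL A)" using E_normal by (rule normal_imp_subgroup)

lemma K1_comm_group: "comm_group (K1 A)"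
  unfolding K1_def by (rule GL.derived_quot_is_comm_group)

lemma K1_class_hom: "K1_class A \<in> hom (GL A) (K1 A)"
  unfolding K1_def K1_class_def using normal.r_coset_hom_Mod[OF E_normal] .

lemma K1_class_group_hom: "group_hom (GL A) (K1 A) (K1_class A)"
  using K1_class_hom GL_group comm_group.axioms(2)[OF K1_comm_group]
  by (simp add: group_hom_def group_hom_axioms_def)

sublocale K1: comm_group "K1 A" by (rule K1_comm_group)
sublocale class_hom: group_hom "GL A" "K1 A" "K1_class A" by (rule K1_class_group_hom)

lemma carrier_K1: "carrier (K1 A) = K1_class A ` carrier (GL A)"
  by (simp add: K1_def K1_class_def carrier_FactGroup)

lemma one_K1: "\<one>\<^bsub>K1 A\<^esub> = E" by (simp add: K1_def)

lemma K1_class_one_iff: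
  assumes "M \<in> carrier (GL A)" shows "K1_class A M = \<one>\<^bsub>K1 A\<^esub> \<longleftrightarrow> M \<in> E"
  using assms GL.coset_join1[OF _ _ E_subgroup] GL.coset_join2[OF _ E_subgroup]
  unfolding one_K1 K1_class_def by (metis subgroup.subset[OF E_subgroup])

text \<open>The equation \<open>MN = P NM\<close> exhibits \<open>P\<close> as a commutator and can be verified entry by entry, without
  computing inverses.\<close>

lemma commutator_in_E:
  assumes "M \<in> carrier (GL A)" "N \<in> carrier (GL A)" "P \<in> carrier (GL A)"
    and "M \<otimes>\<^bsub>GL A\<^esub> N = P \<otimes>\<^bsub>GL A\<^esub> (N \<otimes>\<^bsub>GL A\<^esub> M)"
  shows "P \<in> E"
proof -
  have "P = M \<otimes>\<^bsub>GL A\<^esub> N \<otimes>\<^bsub>GL A\<^esub> inv\<^bsub>GL A\<^esub> (N \<otimes>\<^bsub>GL A\<^esub> M)"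
    using assms GL.inv_solve_right by auto
  also have "\<dots> = M \<otimes>\<^bsub>GL A\<^esub> N \<otimes>\<^bsub>GL A\<^esub> inv\<^bsub>GL A\<^esub> M \<otimes>\<^bsub>GL A\<^esub> inv\<^bsub>GL A\<^esub> N"
    using assms(1-3) by (simp add: GL.inv_mult_group GL.m_assoc)
  finally show ?thesis unfolding derived_def using assms(1,2) by (auto intro!: generate.incl)
qed

end

locale matrix_ring_hom = A: matrix_ring A + B: matrix_ring B
  for A :: "'a ring" and B :: "'b ring" +
  fixes f :: "'a \<Rightarrow> 'b"
  assumes f_hom: "f \<in> Ring.ring_hom A B"
begin

sublocale f: ring_hom_ring A B f
  by (rule ring_hom_ringI2[OF A.ring_axioms B.ring_axioms f_hom])

abbreviation (input) mmap where "mmap \<equiv> \<lambda>M i j. f (M i j)"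

lemma in_block_map: "in_block A n M \<Longrightarrow> in_block B n (mmap M)"
  by (auto simp: in_block_def)

lemma mmap_SM: "M \<in> carrier A.SM \<Longrightarrow> mmap M \<in> carrier B.SM"
  using in_block_map A.carrier_SM B.carrier_SM by blast

lemma mmap_one: "mmap \<one>\<^bsub>A.SM\<^esub> = \<one>\<^bsub>B.SM\<^esub>"
  by (auto simp: A.one_SM B.one_SM fun_eq_iff)

lemma mmap_mult:
  assumes M: "M \<in> carrier A.SM" and N: "N \<in> carrier A.SM"
  shows "mmap (M \<otimes>\<^bsub>A.SM\<^esub> N) = mmap M \<otimes>\<^bsub>B.SM\<^esub> mmap N"
proof (intro ext)
  fix i j
  obtain n where n: "in_block A n M" using M A.carrier_SM by blast
  note [simp] = A.SM_entry[OF M] A.SM_entry[OF N]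
  have "(M \<otimes>\<^bsub>A.SM\<^esub> N) i j = (\<Oplus>\<^bsub>A\<^esub>k\<in>insert i {..<n}. M i k \<otimes>\<^bsub>A\<^esub> N k j)"
    by (rule A.SM_mult_eq) (use A.in_block_row[OF n] in auto)
  moreover have "(mmap M \<otimes>\<^bsub>B.SM\<^esub> mmap N) i j = (\<Oplus>\<^bsub>B\<^esub>k\<in>insert i {..<n}. f (M i k) \<otimes>\<^bsub>B\<^esub> f (N k j))"
    by (rule B.SM_mult_eq) (use B.in_block_row[OF in_block_map[OF n]] in auto)
  ultimately show "f ((M \<otimes>\<^bsub>A.SM\<^esub> N) i j) = (mmap M \<otimes>\<^bsub>B.SM\<^esub> mmap N) i j"
    by (simp add: o_def cong: B.finsum_cong)
qed

lemma mmap_GL: "M \<in> carrier (GL A) \<Longrightarrow> mmap M \<in> carrier (GL B)"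
proof -
  assume "M \<in> carrier (GL A)"
  then obtain N where N: "M \<in> carrier A.SM" "N \<in> carrier A.SM" 
      "M \<otimes>\<^bsub>A.SM\<^esub> N = \<one>\<^bsub>A.SM\<^esub>" "N \<otimes>\<^bsub>A.SM\<^esub> M = \<one>\<^bsub>A.SM\<^esub>"
    by (auto simp: A.carrier_GL Units_def)
  show ?thesis
    by (rule B.GL_I[of _ "mmap N"]) (use N in \<open>simp_all add: mmap_SM mmap_mult[symmetric] mmap_one\<close>)
qed

lemma mmap_hom: "mmap \<in> hom (GL A) (GL B)"
  by (rule homI) (auto simp: mmap_GL A.mult_GL B.mult_GL mmap_mult A.GL_SM)

sublocale GLmap: group_hom "GL A" "GL B" mmap
  using mmap_hom A.GL_group B.GL_group by (simp add: group_hom_def group_hom_axioms_def)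

lemma mmap_E: "M \<in> A.E \<Longrightarrow> mmap M \<in> B.E"
proof -
  assume "M \<in> A.E"
  then have "mmap M \<in> derived (GL B) (mmap ` carrier (GL A))"
    unfolding GLmap.derived_img[OF order.refl] by blast
  then show ?thesis using B.GL.mono_derived[of "mmap ` carrier (GL A)"] mmap_GL by blast
qed

lemma K1_map_class:
  assumes M: "M \<in> carrier (GL A)"
  shows "K1_map B f (K1_class A M) = K1_class B (mmap M)"
  unfolding K1_map_def K1_class_def[of A]
proof (rule normal.on_cosets_rcos[OF A.E_normal M])
  fix h y assume h: "h \<in> A.E" and y: "y \<in> carrier (GL A)"
  have hG: "h \<in> carrier (GL A)" using h subgroup.mem_carrier[OF A.E_subgroup] by blast
  have "K1_class B (mmap (h \<otimes>\<^bsub>GL A\<^esub> y)) = K1_class B (mmap h) \<otimes>\<^bsub>K1 B\<^esub> K1_class B (mmap y)"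
    using hG y by (simp add: mmap_GL)
  also have "K1_class B (mmap h) = \<one>\<^bsub>K1 B\<^esub>"
    using B.K1_class_one_iff mmap_GL[OF hG] mmap_E[OF h] by blast
  finally show "K1_class B (mmap (h \<otimes>\<^bsub>GL A\<^esub> y)) = K1_class B (mmap y)"
    using y by (simp add: mmap_GL)
qed

lemma K1_map_hom: "K1_map B f \<in> hom (K1 A) (K1 B)"
proof (rule homI)
  fix x assume "x \<in> carrier (K1 A)"
  then show "K1_map B f x \<in> carrier (K1 B)"
    by (auto simp: A.carrier_K1 B.carrier_K1 K1_map_class mmap_GL)
next
  fix x y assume "x \<in> carrier (K1 A)" "y \<in> carrier (K1 A)"
  then obtain M N where *: "M \<in> carrier (GL A)" "x = K1_class A M" "N \<in> carrier (GL A)" "y = K1_class A N"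
    by (auto simp: A.carrier_K1)
  then have "K1_map B f (x \<otimes>\<^bsub>K1 A\<^esub> y) = K1_class B (mmap (M \<otimes>\<^bsub>GL A\<^esub> N))"
    by (simp only: A.class_hom.hom_mult[symmetric] K1_map_class A.GL.m_closed)
  then show "K1_map B f (x \<otimes>\<^bsub>K1 A\<^esub> y) = K1_map B f x \<otimes>\<^bsub>K1 B\<^esub> K1_map B f y"
    using * by (simp add: K1_map_class mmap_GL)
qed

end

section \<open>Elementary matrices and reduction to diagonal form\<close>

context matrix_ring
begin

abbreviation (input) kron :: "nat \<Rightarrow> nat \<Rightarrow> 'a" where "kron i j \<equiv> if i = j then \<one> else \<zero>"

definition fin_column :: "(nat \<Rightarrow> 'a) \<Rightarrow> bool" where
  "fin_column z \<longleftrightarrow> (\<forall>i. z i \<in> carrier A) \<and> (\<exists>n. \<forall>i\<ge>n. z i = \<zero>)"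

text \<open>The matrix \<open>1 + z e\<^sub>m\<^sup>T\<close>, that is, the identity matrix with \<open>z\<close> added to its column \<open>m\<close>. Multiplication
  by it from the left adds \<open>z i\<close> times row \<open>m\<close> to row \<open>i\<close>, so all products below can be read off entry by
  entry.\<close>

definition column_matrix :: "nat \<Rightarrow> (nat \<Rightarrow> 'a) \<Rightarrow> nat \<Rightarrow> nat \<Rightarrow> 'a" where
  "column_matrix m z = (\<lambda>i j. kron i j \<oplus> (if j = m then z i else \<zero>))"

abbreviation (input) unit_column :: "nat \<Rightarrow> 'a \<Rightarrow> nat \<Rightarrow> 'a" where
  "unit_column m a \<equiv> (\<lambda>i. if i = m then a else \<zero>)"

lemma fin_column_carrier: "fin_column z \<Longrightarrow> z i \<in> carrier A"
  by (simp add: fin_column_def)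

lemma fin_column_zeros: "(\<And>i. z i \<in> carrier A) \<Longrightarrow> (\<And>i. i \<ge> n \<Longrightarrow> z i = \<zero>) \<Longrightarrow> fin_column z"
  by (auto simp: fin_column_def)

lemma fin_column_unit: "a \<in> carrier A \<Longrightarrow> fin_column (unit_column m a)"
  by (rule fin_column_zeros[of _ "Suc m"]) auto

lemma fin_column_scale:
  assumes "fin_column z" "c \<in> carrier A" shows "fin_column (\<lambda>i. z i \<otimes> c)"
proof -
  obtain n where "\<forall>i\<ge>n. z i = \<zero>" using assms(1) by (auto simp: fin_column_def)
  then show ?thesis using assms fin_column_carrier by (intro fin_column_zeros[of _ n]) auto
qed

lemma fin_column_uminus:
  assumes "fin_column z" shows "fin_column (\<lambda>i. \<ominus> z i)"
proof -
  obtain n where "\<forall>i\<ge>n. z i = \<zero>" using assms(1) by (auto simp: fin_column_def)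
  then show ?thesis using assms fin_column_carrier by (intro fin_column_zeros[of _ n]) auto
qed

lemma column_matrix_SM:
  assumes "fin_column z" shows "column_matrix m z \<in> carrier SM"
proof -
  obtain n where n: "\<forall>i\<ge>n. z i = \<zero>" using assms by (auto simp: fin_column_def)
  have "in_block A (max n (Suc m)) (column_matrix m z)"
    using n fin_column_carrier[OF assms] by (auto simp: in_block_def column_matrix_def)
  then show ?thesis using carrier_SM by blast
qed

lemma column_matrix_mult:
  assumes z: "fin_column z" and N: "N \<in> carrier SM"
  shows "column_matrix m z \<otimes>\<^bsub>SM\<^esub> N = (\<lambda>i j. N i j \<oplus> z i \<otimes> N m j)"
proof (intro ext)
  fix i j
  note [simp] = fin_column_carrier[OF z] SM_entry[OF N] SM_entry[OF column_matrix_SM[OF z]]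
  have eq: "(column_matrix m z \<otimes>\<^bsub>SM\<^esub> N) i j = (\<Oplus>k\<in>{i,m}. column_matrix m z i k \<otimes> N k j)"
    by (rule SM_mult_eq) (auto simp: column_matrix_def split: if_splits)
  show "(column_matrix m z \<otimes>\<^bsub>SM\<^esub> N) i j = N i j \<oplus> z i \<otimes> N m j"
  proof (cases "i = m")
    case True
    then show ?thesis unfolding eq by (simp add: column_matrix_def l_distr)
  next
    case False
    then show ?thesis unfolding eq by (simp add: column_matrix_def)
  qed
qed

lemma column_matrix_comp:
  assumes z: "fin_column z" and w: "fin_column w"
  shows "column_matrix m z \<otimes>\<^bsub>SM\<^esub> column_matrix m w
    = column_matrix m (\<lambda>i. w i \<oplus> z i \<oplus> z i \<otimes> w m)"
proof (intro ext)
  fix i j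
  note [simp] = fin_column_carrier[OF z] fin_column_carrier[OF w]
  show "(column_matrix m z \<otimes>\<^bsub>SM\<^esub> column_matrix m w) i j
     = column_matrix m (\<lambda>i. w i \<oplus> z i \<oplus> z i \<otimes> w m) i j"
    unfolding column_matrix_mult[OF z column_matrix_SM[OF w]]
    by (cases "j = m") (auto simp: column_matrix_def r_distr a_assoc)
qed

lemma column_matrix_zero: "column_matrix m (\<lambda>i. \<zero>) = \<one>\<^bsub>SM\<^esub>"
  by (auto simp: column_matrix_def one_SM fun_eq_iff)

text \<open>The column \<open>w = -z (1 + z\<^sub>m)\<^sup>-\<^sup>1\<close> solves \<open>w + z + z w\<^sub>m = 0\<close>, which by \<open>column_matrix_comp\<close> makes the column
  matrix of \<open>w\<close> inverse to that of \<open>z\<close>.\<close>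

definition inv_column :: "nat \<Rightarrow> (nat \<Rightarrow> 'a) \<Rightarrow> nat \<Rightarrow> 'a" where
  "inv_column m z = (\<lambda>i. \<ominus> (z i \<otimes> inv (\<one> \<oplus> z m)))"

context
  fixes m z assumes z: "fin_column z" and u: "\<one> \<oplus> z m \<in> Units A"
begin

lemma fin_inv_column: "fin_column (inv_column m z)"
  unfolding inv_column_def using u by (intro fin_column_uminus fin_column_scale z) auto

lemma column_matrix_inverse:
  "column_matrix m z \<otimes>\<^bsub>SM\<^esub> column_matrix m (inv_column m z) = \<one>\<^bsub>SM\<^esub>"
  "column_matrix m (inv_column m z) \<otimes>\<^bsub>SM\<^esub> column_matrix m z = \<one>\<^bsub>SM\<^esub>"
proof -
  define c where "c = inv (\<one> \<oplus> z m)"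
  have c: "c \<in> carrier A" "(\<one> \<oplus> z m) \<otimes> c = \<one>" "c \<otimes> (\<one> \<oplus> z m) = \<one>"
    using u by (auto simp: c_def)
  note zc[simp] = fin_column_carrier[OF z]
  have r: "c \<oplus> z m \<otimes> c = \<one>" using c by (simp add: l_distr)
  have l: "c \<oplus> c \<otimes> z m = \<one>" using c by (simp add: r_distr)
  have 1: "\<ominus> (z i \<otimes> c) \<oplus> z i \<oplus> z i \<otimes> \<ominus> (z m \<otimes> c) = \<zero>" for i
  proof -
    have "\<ominus> (z i \<otimes> c) \<oplus> z i \<oplus> z i \<otimes> \<ominus> (z m \<otimes> c) = z i \<ominus> z i \<otimes> (c \<oplus> z m \<otimes> c)"
      using c(1) by (simp add: r_distr r_minus minus_add minus_eq a_ac)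
    then show ?thesis by (simp add: r minus_eq r_neg)
  qed
  have 2: "z i \<oplus> \<ominus> (z i \<otimes> c) \<oplus> \<ominus> (z i \<otimes> c) \<otimes> z m = \<zero>" for i
  proof -
    have "z i \<oplus> \<ominus> (z i \<otimes> c) \<oplus> \<ominus> (z i \<otimes> c) \<otimes> z m = z i \<ominus> z i \<otimes> (c \<oplus> c \<otimes> z m)"
      using c(1) by (simp add: r_distr l_minus minus_add minus_eq a_ac m_assoc)
    then show ?thesis by (simp add: l minus_eq r_neg)
  qed
  show "column_matrix m z \<otimes>\<^bsub>SM\<^esub> column_matrix m (inv_column m z) = \<one>\<^bsub>SM\<^esub>"
    unfolding column_matrix_comp[OF z fin_inv_column]
    unfolding inv_column_def c_def[symmetric] 1 by (rule column_matrix_zero)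
  show "column_matrix m (inv_column m z) \<otimes>\<^bsub>SM\<^esub> column_matrix m z = \<one>\<^bsub>SM\<^esub>"
    unfolding column_matrix_comp[OF fin_inv_column z]
    unfolding inv_column_def c_def[symmetric] 2 by (rule column_matrix_zero)
qed

lemma column_matrix_GL: "column_matrix m z \<in> carrier (GL A)"
  using GL_I[OF column_matrix_SM[OF z] column_matrix_SM[OF fin_inv_column] column_matrix_inverse] .

end

lemma transvection_GL: "fin_column v \<Longrightarrow> v m = \<zero> \<Longrightarrow> column_matrix m v \<in> carrier (GL A)"
  by (rule column_matrix_GL) auto

text \<open>If \<open>v\<close> vanishes at two distinct indices \<open>k\<close> and \<open>m\<close>, then \<open>1 + v e\<^sub>m\<^sup>T\<close> is the commutator of \<open>1 + v e\<^sub>k\<^sup>T\<close> and \<open>1 + e\<^sub>k e\<^sub>m\<^sup>T\<close>.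
  There is room for such an index \<open>k\<close> because the matrices are stable.\<close>

lemma transvection_in_E:
  assumes v: "fin_column v" and m: "v m = \<zero>"
  shows "column_matrix m v \<in> E"
proof -
  obtain n where n: "\<forall>i\<ge>n. v i = \<zero>" using v by (auto simp: fin_column_def)
  define k where "k = max n (Suc m)"
  have k: "v k = \<zero>" "k \<noteq> m" using n by (auto simp: k_def)
  let ?P = "column_matrix k v" and ?Q = "column_matrix m (unit_column k \<one>)"
  have Q: "fin_column (unit_column k \<one>)" by (rule fin_column_unit) simp
  note [simp] = fin_column_carrier[OF v]
  have GLs: "column_matrix m v \<in> carrier (GL A)" "?P \<in> carrier (GL A)" "?Q \<in> carrier (GL A)"
    using transvection_GL[OF v m] transvection_GL[OF v k(1)] transvection_GL[OF Q, of m] k(2) by auto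
  note SMs = GLs[THEN GL_SM]
  show ?thesis
  proof (rule commutator_in_E[OF GLs(2,3,1)], unfold mult_GL)
    show "?P \<otimes>\<^bsub>SM\<^esub> ?Q = column_matrix m v \<otimes>\<^bsub>SM\<^esub> (?Q \<otimes>\<^bsub>SM\<^esub> ?P)"
      unfolding column_matrix_mult[OF v SM_mult_closed[OF SMs(3,2)]]
      unfolding column_matrix_mult[OF v SMs(3)] column_matrix_mult[OF Q SMs(2)]
      using k m by (intro ext) (auto simp: column_matrix_def a_ac)
  qed
qed

definition swap_matrix :: "nat \<Rightarrow> nat \<Rightarrow> nat \<Rightarrow> 'a" where
  "swap_matrix m = (\<lambda>i j. kron (Transposition.transpose 0 m i) j)"

lemma swap_matrix_SM: "swap_matrix m \<in> carrier SM"
proof -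
  have "in_block A (Suc m) (swap_matrix m)"
    by (auto simp: in_block_def swap_matrix_def Transposition.transpose_def)
  then show ?thesis using carrier_SM by blast
qed

lemma swap_matrix_mult:
  assumes N: "N \<in> carrier SM"
  shows "swap_matrix m \<otimes>\<^bsub>SM\<^esub> N = (\<lambda>i j. N (Transposition.transpose 0 m i) j)"
proof (intro ext)
  fix i j
  have "(swap_matrix m \<otimes>\<^bsub>SM\<^esub> N) i j
      = (\<Oplus>k\<in>{Transposition.transpose 0 m i}. swap_matrix m i k \<otimes> N k j)"
    by (rule SM_mult_eq) (use SM_entry[OF N] in \<open>auto simp: swap_matrix_def split: if_splits\<close>)
  then show "(swap_matrix m \<otimes>\<^bsub>SM\<^esub> N) i j = N (Transposition.transpose 0 m i) j"
    using SM_entry[OF N] by (simp add: swap_matrix_def)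
qed

lemma swap_matrix_GL: "swap_matrix m \<in> carrier (GL A)"
proof (rule GL_I[OF swap_matrix_SM swap_matrix_SM])
  show "swap_matrix m \<otimes>\<^bsub>SM\<^esub> swap_matrix m = \<one>\<^bsub>SM\<^esub>"
    unfolding swap_matrix_mult[OF swap_matrix_SM] by (simp add: swap_matrix_def one_SM)
  then show "swap_matrix m \<otimes>\<^bsub>SM\<^esub> swap_matrix m = \<one>\<^bsub>SM\<^esub>" .
qed

text \<open>The diagonal matrix with entry \<open>1 + a\<close> (not \<open>a\<close>) at position \<open>m\<close>.\<close>

definition diag :: "nat \<Rightarrow> 'a \<Rightarrow> nat \<Rightarrow> nat \<Rightarrow> 'a" where
  "diag m a = column_matrix m (unit_column m a)"

lemma diag_GL:
  assumes "a \<in> carrier A" "\<one> \<oplus> a \<in> Units A" shows "diag m a \<in> carrier (GL A)"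
  unfolding diag_def by (rule column_matrix_GL) (use assms fin_column_unit in auto)

text \<open>Conjugation by a permutation matrix moves the diagonal entry to position \<open>0\<close>, and \<open>K\<^sub>1\<close> is commutative.\<close>

lemma class_diag_zero:
  assumes a: "a \<in> carrier A" "\<one> \<oplus> a \<in> Units A"
  shows "K1_class A (diag m a) = K1_class A (diag 0 a)"
proof -
  let ?P = "swap_matrix m"
  have D: "diag m a \<in> carrier (GL A)" for m using diag_GL[OF a] .
  have "diag m a \<otimes>\<^bsub>SM\<^esub> ?P = ?P \<otimes>\<^bsub>SM\<^esub> diag 0 a"
    unfolding swap_matrix_mult[OF GL_SM[OF D]]
    unfolding diag_def column_matrix_mult[OF fin_column_unit[OF a(1)] swap_matrix_SM]
    using a(1) by (intro ext) (auto simp: swap_matrix_def column_matrix_def Transposition.transpose_def)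
  then have "K1_class A (diag m a \<otimes>\<^bsub>GL A\<^esub> ?P) = K1_class A (?P \<otimes>\<^bsub>GL A\<^esub> diag 0 a)"
    by (simp add: mult_GL)
  then have "K1_class A (diag m a) \<otimes>\<^bsub>K1 A\<^esub> K1_class A ?P
      = K1_class A (diag 0 a) \<otimes>\<^bsub>K1 A\<^esub> K1_class A ?P"
    using D swap_matrix_GL by (simp add: K1.m_comm)
  then show ?thesis using D swap_matrix_GL by simp
qed

lemma class_diag_mult:
  assumes "a \<in> carrier A" "\<one> \<oplus> a \<in> Units A" "b \<in> carrier A" "\<one> \<oplus> b \<in> Units A"
  shows "K1_class A (diag m a) \<otimes>\<^bsub>K1 A\<^esub> K1_class A (diag m b) = K1_class A (diag m (b \<oplus> a \<oplus> a \<otimes> b))"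
proof -
  have "diag m a \<otimes>\<^bsub>SM\<^esub> diag m b = diag m (b \<oplus> a \<oplus> a \<otimes> b)"
    unfolding diag_def column_matrix_comp[OF fin_column_unit[OF assms(1)] fin_column_unit[OF assms(3)]]
    using assms(1,3) by (intro arg_cong[of _ _ "column_matrix m"]) auto
  then show ?thesis using assms by (simp add: diag_GL mult_GL flip: class_hom.hom_mult)
qed

text \<open>A column matrix with unit pivot is a transvection times a diagonal matrix, and transvections vanish in
  \<open>K\<^sub>1\<close>.\<close>

lemma class_column_matrix:
  assumes z: "fin_column z" and u: "\<one> \<oplus> z m \<in> Units A"
  shows "K1_class A (column_matrix m z) = K1_class A (diag 0 (z m))"
proof -
  note [simp] = fin_column_carrier[OF z]
  define c where "c = inv (\<one> \<oplus> z m)"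
  have c: "c \<in> carrier A" "c \<otimes> (\<one> \<oplus> z m) = \<one>" using u by (auto simp: c_def)
  define v where "v = (\<lambda>i. (if i = m then \<zero> else z i) \<otimes> c)"
  have v: "fin_column v"
  proof -
    obtain n where "\<forall>i\<ge>n. z i = \<zero>" using z by (auto simp: fin_column_def)
    then show ?thesis unfolding v_def using c by (intro fin_column_zeros[of _ n]) auto
  qed
  have vm: "v m = \<zero>" using c by (simp add: v_def)
  have col: "unit_column m (z m) i \<oplus> v i \<oplus> v i \<otimes> z m = z i" for i
  proof (cases "i = m")
    case False
    have "v i \<oplus> v i \<otimes> z m = z i \<otimes> (c \<otimes> (\<one> \<oplus> z m))"
      using c(1) False by (simp add: v_def r_distr m_assoc)
    then show ?thesis using False c fin_column_carrier[OF v] by simp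
  qed (simp add: vm)
  have "column_matrix m z = column_matrix m v \<otimes>\<^bsub>SM\<^esub> diag m (z m)"
    unfolding diag_def using col
    by (subst column_matrix_comp[OF v fin_column_unit]) (auto intro!: arg_cong[of _ _ "column_matrix m"])
  then have "K1_class A (column_matrix m z) = K1_class A (column_matrix m v) \<otimes>\<^bsub>K1 A\<^esub> K1_class A (diag m (z m))"
    using transvection_GL[OF v vm] diag_GL[OF _ u, of m] by (simp add: mult_GL flip: class_hom.hom_mult)
  also have "K1_class A (column_matrix m v) = \<one>\<^bsub>K1 A\<^esub>"
    using K1_class_one_iff[OF transvection_GL[OF v vm]] transvection_in_E[OF v vm] by simp
  finally show ?thesis using diag_GL[OF _ u, of 0] class_diag_zero[OF _ u, of m] by simp
qed

end

section \<open>Matrices congruent to the identity modulo a radical ideal\<close>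

text \<open>The condition on \<open>J\<close> says that the ideal lies in the Jacobson radical.\<close>

locale radical_ideal = matrix_ring A + ideal J A for A :: "'a ring" (structure) and J :: "'a set" +
  assumes one_plus_unit: "a \<in> J \<Longrightarrow> \<one> \<oplus> a \<in> Units A"
begin

definition congruent_one :: "(nat \<Rightarrow> nat \<Rightarrow> 'a) set" where
  "congruent_one = {M \<in> carrier SM. \<forall>i j. M i j \<ominus> kron i j \<in> J}"

lemma J_closed:
  "a \<in> J \<Longrightarrow> b \<in> J \<Longrightarrow> a \<oplus> b \<in> J" "a \<in> J \<Longrightarrow> c \<in> carrier A \<Longrightarrow> a \<otimes> c \<in> J"
  "a \<in> J \<Longrightarrow> c \<in> carrier A \<Longrightarrow> c \<otimes> a \<in> J" "a \<in> J \<Longrightarrow> \<ominus> a \<in> J" "\<zero> \<in> J"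
  by (auto simp: I_l_closed I_r_closed)

text \<open>Elimination by induction on the number of columns that differ from the identity. The last such column
  gives a column matrix whose pivot is a unit; dividing by it from the left turns this column into one
  of the identity matrix, leaves the columns beyond it alone, and keeps the other entries congruent to
  the identity modulo \<open>J\<close>. Invertibility and the class in \<open>K\<^sub>1\<close> are obtained together.\<close>

lemma reduce_columns:
  assumes "\<And>i j. Y i j \<in> J" "\<And>i j. i \<ge> n \<or> j \<ge> m \<Longrightarrow> Y i j = \<zero>"
  shows "(\<lambda>i j. kron i j \<oplus> Y i j) \<in> carrier (GL A) \<and>
    (\<exists>a\<in>J. K1_class A (\<lambda>i j. kron i j \<oplus> Y i j) = K1_class A (diag 0 a))"
  using assms
proof (induction m arbitrary: Y)
  case 0
  have "(\<lambda>i j. kron i j \<oplus> Y i j) = \<one>\<^bsub>SM\<^esub>" using "0.prems"(2) by (simp add: one_SM fun_eq_iff)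
  moreover have "diag 0 \<zero> = \<one>\<^bsub>SM\<^esub>" by (simp add: diag_def column_matrix_zero)
  moreover have "\<one>\<^bsub>SM\<^esub> \<in> carrier (GL A)" unfolding one_GL[symmetric] by (rule GL.one_closed)
  ultimately show ?case using J_closed(5) by metis
next
  case (Suc m)
  have Yc[simp]: "Y i j \<in> carrier A" for i j using Suc.prems(1) Icarr by blast
  let ?M = "\<lambda>i j. kron i j \<oplus> Y i j"
  have "in_block A (max n (Suc m)) ?M"
    using Suc.prems(2) by (auto simp: in_block_def)
  then have M: "?M \<in> carrier SM" using carrier_SM by blast
  define z where "z = (\<lambda>i. Y i m)"
  have z: "fin_column z" unfolding z_def by (rule fin_column_zeros[of _ n]) (use Suc.prems(2) in auto)
  have u: "\<one> \<oplus> z m \<in> Units A" using one_plus_unit Suc.prems(1) by (simp add: z_def)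
  define w where "w = inv_column m z"
  have w: "fin_column w" unfolding w_def by (rule fin_inv_column[OF z u])
  note wc[simp] = fin_column_carrier[OF w]
  have wJ: "w i \<in> J" for i unfolding w_def inv_column_def
    by (intro J_closed(4) J_closed(2)) (use u Suc.prems(1) in \<open>auto simp: z_def\<close>)
  define Y' where "Y' = (\<lambda>i j. if j = m then \<zero> else Y i j \<oplus> w i \<otimes> Y m j)"
  have prod: "column_matrix m w \<otimes>\<^bsub>SM\<^esub> ?M = (\<lambda>i j. kron i j \<oplus> Y' i j)"
  proof (intro ext)
    fix i j
    have "(column_matrix m w \<otimes>\<^bsub>SM\<^esub> ?M) i j = ?M i j \<oplus> w i \<otimes> ?M m j"
      unfolding column_matrix_mult[OF w M] ..
    also have "\<dots> = kron i j \<oplus> Y' i j"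
    proof (cases "j = m")
      case True
      have "(column_matrix m w \<otimes>\<^bsub>SM\<^esub> column_matrix m z) i m = kron i m"
        unfolding w_def column_matrix_inverse[OF z u] one_SM ..
      then have "column_matrix m z i m \<oplus> w i \<otimes> column_matrix m z m m = kron i m"
        unfolding column_matrix_mult[OF w column_matrix_SM[OF z]] .
      then show ?thesis using True by (simp add: Y'_def column_matrix_def z_def)
    qed (simp add: Y'_def a_assoc)
    finally show "(column_matrix m w \<otimes>\<^bsub>SM\<^esub> ?M) i j = kron i j \<oplus> Y' i j" .
  qed
  have w0: "w i = \<zero>" if "i \<ge> n" for i
    using that Suc.prems(2) u by (simp add: w_def inv_column_def z_def)
  have IH: "(\<lambda>i j. kron i j \<oplus> Y' i j) \<in> carrier (GL A)"
    "\<exists>a\<in>J. K1_class A (\<lambda>i j. kron i j \<oplus> Y' i j) = K1_class A (diag 0 a)"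
  proof -
    have "Y' i j \<in> J" for i j using Suc.prems(1) wJ by (auto simp: Y'_def intro!: J_closed)
    moreover have "Y' i j = \<zero>" if "i \<ge> n \<or> j \<ge> m" for i j
      using that Suc.prems(2) w0 by (auto simp: Y'_def)
    ultimately show "(\<lambda>i j. kron i j \<oplus> Y' i j) \<in> carrier (GL A)"
      "\<exists>a\<in>J. K1_class A (\<lambda>i j. kron i j \<oplus> Y' i j) = K1_class A (diag 0 a)"
      using Suc.IH[of Y'] by blast+
  qed
  then obtain a where a: "a \<in> J" "K1_class A (\<lambda>i j. kron i j \<oplus> Y' i j) = K1_class A (diag 0 a)"
    by blast
  have "?M = column_matrix m z \<otimes>\<^bsub>SM\<^esub> column_matrix m w \<otimes>\<^bsub>SM\<^esub> ?M"
    unfolding w_def column_matrix_inverse(1)[OF z u] using M by simp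
  also have "\<dots> = column_matrix m z \<otimes>\<^bsub>SM\<^esub> (\<lambda>i j. kron i j \<oplus> Y' i j)"
    using SM_assoc[OF column_matrix_SM[OF z] column_matrix_SM[OF w] M] prod by simp
  finally have eq: "?M = column_matrix m z \<otimes>\<^bsub>GL A\<^esub> (\<lambda>i j. kron i j \<oplus> Y' i j)"
    by (simp only: mult_GL)
  have zG: "column_matrix m z \<in> carrier (GL A)" by (rule column_matrix_GL[OF z u])
  have ac: "a \<in> carrier A" "z m \<in> carrier A" using a(1) Icarr fin_column_carrier[OF z] by auto
  have zJ: "z m \<in> J" using Suc.prems(1) by (simp add: z_def)
  have "K1_class A ?M = K1_class A (diag 0 (z m)) \<otimes>\<^bsub>K1 A\<^esub> K1_class A (diag 0 a)"
    unfolding eq using zG IH(1) a(2) class_column_matrix[OF z u] by simp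
  also have "\<dots> = K1_class A (diag 0 (a \<oplus> z m \<oplus> z m \<otimes> a))"
    by (rule class_diag_mult) (use ac u one_plus_unit a(1) in auto)
  finally have "K1_class A ?M = K1_class A (diag 0 (a \<oplus> z m \<oplus> z m \<otimes> a))" .
  moreover have "a \<oplus> z m \<oplus> z m \<otimes> a \<in> J" using a(1) zJ ac by (intro J_closed)
  moreover have "?M \<in> carrier (GL A)" unfolding eq using zG IH(1) by (rule GL.m_closed)
  ultimately show ?case by blast
qed

lemma congruent_one_reduce:
  assumes "M \<in> congruent_one"
  shows congruent_one_GL: "M \<in> carrier (GL A)"
    and congruent_one_class: "\<exists>a\<in>J. K1_class A M = K1_class A (diag 0 a)"
proof -
  have M: "M \<in> carrier SM" "\<And>i j. M i j \<ominus> kron i j \<in> J"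
    using assms by (auto simp: congruent_one_def)
  obtain n where n: "in_block A n M" using M(1) carrier_SM by blast
  let ?Y = "\<lambda>i j. M i j \<ominus> kron i j"
  have eq: "(\<lambda>i j. kron i j \<oplus> ?Y i j) = M"
  proof (intro ext)
    fix i j
    have "kron i j \<in> carrier A" "M i j \<in> carrier A" using SM_entry[OF M(1)] by auto
    then show "kron i j \<oplus> ?Y i j = M i j" by (simp add: minus_eq a_lcomm r_neg)
  qed
  have "?Y i j = \<zero>" if "i \<ge> n \<or> j \<ge> n" for i j
    unfolding in_block_outside[OF n that] by (simp add: minus_eq r_neg)
  from reduce_columns[of ?Y n n, OF M(2) this, unfolded eq]
  show "M \<in> carrier (GL A)" "\<exists>a\<in>J. K1_class A M = K1_class A (diag 0 a)" by auto
qed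

lemma diag_congruent_one: "a \<in> J \<Longrightarrow> diag m a \<in> congruent_one"
proof -
  assume a: "a \<in> J"
  then have ac: "a \<in> carrier A" by (rule Icarr)
  have "\<one> \<oplus> a \<ominus> \<one> = a" using ac by (simp add: minus_eq a_ac r_neg1 l_neg r_neg)
  then show ?thesis unfolding congruent_one_def diag_def
    using a ac column_matrix_SM[OF fin_column_unit[OF ac]] J_closed(5)
    by (auto simp: column_matrix_def minus_eq r_neg)
qed

end

text \<open>Surjections of rings \<open>A \<rightarrow> B\<close> whose kernel lies in the Jacobson radical of \<open>A\<close>.\<close>

locale radical_surjection = matrix_ring_hom A B f
  for A :: "'a ring" and B :: "'b ring" and f :: "'a \<Rightarrow> 'b" +
  assumes f_surj: "f ` carrier A = carrier B"
    and f_radical: "\<And>a. a \<in> carrier A \<Longrightarrow> f a = \<zero>\<^bsub>B\<^esub> \<Longrightarrow> \<one>\<^bsub>A\<^esub> \<oplus>\<^bsub>A\<^esub> a \<in> Units A"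
begin

abbreviation J where "J \<equiv> a_kernel A B f"

lemma J_iff: "a \<in> J \<longleftrightarrow> a \<in> carrier A \<and> f a = \<zero>\<^bsub>B\<^esub>"
  unfolding a_kernel_def' by blast

sublocale radical_ideal A J
proof (intro radical_ideal.intro radical_ideal_axioms.intro)
  show "matrix_ring A" by (rule A.matrix_ring_axioms)
  show "ideal J A" by (rule f.kernel_is_ideal)
  show "\<one>\<^bsub>A\<^esub> \<oplus>\<^bsub>A\<^esub> a \<in> Units A" if "a \<in> J" for a
    using that unfolding J_iff by (elim conjE) (rule f_radical)
qed

lemma congruent_one_eq: "congruent_one = {M \<in> carrier A.SM. mmap M = \<one>\<^bsub>B.SM\<^esub>}"
proof -
  have "M i j \<ominus>\<^bsub>A\<^esub> A.kron i j \<in> J \<longleftrightarrow> f (M i j) = B.kron i j"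
    if M: "M \<in> carrier A.SM" for M i j
  proof -
    have c: "M i j \<in> carrier A" "A.kron i j \<in> carrier A" using A.SM_entry[OF M] by auto
    have "f (A.kron i j) = B.kron i j" by simp
    moreover have "f (M i j \<ominus>\<^bsub>A\<^esub> A.kron i j) = f (M i j) \<ominus>\<^bsub>B\<^esub> f (A.kron i j)"
      using c by (simp only: A.minus_eq B.minus_eq f.hom_add f.hom_a_inv A.a_inv_closed)
    ultimately show ?thesis using c unfolding J_iff by simp
  qed
  then show ?thesis
    unfolding congruent_one_def B.one_SM fun_eq_iff by (intro Collect_cong conj_cong) simp_all
qed

text \<open>Lift an invertible matrix and its inverse. The two products of the lifts are congruent to \<open>1\<close> modulo the
  kernel, hence invertible, so the lift has a right and a left inverse.\<close>

lemma mmap_GL_surj: "mmap ` carrier (GL A) = carrier (GL B)"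
proof (intro equalityI subsetI)
  fix M assume M: "M \<in> carrier (GL B)"
  then obtain N where N: "M \<in> carrier B.SM" "N \<in> carrier B.SM"
      "M \<otimes>\<^bsub>B.SM\<^esub> N = \<one>\<^bsub>B.SM\<^esub>" "N \<otimes>\<^bsub>B.SM\<^esub> M = \<one>\<^bsub>B.SM\<^esub>"
    by (auto simp: B.carrier_GL Units_def)
  have lift: "\<exists>P\<in>carrier A.SM. mmap P = L" if L: "L \<in> carrier B.SM" for L
  proof -
    obtain n where n: "in_block B n L" using L B.carrier_SM by blast
    have "\<exists>a\<in>carrier A. f a = L i j" for i j
      using f_surj B.SM_entry[OF L, of i j] by (metis imageE)
    then obtain P where P: "\<And>i j. P i j \<in> carrier A" "\<And>i j. f (P i j) = L i j" by metis
    let ?P = "\<lambda>i j. if i \<ge> n \<or> j \<ge> n then A.kron i j else P i j"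
    have "in_block A n ?P" using P by (auto simp: in_block_def)
    then have "?P \<in> carrier A.SM" using A.carrier_SM by blast
    moreover have "mmap ?P = L"
    proof (intro ext)
      fix i j show "f (?P i j) = L i j" using P B.in_block_outside[OF n, of i j] by auto
    qed
    ultimately show ?thesis by (intro bexI[of _ ?P])
  qed
  obtain M' where M': "M' \<in> carrier A.SM" "mmap M' = M" using lift[OF N(1)] by blast
  obtain N' where N': "N' \<in> carrier A.SM" "mmap N' = N" using lift[OF N(2)] by blast
  have "mmap (M' \<otimes>\<^bsub>A.SM\<^esub> N') = \<one>\<^bsub>B.SM\<^esub>" "mmap (N' \<otimes>\<^bsub>A.SM\<^esub> M') = \<one>\<^bsub>B.SM\<^esub>"
    using M' N' N by (simp_all only: mmap_mult)
  then have "M' \<otimes>\<^bsub>A.SM\<^esub> N' \<in> congruent_one" "N' \<otimes>\<^bsub>A.SM\<^esub> M' \<in> congruent_one"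
    unfolding congruent_one_eq using M'(1) N'(1) A.SM_mult_closed by auto
  then have U: "M' \<otimes>\<^bsub>A.SM\<^esub> N' \<in> Units A.SM" "N' \<otimes>\<^bsub>A.SM\<^esub> M' \<in> Units A.SM"
    using congruent_one_GL A.carrier_GL by auto
  have "M' \<in> Units A.SM"
  proof -
    obtain r where r: "r \<in> carrier A.SM" "M' \<otimes>\<^bsub>A.SM\<^esub> N' \<otimes>\<^bsub>A.SM\<^esub> r = \<one>\<^bsub>A.SM\<^esub>"
      using U(1) by (auto simp: Units_def)
    obtain l where l: "l \<in> carrier A.SM" "l \<otimes>\<^bsub>A.SM\<^esub> (N' \<otimes>\<^bsub>A.SM\<^esub> M') = \<one>\<^bsub>A.SM\<^esub>"
      using U(2) by (auto simp: Units_def)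
    have R: "M' \<otimes>\<^bsub>A.SM\<^esub> (N' \<otimes>\<^bsub>A.SM\<^esub> r) = \<one>\<^bsub>A.SM\<^esub>"
      using r M'(1) N'(1) by (simp add: A.SM.m_assoc)
    have L: "(l \<otimes>\<^bsub>A.SM\<^esub> N') \<otimes>\<^bsub>A.SM\<^esub> M' = \<one>\<^bsub>A.SM\<^esub>"
      using l M'(1) N'(1) by (simp add: A.SM.m_assoc)
    have "l \<otimes>\<^bsub>A.SM\<^esub> N' = N' \<otimes>\<^bsub>A.SM\<^esub> r"
      using A.SM.inv_unique[OF L R] M'(1) N'(1) l r by simp
    then show ?thesis using L R M'(1) N'(1) l(1) unfolding Units_def
      by (auto intro!: bexI[of _ "l \<otimes>\<^bsub>A.SM\<^esub> N'"])
  qed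
  then show "M \<in> mmap ` carrier (GL A)" using M'(2) A.carrier_GL by blast
qed (auto simp: mmap_GL)

lemma K1_map_surj: "K1_map B f ` carrier (K1 A) = carrier (K1 B)"
proof -
  have "K1_map B f ` carrier (K1 A) = (\<lambda>M. K1_class B (mmap M)) ` carrier (GL A)"
    unfolding A.carrier_K1 image_image by (rule image_cong) (simp_all add: K1_map_class)
  also have "\<dots> = K1_class B ` (mmap ` carrier (GL A))" by (simp add: image_image)
  finally show ?thesis by (simp add: mmap_GL_surj B.carrier_K1)
qed

text \<open>The group \<open>GL(A)\<close> maps onto \<open>GL(B)\<close>, so its commutator subgroup maps onto that of \<open>GL(B)\<close>. A matrix whose
  class dies in \<open>K\<^sub>1(B)\<close> can therefore be changed by a product of commutators into one that maps to \<open>1\<close>.\<close>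

lemma K1_map_kernel: "kernel (K1 A) (K1 B) (K1_map B f) = K1_class A ` congruent_one"
proof (intro equalityI subsetI)
  fix Y assume "Y \<in> kernel (K1 A) (K1 B) (K1_map B f)"
  then obtain M where M: "M \<in> carrier (GL A)" "Y = K1_class A M" "K1_map B f Y = \<one>\<^bsub>K1 B\<^esub>"
    by (auto simp: kernel_def A.carrier_K1)
  then have "mmap M \<in> B.E" by (simp add: K1_map_class B.K1_class_one_iff mmap_GL)
  also have "B.E = mmap ` A.E"
    using GLmap.derived_img[OF order.refl] mmap_GL_surj by simp
  finally obtain N where N: "N \<in> A.E" "mmap M = mmap N" by auto
  have NG: "N \<in> carrier (GL A)" using N(1) subgroup.mem_carrier[OF A.E_subgroup] by blast
  let ?P = "M \<otimes>\<^bsub>GL A\<^esub> inv\<^bsub>GL A\<^esub> N"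
  have PG: "?P \<in> carrier (GL A)" using M(1) NG by simp
  have "mmap ?P = mmap M \<otimes>\<^bsub>GL B\<^esub> inv\<^bsub>GL B\<^esub> mmap N"
    using GLmap.hom_mult[of M "inv\<^bsub>GL A\<^esub> N"] GLmap.hom_inv[of N] M(1) NG by simp
  also have "\<dots> = \<one>\<^bsub>B.SM\<^esub>" unfolding N(2) using mmap_GL[OF NG] by (simp add: B.one_GL[symmetric])
  finally have "?P \<in> congruent_one" unfolding congruent_one_eq using PG A.GL_SM by simp
  moreover have "Y = K1_class A ?P"
    using M NG A.K1_class_one_iff[OF NG] N(1) by simp
  ultimately show "Y \<in> K1_class A ` congruent_one" by blast
next
  fix Y assume "Y \<in> K1_class A ` congruent_one"
  then obtain M where M: "M \<in> congruent_one" "Y = K1_class A M" by blast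
  note MG = congruent_one_GL[OF M(1)]
  have "mmap M = \<one>\<^bsub>GL B\<^esub>" using M(1) by (simp add: congruent_one_eq B.one_GL)
  then have "K1_map B f Y = \<one>\<^bsub>K1 B\<^esub>" unfolding M(2) K1_map_class[OF MG] by (simp only: B.class_hom.hom_one)
  then show "Y \<in> kernel (K1 A) (K1 B) (K1_map B f)"
    using M(2) MG by (simp add: kernel_def)
qed

end

section \<open>Group rings\<close>

locale finite_group_ring = R: ring R + G: Group.group G
  for R :: "'r ring" and G :: "('g, 'm) monoid_scheme" +
  assumes finite_G: "finite (carrier G)"
begin

abbreviation RG where "RG \<equiv> group_ring R G"

lemma RG_simps:
  "carrier RG = carrier G \<rightarrow>\<^sub>E carrier R"
  "a \<otimes>\<^bsub>RG\<^esub> b = (\<lambda>g\<in>carrier G. \<Oplus>\<^bsub>R\<^esub>h\<in>carrier G. a h \<otimes>\<^bsub>R\<^esub> b (inv\<^bsub>G\<^esub> h \<otimes>\<^bsub>G\<^esub> g))"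
  "\<one>\<^bsub>RG\<^esub> = (\<lambda>g\<in>carrier G. if g = \<one>\<^bsub>G\<^esub> then \<one>\<^bsub>R\<^esub> else \<zero>\<^bsub>R\<^esub>)"
  "\<zero>\<^bsub>RG\<^esub> = (\<lambda>g\<in>carrier G. \<zero>\<^bsub>R\<^esub>)"
  "a \<oplus>\<^bsub>RG\<^esub> b = (\<lambda>g\<in>carrier G. a g \<oplus>\<^bsub>R\<^esub> b g)"
  by (simp_all add: group_ring_def)

lemma RG_coeff: "a \<in> carrier RG \<Longrightarrow> g \<in> carrier G \<Longrightarrow> a g \<in> carrier R"
  by (auto simp: RG_simps)

lemma RG_eqI:
  assumes "a \<in> carrier RG" "b \<in> carrier RG" "\<And>g. g \<in> carrier G \<Longrightarrow> a g = b g"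
  shows "a = b"
  using assms by (intro PiE_ext[of a _ _ b]) (auto simp: RG_simps(1))

lemma RG_mult_closed: "a \<in> carrier RG \<Longrightarrow> b \<in> carrier RG \<Longrightarrow> a \<otimes>\<^bsub>RG\<^esub> b \<in> carrier RG"
  unfolding RG_simps(2) by (simp add: RG_simps(1)) (auto intro!: R.finsum_closed simp: PiE_iff)

lemma RG_mult_at:
  "g \<in> carrier G \<Longrightarrow> (a \<otimes>\<^bsub>RG\<^esub> b) g = (\<Oplus>\<^bsub>R\<^esub>h\<in>carrier G. a h \<otimes>\<^bsub>R\<^esub> b (inv\<^bsub>G\<^esub> h \<otimes>\<^bsub>G\<^esub> g))"
  by (simp add: RG_simps)

lemma RG_assoc:
  assumes a: "a \<in> carrier RG" and b: "b \<in> carrier RG" and c: "c \<in> carrier RG"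
  shows "a \<otimes>\<^bsub>RG\<^esub> b \<otimes>\<^bsub>RG\<^esub> c = a \<otimes>\<^bsub>RG\<^esub> (b \<otimes>\<^bsub>RG\<^esub> c)"
proof (rule RG_eqI)
  fix g assume g: "g \<in> carrier G"
  note [simp] = RG_coeff[OF a] RG_coeff[OF b] RG_coeff[OF c] RG_coeff[OF RG_mult_closed[OF a b]]
    RG_coeff[OF RG_mult_closed[OF b c]] finite_G g
  let ?t = "\<lambda>k h. a k \<otimes>\<^bsub>R\<^esub> b (inv\<^bsub>G\<^esub> k \<otimes>\<^bsub>G\<^esub> h) \<otimes>\<^bsub>R\<^esub> c (inv\<^bsub>G\<^esub> h \<otimes>\<^bsub>G\<^esub> g)"
  have "(a \<otimes>\<^bsub>RG\<^esub> b \<otimes>\<^bsub>RG\<^esub> c) g = (\<Oplus>\<^bsub>R\<^esub>h\<in>carrier G. \<Oplus>\<^bsub>R\<^esub>k\<in>carrier G. ?t k h)"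
    unfolding RG_mult_at[OF g]
    by (intro R.finsum_cong' refl) (auto simp: RG_mult_at R.finsum_ldistr intro!: R.finsum_closed)
  also have "\<dots> = (\<Oplus>\<^bsub>R\<^esub>k\<in>carrier G. \<Oplus>\<^bsub>R\<^esub>h\<in>carrier G. ?t k h)"
    by (rule R.finsum_swap) auto
  \<comment> \<open>substitute \<open>h = k l\<close> in the inner sum\<close>
  also have "\<dots> = (\<Oplus>\<^bsub>R\<^esub>k\<in>carrier G. \<Oplus>\<^bsub>R\<^esub>l\<in>carrier G. ?t k (k \<otimes>\<^bsub>G\<^esub> l))"
  proof (rule R.finsum_cong'[OF refl])
    fix k assume k: "k \<in> carrier G"
    have "(\<Oplus>\<^bsub>R\<^esub>h\<in>(\<lambda>l. k \<otimes>\<^bsub>G\<^esub> l) ` carrier G. ?t k h) = (\<Oplus>\<^bsub>R\<^esub>l\<in>carrier G. ?t k (k \<otimes>\<^bsub>G\<^esub> l))"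
      using k by (intro R.finsum_reindex) (auto simp: G.inj_on_cmult)
    then show "(\<Oplus>\<^bsub>R\<^esub>h\<in>carrier G. ?t k h) = (\<Oplus>\<^bsub>R\<^esub>l\<in>carrier G. ?t k (k \<otimes>\<^bsub>G\<^esub> l))"
      using G.surj_const_mult[OF k] by simp
  qed (auto intro!: R.finsum_closed)
  also have "\<dots> = (\<Oplus>\<^bsub>R\<^esub>k\<in>carrier G. \<Oplus>\<^bsub>R\<^esub>l\<in>carrier G.
      a k \<otimes>\<^bsub>R\<^esub> (b l \<otimes>\<^bsub>R\<^esub> c (inv\<^bsub>G\<^esub> l \<otimes>\<^bsub>G\<^esub> (inv\<^bsub>G\<^esub> k \<otimes>\<^bsub>G\<^esub> g))))"
    by (intro R.finsum_cong' refl)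
      (auto simp: G.inv_mult_group G.m_assoc[symmetric] R.m_assoc intro!: R.finsum_closed)
  also have "\<dots> = (a \<otimes>\<^bsub>RG\<^esub> (b \<otimes>\<^bsub>RG\<^esub> c)) g"
    unfolding RG_mult_at[OF g]
    by (intro R.finsum_cong' refl) (auto simp: RG_mult_at R.finsum_rdistr intro!: R.finsum_closed)
  finally show "(a \<otimes>\<^bsub>RG\<^esub> b \<otimes>\<^bsub>RG\<^esub> c) g = (a \<otimes>\<^bsub>RG\<^esub> (b \<otimes>\<^bsub>RG\<^esub> c)) g" .
qed (use a b c in \<open>auto intro!: RG_mult_closed\<close>)

lemma RG_one_closed: "\<one>\<^bsub>RG\<^esub> \<in> carrier RG"
  by (auto simp: RG_simps)

lemma RG_one_mult:
  assumes a: "a \<in> carrier RG"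
  shows "\<one>\<^bsub>RG\<^esub> \<otimes>\<^bsub>RG\<^esub> a = a" "a \<otimes>\<^bsub>RG\<^esub> \<one>\<^bsub>RG\<^esub> = a"
proof -
  note [simp] = RG_coeff[OF a] finite_G
  show "\<one>\<^bsub>RG\<^esub> \<otimes>\<^bsub>RG\<^esub> a = a"
  proof (rule RG_eqI)
    fix g assume g: "g \<in> carrier G"
    have "(\<one>\<^bsub>RG\<^esub> \<otimes>\<^bsub>RG\<^esub> a) g = \<one>\<^bsub>RG\<^esub> \<one>\<^bsub>G\<^esub> \<otimes>\<^bsub>R\<^esub> a (inv\<^bsub>G\<^esub> \<one>\<^bsub>G\<^esub> \<otimes>\<^bsub>G\<^esub> g)"
      unfolding RG_mult_at[OF g] by (rule R.finsum_single) (use g in \<open>auto simp: RG_simps(3)\<close>)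
    then show "(\<one>\<^bsub>RG\<^esub> \<otimes>\<^bsub>RG\<^esub> a) g = a g" using g by (simp add: RG_simps(3))
  qed (use a in \<open>auto intro!: RG_mult_closed RG_one_closed\<close>)
  show "a \<otimes>\<^bsub>RG\<^esub> \<one>\<^bsub>RG\<^esub> = a"
  proof (rule RG_eqI)
    fix g assume g: "g \<in> carrier G"
    have ne: "inv\<^bsub>G\<^esub> l \<otimes>\<^bsub>G\<^esub> g \<noteq> \<one>\<^bsub>G\<^esub>" if "l \<in> carrier G" "l \<noteq> g" for l
      using that g G.inv_equality[of "inv\<^bsub>G\<^esub> l" g] G.inv_comm by (metis G.inv_closed G.inv_inv)
    have "(a \<otimes>\<^bsub>RG\<^esub> \<one>\<^bsub>RG\<^esub>) g = a g \<otimes>\<^bsub>R\<^esub> \<one>\<^bsub>RG\<^esub> (inv\<^bsub>G\<^esub> g \<otimes>\<^bsub>G\<^esub> g)"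
      unfolding RG_mult_at[OF g] by (rule R.finsum_single) (use g ne in \<open>auto simp: RG_simps(3)\<close>)
    then show "(a \<otimes>\<^bsub>RG\<^esub> \<one>\<^bsub>RG\<^esub>) g = a g" using g by (simp add: RG_simps(3))
  qed (use a in \<open>auto intro!: RG_mult_closed RG_one_closed\<close>)
qed

lemma RG_ring: "ring RG"
proof (rule ringI)
  show "abelian_group RG"
  proof (rule abelian_groupI)
    fix a assume a: "a \<in> carrier RG"
    show "\<exists>b\<in>carrier RG. b \<oplus>\<^bsub>RG\<^esub> a = \<zero>\<^bsub>RG\<^esub>"
      by (rule bexI[of _ "\<lambda>g\<in>carrier G. \<ominus>\<^bsub>R\<^esub> a g"])
        (use a in \<open>auto simp: RG_simps R.l_neg PiE_iff intro!: restrict_ext\<close>)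
    show "\<zero>\<^bsub>RG\<^esub> \<oplus>\<^bsub>RG\<^esub> a = a"
      by (rule RG_eqI) (use a in \<open>auto simp: RG_simps PiE_iff\<close>)
  qed (auto simp: RG_simps R.a_ac PiE_iff intro!: restrict_ext)
  show "Group.monoid RG"
    by (rule monoidI) (auto simp: RG_mult_closed RG_one_closed RG_assoc RG_one_mult)
  fix a b c assume a: "a \<in> carrier RG" and b: "b \<in> carrier RG" and c: "c \<in> carrier RG"
  note [simp] = RG_coeff[OF a] RG_coeff[OF b] RG_coeff[OF c] finite_G
  show "(a \<oplus>\<^bsub>RG\<^esub> b) \<otimes>\<^bsub>RG\<^esub> c = a \<otimes>\<^bsub>RG\<^esub> c \<oplus>\<^bsub>RG\<^esub> b \<otimes>\<^bsub>RG\<^esub> c"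
    unfolding RG_simps(2,5)
    by (rule restrict_ext) (simp add: R.l_distr R.finsum_addf Pi_def cong: R.finsum_cong)
  show "c \<otimes>\<^bsub>RG\<^esub> (a \<oplus>\<^bsub>RG\<^esub> b) = c \<otimes>\<^bsub>RG\<^esub> a \<oplus>\<^bsub>RG\<^esub> c \<otimes>\<^bsub>RG\<^esub> b"
    unfolding RG_simps(2,5)
    by (rule restrict_ext) (simp add: R.r_distr R.finsum_addf Pi_def cong: R.finsum_cong)
qed

sublocale RG: ring RG by (rule RG_ring)

lemma RG_uminus_at:
  assumes "a \<in> carrier RG" "g \<in> carrier G" shows "(\<ominus>\<^bsub>RG\<^esub> a) g = \<ominus>\<^bsub>R\<^esub> a g"
proof -
  have "((\<ominus>\<^bsub>RG\<^esub> a) \<oplus>\<^bsub>RG\<^esub> a) g = \<zero>\<^bsub>R\<^esub>"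
    using assms by (simp only: RG.l_neg) (simp add: RG_simps)
  then have "(\<ominus>\<^bsub>RG\<^esub> a) g \<oplus>\<^bsub>R\<^esub> a g = \<zero>\<^bsub>R\<^esub>" using assms by (simp add: RG_simps(5))
  then show ?thesis using assms RG_coeff R.minus_equality RG.a_inv_closed by metis
qed

lemma RG_minus_at:
  assumes "a \<in> carrier RG" "b \<in> carrier RG" "g \<in> carrier G"
  shows "(a \<ominus>\<^bsub>RG\<^esub> b) g = a g \<ominus>\<^bsub>R\<^esub> b g"
  using assms by (simp add: RG.minus_eq R.minus_eq RG_uminus_at RG_simps(5))

lemma RG_add_pow_at:
  assumes a: "a \<in> carrier RG" and g: "g \<in> carrier G"
  shows "(add_pow RG (k::nat) a) g = add_pow R k (a g)"
proof (induction k)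
  case 0
  then show ?case using g by (simp add: RG_simps)
next
  case (Suc k)
  have "add_pow RG (Suc k) a = add_pow RG k a \<oplus>\<^bsub>RG\<^esub> a"
    using a by (simp add: RG.add.nat_pow_Suc)
  then have "(add_pow RG (Suc k) a) g = (add_pow RG k a) g \<oplus>\<^bsub>R\<^esub> a g"
    using g by (simp add: RG_simps(5))
  then show ?case using Suc RG_coeff[OF a g] by (simp add: R.add.nat_pow_Suc)
qed

lemma matrix_ring_RG: "matrix_ring RG"
  by (simp add: matrix_ring_def RG_ring)

end

lemma group_ring_map_hom:
  assumes R: "finite_group_ring R G" and S: "finite_group_ring S G" and f: "f \<in> Ring.ring_hom R S"
  shows "group_ring_map G f \<in> Ring.ring_hom (group_ring R G) (group_ring S G)"
proof -
  interpret R: finite_group_ring R G by (rule R)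
  interpret S: finite_group_ring S G by (rule S)
  interpret f: ring_hom_ring R S f by (rule ring_hom_ringI2[OF R.R.ring_axioms S.R.ring_axioms f])
  show ?thesis
  proof (rule ring_hom_memI)
    fix a assume a: "a \<in> carrier R.RG"
    show "group_ring_map G f a \<in> carrier S.RG"
      using a by (auto simp: group_ring_map_def R.RG_simps S.RG_simps PiE_iff)
    fix b assume b: "b \<in> carrier R.RG"
    note [simp] = R.RG_coeff[OF a] R.RG_coeff[OF b] R.finite_G
    show "group_ring_map G f (a \<otimes>\<^bsub>R.RG\<^esub> b) = group_ring_map G f a \<otimes>\<^bsub>S.RG\<^esub> group_ring_map G f b"
      unfolding R.RG_simps S.RG_simps group_ring_map_def
      by (rule restrict_ext) (simp add: Pi_def o_def cong: S.R.finsum_cong)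
    show "group_ring_map G f (a \<oplus>\<^bsub>R.RG\<^esub> b) = group_ring_map G f a \<oplus>\<^bsub>S.RG\<^esub> group_ring_map G f b"
      unfolding R.RG_simps S.RG_simps group_ring_map_def
      by (rule restrict_ext) simp
  next
    show "group_ring_map G f \<one>\<^bsub>R.RG\<^esub> = \<one>\<^bsub>S.RG\<^esub>"
      unfolding R.RG_simps S.RG_simps group_ring_map_def
      by (rule restrict_ext) simp
  qed
qed

lemma matrix_ring_hom_group_ring_map:
  assumes "finite_group_ring R G" "finite_group_ring S G" "f \<in> Ring.ring_hom R S"
  shows "matrix_ring_hom (group_ring R G) (group_ring S G) (group_ring_map G f)"
  using assms by (simp add: matrix_ring_hom_def matrix_ring_hom_axioms_def group_ring_map_hom
      finite_group_ring.matrix_ring_RG)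

section \<open>Complete filtered rings\<close>

text \<open>The ordered rewriting of sums by \<open>a_ac\<close> can leave one or two summands between \<open>s\<close> and \<open>\<ominus> s\<close>; these rules
  cancel across them.\<close>

lemma (in abelian_group) r_neg_cancel:
  assumes "s \<in> carrier G" "a \<in> carrier G" "b \<in> carrier G" "c \<in> carrier G"
  shows "s \<oplus> (a \<oplus> \<ominus> s) = a" "s \<oplus> (a \<oplus> (\<ominus> s \<oplus> b)) = a \<oplus> b"
    "s \<oplus> (a \<oplus> (b \<oplus> \<ominus> s)) = a \<oplus> b"
    "s \<oplus> (a \<oplus> (b \<oplus> (\<ominus> s \<oplus> c))) = a \<oplus> (b \<oplus> c)"
  using assms by (simp_all add: a_lcomm[of s] r_neg r_neg2)

locale complete_filtered_ring = ring A for A :: "'a ring" (structure) +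
  fixes J :: "nat \<Rightarrow> 'a set"
  assumes J_ideal: "\<And>n. n \<ge> 1 \<Longrightarrow> ideal (J n) A"
    and J_mult: "\<And>n a b. n \<ge> 1 \<Longrightarrow> a \<in> J 1 \<Longrightarrow> b \<in> J n \<Longrightarrow> a \<otimes> b \<in> J (Suc n)"
    and J_decreasing: "\<And>n. n \<ge> 1 \<Longrightarrow> J (Suc n) \<subseteq> J n"
    and J_separated: "\<And>a. a \<in> carrier A \<Longrightarrow> (\<And>n. n \<ge> 1 \<Longrightarrow> a \<in> J n) \<Longrightarrow> a = \<zero>"
    and J_complete: "\<And>x. (\<And>n. n \<ge> 1 \<Longrightarrow> x n \<in> carrier A) \<Longrightarrow>
      (\<And>n. n \<ge> 1 \<Longrightarrow> x (Suc n) \<ominus> x n \<in> J n) \<Longrightarrow> \<exists>y\<in>carrier A. \<forall>n\<ge>1. y \<ominus> x n \<in> J n"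
begin

lemma J_carrier: "n \<ge> 1 \<Longrightarrow> a \<in> J n \<Longrightarrow> a \<in> carrier A"
  using ideal.Icarr[OF J_ideal] by blast

lemma J_le_1: "n \<ge> 1 \<Longrightarrow> J n \<subseteq> J 1"
  by (induction n rule: dec_induct) (use J_decreasing in auto)

lemma J_add: "n \<ge> 1 \<Longrightarrow> a \<in> J n \<Longrightarrow> b \<in> J n \<Longrightarrow> a \<oplus> b \<in> J n"
  using additive_subgroup.a_closed[OF ideal.axioms(1)[OF J_ideal]] by blast

lemma J_uminus: "n \<ge> 1 \<Longrightarrow> a \<in> J n \<Longrightarrow> \<ominus> a \<in> J n"
  using additive_subgroup.a_inv_closed[OF ideal.axioms(1)[OF J_ideal]] by blast

lemma J_l: "n \<ge> 1 \<Longrightarrow> a \<in> J n \<Longrightarrow> b \<in> carrier A \<Longrightarrow> b \<otimes> a \<in> J n"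
  using ideal.I_l_closed[OF J_ideal] by blast

lemma J_r: "n \<ge> 1 \<Longrightarrow> a \<in> J n \<Longrightarrow> b \<in> carrier A \<Longrightarrow> a \<otimes> b \<in> J n"
  using ideal.I_r_closed[OF J_ideal] by blast

lemma J_pow:
  assumes "a \<in> J 1" shows "a [^] Suc n \<in> J (Suc n)"
proof (induction n)
  case 0
  have "a \<in> carrier A" using J_carrier[OF _ assms] by simp
  then show ?case using assms by simp
next
  case (Suc n)
  have "a \<in> carrier A" using J_carrier[OF _ assms] by simp
  then have "a [^] Suc (Suc n) = a \<otimes> a [^] Suc n"
    by (rule nat_pow_Suc2)
  then show ?case using J_mult[OF _ assms Suc] by simp
qed

text \<open>With \<open>b = -a\<close> the partial sums \<open>s\<^sub>n = 1 + b + \<dots> + b\<^sup>n\<^sup>-\<^sup>1\<close> of the geometric series converge to an inverse of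
  \<open>1 + a\<close>. Since \<open>A\<close> need not be commutative, both sides are checked.\<close>

lemma one_plus_J_unit:
  assumes a: "a \<in> J 1" shows "\<one> \<oplus> a \<in> Units A"
proof -
  have ac: "a \<in> carrier A" using a J_carrier[of 1] by simp
  define b where "b = \<ominus> a"
  have b: "b \<in> J 1" "b \<in> carrier A" using a ac J_uminus[of 1] by (auto simp: b_def)
  have a_b: "a = \<ominus> b" using ac by (simp add: b_def)
  define s where "s = rec_nat \<zero> (\<lambda>n x. \<one> \<oplus> b \<otimes> x)"
  have s0: "s 0 = \<zero>" and sS: "s (Suc n) = \<one> \<oplus> b \<otimes> s n" for n by (simp_all add: s_def)
  have sc: "s n \<in> carrier A" for n by (induction n) (use b s0 sS in auto)
  have comm: "b \<otimes> s n = s n \<otimes> b" for n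
  proof (induction n)
    case (Suc n)
    have "b \<otimes> (b \<otimes> s n) = b \<otimes> (s n \<otimes> b)" by (simp only: Suc)
    then show ?case using b sc[of n] by (simp add: sS r_distr l_distr m_assoc)
  qed (use b s0 in simp)
  have diff: "s (Suc n) \<ominus> s n = b [^] n" for n
  proof (induction n)
    case (Suc n)
    have "s (Suc (Suc n)) \<ominus> s (Suc n) = b \<otimes> (s (Suc n) \<ominus> s n)"
      unfolding sS[of "Suc n"] sS[of n]
      using b(2) sc[of n] sc[of "Suc n"] 
      by (simp add: minus_eq r_distr r_minus minus_add a_ac r_neg1 r_neg2 r_neg l_neg sS)
    also have "\<dots> = b [^] Suc n" unfolding Suc using b nat_pow_Suc2 by simp
    finally show ?case .
  qed (use b in \<open>simp add: s0 sS minus_eq\<close>)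
  obtain y where y: "y \<in> carrier A" "\<And>n. n \<ge> 1 \<Longrightarrow> y \<ominus> s n \<in> J n"
  proof -
    have "\<exists>y\<in>carrier A. \<forall>n\<ge>1. y \<ominus> s n \<in> J n"
    proof (rule J_complete[OF sc])
      fix n :: nat assume "n \<ge> 1"
      then obtain k where "n = Suc k" by (cases n) auto
      then show "s (Suc n) \<ominus> s n \<in> J n" using diff[of n] J_pow[OF b(1), of k] by simp
    qed
    then show ?thesis using that by blast
  qed
  have l: "(\<one> \<oplus> a) \<otimes> y = \<one>" and r: "y \<otimes> (\<one> \<oplus> a) = \<one>"
  proof -
    have 1: "(\<one> \<oplus> a) \<otimes> y \<ominus> \<one> = (\<one> \<oplus> a) \<otimes> (y \<ominus> s n) \<ominus> (s (Suc n) \<ominus> s n)" for n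
      using b(2) y(1) sc[of n] unfolding a_b sS
      by (simp add: minus_eq l_distr r_distr l_minus r_minus minus_add a_ac r_neg1 r_neg2 r_neg l_neg r_neg_cancel)
    have 2: "y \<otimes> (\<one> \<oplus> a) \<ominus> \<one> = (y \<ominus> s n) \<otimes> (\<one> \<oplus> a) \<ominus> (s (Suc n) \<ominus> s n)" for n
      using b(2) y(1) sc[of n] comm[of n] unfolding a_b sS
      by (simp add: minus_eq l_distr r_distr l_minus r_minus minus_add a_ac r_neg1 r_neg2 r_neg l_neg r_neg_cancel)
    have pow: "s (Suc n) \<ominus> s n \<in> J n" if "n \<ge> 1" for n
      using that diff[of n] J_pow[OF b(1), of "n - 1"] by simp
    have "(\<one> \<oplus> a) \<otimes> y \<ominus> \<one> = \<zero>"
    proof (rule J_separated)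
      fix n :: nat assume n: "n \<ge> 1"
      show "(\<one> \<oplus> a) \<otimes> y \<ominus> \<one> \<in> J n" 
      proof -
        have "(\<one> \<oplus> a) \<otimes> (y \<ominus> s n) \<in> J n" by (rule J_l[OF n y(2)[OF n]]) (use ac in simp)
        from J_add[OF n this J_uminus[OF n pow[OF n]]] show ?thesis
          unfolding 1[of n] by (simp only: minus_eq)
      qed
    qed (use ac y in auto)
    then show "(\<one> \<oplus> a) \<otimes> y = \<one>" using ac y(1) by simp
    have "y \<otimes> (\<one> \<oplus> a) \<ominus> \<one> = \<zero>"
    proof (rule J_separated)
      fix n :: nat assume n: "n \<ge> 1"
      show "y \<otimes> (\<one> \<oplus> a) \<ominus> \<one> \<in> J n" 
      proof -
        have "(y \<ominus> s n) \<otimes> (\<one> \<oplus> a) \<in> J n" by (rule J_r[OF n y(2)[OF n]]) (use ac in simp)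
        from J_add[OF n this J_uminus[OF n pow[OF n]]] show ?thesis
          unfolding 2[of n] by (simp only: minus_eq)
      qed
    qed (use ac y in auto)
    then show "y \<otimes> (\<one> \<oplus> a) = \<one>" using ac y(1) by simp
  qed
  show ?thesis using l r y ac by (auto simp: Units_def)
qed

text \<open>The partial products \<open>u n\<close> are units that converge to a unit \<open>v\<close>, because consecutive ones differ by
  \<open>u n a\<^sub>n \<in> J n\<close>. The quotient \<open>u\<^sub>n\<^sup>-\<^sup>1 v\<close> lies in \<open>1 + J n\<close>, which is how the limit is compared with its
  approximations in \<open>K\<^sub>1\<close>.\<close>

lemma infinite_product:
  assumes a: "\<And>n. n \<ge> 1 \<Longrightarrow> a n \<in> J n"
    and u1: "u 1 = \<one>" and uS: "\<And>n. n \<ge> 1 \<Longrightarrow> u (Suc n) = u n \<otimes> (\<one> \<oplus> a n)"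
  obtains v where "v \<in> Units A" "v \<ominus> \<one> \<in> J 1"
    "\<And>n. n \<ge> 1 \<Longrightarrow> u n \<in> Units A \<and> u n \<ominus> \<one> \<in> J 1 \<and> (\<exists>b\<in>J n. v = u n \<otimes> (\<one> \<oplus> b))"
proof -
  have ac[simp]: "a n \<in> carrier A" if "n \<ge> 1" for n using a[OF that] J_carrier[OF that] by simp
  have uU: "u n \<in> Units A" if "n \<ge> 1" for n
    using that
  proof (induction n rule: dec_induct)
    case (step n)
    then show ?case using uS a one_plus_J_unit J_le_1 by (metis Units_m_closed subsetD)
  qed (use u1 in simp)
  have uc: "u n \<in> carrier A" if "n \<ge> 1" for n using uU[OF that] by blast
  have diff: "u (Suc n) \<ominus> u n = u n \<otimes> a n" if n: "n \<ge> 1" for n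
    using uc[OF n] ac[OF n] uS[OF n] by (simp add: r_distr minus_eq a_ac r_neg r_neg1 r_neg2 l_neg)
  have "\<exists>v\<in>carrier A. \<forall>n\<ge>1. v \<ominus> u n \<in> J n"
    by (rule J_complete) (use uc diff a in \<open>auto intro!: J_l\<close>)
  then obtain v where v: "v \<in> carrier A" "\<And>n. n \<ge> 1 \<Longrightarrow> v \<ominus> u n \<in> J n" by blast
  have v1: "v \<ominus> \<one> \<in> J 1" using v(2)[of 1] u1 by simp
  have "\<one> \<oplus> (v \<ominus> \<one>) = v" using v(1) by (simp add: minus_eq a_lcomm r_neg)
  then have vU: "v \<in> Units A" using one_plus_J_unit[OF v1] by simp
  have 1: "u n \<ominus> \<one> \<in> J 1" if n: "n \<ge> 1" for n
  proof -
    have "u n \<ominus> \<one> = (v \<ominus> \<one>) \<ominus> (v \<ominus> u n)"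
      using uc[OF n] v(1) by (simp add: minus_eq minus_add a_ac r_neg r_neg1 r_neg2 l_neg)
    moreover have "\<dots> \<in> J 1" unfolding minus_eq[of "v \<ominus> \<one>"]
      using v1 v(2)[OF n] J_le_1[OF n] by (intro J_add J_uminus) auto
    ultimately show ?thesis by simp
  qed
  have 2: "\<exists>b\<in>J n. v = u n \<otimes> (\<one> \<oplus> b)" if n: "n \<ge> 1" for n
  proof (rule bexI[of _ "inv (u n) \<otimes> (v \<ominus> u n)"])
    have "u n \<otimes> (\<one> \<oplus> inv (u n) \<otimes> (v \<ominus> u n)) = u n \<oplus> (u n \<otimes> inv (u n)) \<otimes> (v \<ominus> u n)"
      using uU[OF n] uc[OF n] v(1) by (simp add: r_distr m_assoc del: Units_r_inv)
    also have "\<dots> = v" using uU[OF n] uc[OF n] v(1) by (simp add: minus_eq a_lcomm r_neg)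
    finally show "v = u n \<otimes> (\<one> \<oplus> inv (u n) \<otimes> (v \<ominus> u n))" by simp
    show "inv (u n) \<otimes> (v \<ominus> u n) \<in> J n" using n uU[OF n] v(2)[OF n] by (intro J_l) auto
  qed
  show thesis using that[OF vU v1] uU 1 2 by blast
qed

end

section \<open>Group rings over a p-adically complete ring\<close>

locale p_complete_ring = cring R for R :: "'r ring" (structure) and p :: nat +
  assumes limit_iso: "(\<lambda>r. \<lambda>n\<in>{1..}. reduction p R n r)
     \<in> ring_iso R (inverse_limit_ring (ppow_quot p R) (ppow_trans p R))"
begin

abbreviation I where "I n \<equiv> ppow_ideal p R n"

lemma I_iff: "r \<in> I n \<longleftrightarrow> (\<exists>x\<in>carrier R. r = add_pow R (p ^ n) x)"
proof -
  have "x \<otimes> add_pow R (p ^ n) \<one> = add_pow R (p ^ n) x" if "x \<in> carrier R" for x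
    using that by (simp add: add_pow_rdistr)
  then show ?thesis unfolding ppow_ideal_def cgenideal_def mem_Collect_eq Bex_def by metis
qed

lemma I_ideal: "ideal (I n) R"
  unfolding ppow_ideal_def by (rule cgenideal_ideal) simp

lemma I_Suc: "I (Suc n) \<subseteq> I n"
proof
  fix r assume "r \<in> I (Suc n)"
  then obtain x where "x \<in> carrier R" "r = add_pow R (p ^ Suc n) x" by (auto simp: I_iff)
  then have "r = add_pow R (p ^ n) (add_pow R p x)" by (simp add: add.nat_pow_pow mult.commute)
  then show "r \<in> I n" using \<open>x \<in> carrier R\<close> by (auto simp: I_iff)
qed

lemma I_mult: "r \<in> I 1 \<Longrightarrow> s \<in> I n \<Longrightarrow> r \<otimes> s \<in> I (Suc n)"
proof -
  assume "r \<in> I 1" "s \<in> I n"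
  then obtain x y where xy: "x \<in> carrier R" "y \<in> carrier R" "r = add_pow R p x" "s = add_pow R (p ^ n) y"
    by (auto simp: I_iff)
  then have "r \<otimes> s = add_pow R (p ^ Suc n) (x \<otimes> y)"
    by (simp add: add_pow_ldistr add_pow_rdistr add.nat_pow_pow mult.commute)
  then show ?thesis using xy by (auto simp: I_iff)
qed

lemma reduction_hom: "reduction p R n \<in> Ring.ring_hom R (ppow_quot p R n)"
  unfolding reduction_def[abs_def] ppow_quot_def using ideal.rcos_ring_hom[OF I_ideal] .

lemma ppow_quot_ring: "ring (ppow_quot p R n)"
  unfolding ppow_quot_def by (rule ideal.quotient_is_ring[OF I_ideal])

lemma reduction_surj: "reduction p R n ` carrier R = carrier (ppow_quot p R n)"
  by (auto simp: reduction_def ppow_quot_def FactRing_def A_RCOSETS_def')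

lemma reduction_eq_iff:
  assumes "r \<in> carrier R" "s \<in> carrier R"
  shows "reduction p R n r = reduction p R n s \<longleftrightarrow> r \<ominus> s \<in> I n"
proof -
  interpret ideal "I n" R by (rule I_ideal)
  show ?thesis unfolding reduction_def using assms by (metis quotient_eq_iff_same_a_r_cos ideal_axioms)
qed

lemma reduction_zero_iff:
  assumes "r \<in> carrier R" shows "reduction p R n r = \<zero>\<^bsub>ppow_quot p R n\<^esub> \<longleftrightarrow> r \<in> I n"
proof -
  have "\<zero>\<^bsub>ppow_quot p R n\<^esub> = reduction p R n \<zero>"
    using ring_hom_zero[OF reduction_hom ring_axioms ppow_quot_ring] by simp
  then show ?thesis using assms by (simp add: reduction_eq_iff minus_eq)
qed

lemma ppow_trans_reduction:
  assumes "r \<in> carrier R" shows "ppow_trans p R n (reduction p R (Suc n) r) = reduction p R n r"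
  unfolding ppow_trans_def
proof (rule on_cosets_eq)
  interpret ideal "I (Suc n)" R by (rule I_ideal)
  show "r \<in> reduction p R (Suc n) r" unfolding reduction_def using assms a_rcos_self by blast
  fix s assume s: "s \<in> reduction p R (Suc n) r"
  then have sc: "s \<in> carrier R"
    using assms a_r_coset_subset_G[of "I (Suc n)" r] a_subset unfolding reduction_def by blast
  have "I (Suc n) +> r = I (Suc n) +> s" using a_repr_independence[OF _ assms a_subgroup] s
    unfolding reduction_def by blast
  then have "r \<ominus> s \<in> I (Suc n)" using reduction_eq_iff[OF assms sc] by (simp add: reduction_def)
  then show "reduction p R n s = reduction p R n r"
    using I_Suc reduction_eq_iff[OF assms sc] by auto
qed

lemma ppow_trans_hom: "ppow_trans p R n \<in> Ring.ring_hom (ppow_quot p R (Suc n)) (ppow_quot p R n)"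
proof (rule ring_hom_memI)
  note S = reduction_surj[of "Suc n", symmetric]
  note h = reduction_hom[THEN ring_hom_closed] reduction_hom[THEN ring_hom_mult, symmetric]
    reduction_hom[THEN ring_hom_add, symmetric]
  fix a assume "a \<in> carrier (ppow_quot p R (Suc n))"
  then obtain r where r: "r \<in> carrier R" "a = reduction p R (Suc n) r" unfolding S by blast
  then show "ppow_trans p R n a \<in> carrier (ppow_quot p R n)" by (simp add: ppow_trans_reduction h(1))
  fix b assume "b \<in> carrier (ppow_quot p R (Suc n))"
  then obtain s where s: "s \<in> carrier R" "b = reduction p R (Suc n) s" unfolding S by blast
  show "ppow_trans p R n (a \<otimes>\<^bsub>ppow_quot p R (Suc n)\<^esub> b)
      = ppow_trans p R n a \<otimes>\<^bsub>ppow_quot p R n\<^esub> ppow_trans p R n b"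
    using r s by (simp add: ppow_trans_reduction h(2))
  show "ppow_trans p R n (a \<oplus>\<^bsub>ppow_quot p R (Suc n)\<^esub> b)
      = ppow_trans p R n a \<oplus>\<^bsub>ppow_quot p R n\<^esub> ppow_trans p R n b"
    using r s by (simp add: ppow_trans_reduction h(3))
next
  show "ppow_trans p R n \<one>\<^bsub>ppow_quot p R (Suc n)\<^esub> = \<one>\<^bsub>ppow_quot p R n\<^esub>"
    using ppow_trans_reduction[of "\<one>" n] ring_hom_one[OF reduction_hom] by simp
qed

lemma I_separated:
  assumes r: "r \<in> carrier R" and I: "\<And>n. n \<ge> 1 \<Longrightarrow> r \<in> I n"
  shows "r = \<zero>"
proof -
  have "inj_on (\<lambda>r. \<lambda>n\<in>{1..}. reduction p R n r) (carrier R)"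
    using limit_iso by (auto simp: ring_iso_def bij_betw_def)
  moreover have "(\<lambda>n\<in>{1..}. reduction p R n r) = (\<lambda>n\<in>{1..}. reduction p R n \<zero>)"
    using r I by (intro restrict_ext) (simp add: reduction_eq_iff minus_eq)
  ultimately show ?thesis using r by (auto dest: inj_onD)
qed

text \<open>The residues of the \<open>r n\<close> form an element of the inverse limit of the \<open>R/p\<^sup>nR\<close>, which comes from \<open>R\<close>.\<close>

lemma I_complete:
  assumes c: "\<And>n. n \<ge> 1 \<Longrightarrow> r n \<in> carrier R" and d: "\<And>n. n \<ge> 1 \<Longrightarrow> r (Suc n) \<ominus> r n \<in> I n"
  obtains s where "s \<in> carrier R" "\<And>n. n \<ge> 1 \<Longrightarrow> s \<ominus> r n \<in> I n"
proof -
  let ?x = "\<lambda>n\<in>{1..}. reduction p R n (r n)"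
  have "?x \<in> inverse_limit_set (\<lambda>n. carrier (ppow_quot p R n)) (ppow_trans p R)"
    using c d by (intro inverse_limit_setI)
      (simp_all add: ppow_trans_reduction reduction_eq_iff ring_hom_closed[OF reduction_hom])
  then have "?x \<in> (\<lambda>r. \<lambda>n\<in>{1..}. reduction p R n r) ` carrier R"
    using limit_iso by (auto simp: ring_iso_def bij_betw_def inverse_limit_ring_def)
  then obtain s where s: "s \<in> carrier R" "?x = (\<lambda>n\<in>{1..}. reduction p R n s)" by blast
  have "s \<ominus> r n \<in> I n" if "n \<ge> 1" for n
    using fun_cong[OF s(2), of n] that reduction_eq_iff[OF s(1) c[OF that], of n] by simp
  then show thesis using that s(1) by blast
qed

end

locale p_complete_group_ring = R: p_complete_ring R p + finite_group_ring R G
  for R :: "'r ring" and p :: nat and G :: "('g, 'm) monoid_scheme"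
begin

definition J :: "nat \<Rightarrow> ('g \<Rightarrow> 'r) set" where
  "J n = {a \<in> carrier RG. \<forall>g\<in>carrier G. a g \<in> R.I n}"

abbreviation level where "level n \<equiv> group_ring (ppow_quot p R n) G"

lemma level_finite_group_ring: "finite_group_ring (ppow_quot p R n) G"
  using R.ppow_quot_ring G.is_group finite_G
  by (simp add: finite_group_ring_def finite_group_ring_axioms_def)

lemma reduction_matrix_hom: "matrix_ring_hom RG (level n) (group_ring_map G (reduction p R n))"
  using matrix_ring_hom_group_ring_map finite_group_ring_axioms level_finite_group_ring R.reduction_hom .

lemma trans_matrix_hom: "matrix_ring_hom (level (Suc n)) (level n) (group_ring_map G (ppow_trans p R n))"
  using matrix_ring_hom_group_ring_map level_finite_group_ring level_finite_group_ring R.ppow_trans_hom .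

lemma J_eq_kernel: "J n = a_kernel RG (level n) (group_ring_map G (reduction p R n))"
proof -
  interpret L: finite_group_ring "ppow_quot p R n" G by (rule level_finite_group_ring)
  have "(\<forall>g\<in>carrier G. a g \<in> R.I n) \<longleftrightarrow> group_ring_map G (reduction p R n) a = \<zero>\<^bsub>level n\<^esub>"
    if a: "a \<in> carrier RG" for a
    unfolding L.RG_simps group_ring_map_def using R.reduction_zero_iff[OF RG_coeff[OF a]]
    by (auto simp: restrict_def fun_eq_iff)
  then show ?thesis unfolding J_def a_kernel_def' by blast
qed

lemma J_eq_multiples: "J n = add_pow RG (p ^ n) ` carrier RG"
proof (intro equalityI subsetI)
  fix a assume a: "a \<in> J n"
  then have "\<exists>x\<in>carrier R. a g = add_pow R (p ^ n) x" if "g \<in> carrier G" for g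
    using that by (auto simp: J_def R.I_iff)
  then obtain b where b: "\<And>g. g \<in> carrier G \<Longrightarrow> b g \<in> carrier R \<and> a g = add_pow R (p ^ n) (b g)"
    by metis
  have bc: "restrict b (carrier G) \<in> carrier RG" using b by (auto simp: RG_simps)
  have "a = add_pow RG (p ^ n) (restrict b (carrier G))"
    by (rule RG_eqI) (use a b bc in \<open>auto simp: J_def RG_add_pow_at\<close>)
  then show "a \<in> add_pow RG (p ^ n) ` carrier RG" using bc by blast
next
  fix a assume "a \<in> add_pow RG (p ^ n) ` carrier RG"
  then show "a \<in> J n" by (auto simp: J_def R.I_iff RG_add_pow_at intro!: RG_coeff)
qed

text \<open>Separatedness and completeness are those of \<open>R\<close>, coefficient by coefficient.\<close>

lemma RG_complete: "complete_filtered_ring RG J"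
proof (rule complete_filtered_ring.intro[OF RG_ring complete_filtered_ring_axioms.intro])
  fix n :: nat
  interpret h: matrix_ring_hom RG "level n" "group_ring_map G (reduction p R n)" by (rule reduction_matrix_hom)
  show "ideal (J n) RG" unfolding J_eq_kernel by (rule h.f.kernel_is_ideal)
  show "J (Suc n) \<subseteq> J n" using R.I_Suc by (auto simp: J_def)
  fix a b assume a: "a \<in> J 1" and b: "b \<in> J n"
  have ab: "a \<in> carrier RG" "b \<in> carrier RG" using a b by (auto simp: J_def)
  have I: "additive_subgroup (R.I (Suc n)) R" using R.I_ideal by (rule ideal.axioms(1))
  have sum: "finsum R f S \<in> R.I (Suc n)" if "finite S" "\<And>h. h \<in> S \<Longrightarrow> f h \<in> R.I (Suc n)" for f and S :: "'g set"
    using that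
  proof (induction S)
    case (insert x S)
    have "f \<in> S \<rightarrow> carrier R" "f x \<in> carrier R"
      using insert.prems ideal.Icarr[OF R.I_ideal] by auto
    then show ?case using insert additive_subgroup.a_closed[OF I] by simp
  qed (use additive_subgroup.zero_closed[OF I] in simp)
  show "a \<otimes>\<^bsub>RG\<^esub> b \<in> J (Suc n)"
    using a b RG_mult_closed[OF ab] finite_G
    by (auto simp: J_def RG_mult_at intro!: sum R.I_mult)
next
  fix a assume a: "a \<in> carrier RG" and J: "\<And>n. n \<ge> 1 \<Longrightarrow> a \<in> J n"
  show "a = \<zero>\<^bsub>RG\<^esub>"
  proof (rule RG_eqI[OF a RG.zero_closed])
    fix g assume g: "g \<in> carrier G"
    have "a g = \<zero>\<^bsub>R\<^esub>" by (rule R.I_separated) (use J g RG_coeff[OF a g] in \<open>auto simp: J_def\<close>)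
    then show "a g = \<zero>\<^bsub>RG\<^esub> g" using g by (simp add: RG_simps)
  qed
next
  fix x assume x: "\<And>n. n \<ge> 1 \<Longrightarrow> x n \<in> carrier RG"
    and d: "\<And>n. n \<ge> 1 \<Longrightarrow> x (Suc n) \<ominus>\<^bsub>RG\<^esub> x n \<in> J n"
  have "\<exists>s. s \<in> carrier R \<and> (\<forall>n\<ge>1. s \<ominus>\<^bsub>R\<^esub> x n g \<in> R.I n)" if g: "g \<in> carrier G" for g
  proof -
    obtain s where "s \<in> carrier R" "\<And>n. n \<ge> 1 \<Longrightarrow> s \<ominus>\<^bsub>R\<^esub> x n g \<in> R.I n"
    proof (rule R.I_complete[of "\<lambda>n. x n g"])
      fix n :: nat assume n: "n \<ge> 1"
      show "x n g \<in> carrier R" using RG_coeff[OF x[OF n] g] .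
      show "x (Suc n) g \<ominus>\<^bsub>R\<^esub> x n g \<in> R.I n"
      proof -
        have "(x (Suc n) \<ominus>\<^bsub>RG\<^esub> x n) g \<in> R.I n" using d[OF n] g by (simp add: J_def)
        then show ?thesis using RG_minus_at[OF x[of "Suc n"] x[OF n] g] by simp
      qed
    qed blast
    then show ?thesis by blast
  qed
  then obtain y where y: "\<And>g. g \<in> carrier G \<Longrightarrow> y g \<in> carrier R \<and> (\<forall>n\<ge>1. y g \<ominus>\<^bsub>R\<^esub> x n g \<in> R.I n)"
    by metis
  let ?y = "restrict y (carrier G)"
  have yc: "?y \<in> carrier RG" using y by (auto simp: RG_simps)
  have "?y \<ominus>\<^bsub>RG\<^esub> x n \<in> J n" if n: "n \<ge> 1" for n
    using y n yc x[OF n] RG.minus_closed[OF yc x[OF n]] by (simp add: J_def RG_minus_at)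
  then show "\<exists>y\<in>carrier RG. \<forall>n\<ge>1. y \<ominus>\<^bsub>RG\<^esub> x n \<in> J n" using yc by blast
qed

sublocale complete_filtered_ring RG J by (rule RG_complete)

lemma reduction_radical_surjection:
  assumes n: "n \<ge> 1"
  shows "radical_surjection RG (level n) (group_ring_map G (reduction p R n))"
proof -
  interpret h: matrix_ring_hom RG "level n" "group_ring_map G (reduction p R n)" by (rule reduction_matrix_hom)
  interpret L: finite_group_ring "ppow_quot p R n" G by (rule level_finite_group_ring)
  show ?thesis
  proof (rule radical_surjection.intro[OF reduction_matrix_hom radical_surjection_axioms.intro])
    show "group_ring_map G (reduction p R n) ` carrier RG = carrier (level n)"
    proof (intro equalityI subsetI)
      fix b assume b: "b \<in> carrier (level n)"
      then have "\<exists>r\<in>carrier R. reduction p R n r = b g" if "g \<in> carrier G" for g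
        using L.RG_coeff[OF b that] R.reduction_surj[of n] by (metis imageE)
      then obtain a where a: "\<And>g. g \<in> carrier G \<Longrightarrow> a g \<in> carrier R \<and> reduction p R n (a g) = b g"
        by metis
      have ac: "restrict a (carrier G) \<in> carrier RG" using a by (auto simp: RG_simps)
      have "group_ring_map G (reduction p R n) (restrict a (carrier G)) = b"
        by (rule L.RG_eqI) (use a b h.f.hom_closed[OF ac] in \<open>auto simp: group_ring_map_def\<close>)
      then show "b \<in> group_ring_map G (reduction p R n) ` carrier RG" using ac by blast
    qed (use h.f.hom_closed in blast)
    fix a assume "a \<in> carrier RG" "group_ring_map G (reduction p R n) a = \<zero>\<^bsub>level n\<^esub>"
    then have "a \<in> J n" unfolding J_eq_kernel a_kernel_def' by simp
    then show "\<one>\<^bsub>RG\<^esub> \<oplus>\<^bsub>RG\<^esub> a \<in> Units RG" using one_plus_J_unit J_le_1[OF n] by blast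
  qed
qed

lemma radical_ideal_J: "n \<ge> 1 \<Longrightarrow> radical_ideal RG (J n)"
  using radical_ideal.intro[OF matrix_ring_RG J_ideal radical_ideal_axioms.intro]
    one_plus_J_unit J_le_1 by blast

lemma congruence_matrices_eq:
  assumes n: "n \<ge> 1"
  shows "congruence_matrices p RG n = radical_ideal.congruent_one RG (J n)"
proof -
  interpret M: radical_ideal RG "J n" by (rule radical_ideal_J[OF n])
  show ?thesis
  proof (intro equalityI subsetI)
    fix N assume "N \<in> congruence_matrices p RG n"
    then obtain Y where Y: "Y \<in> M_infinity RG"
      "N = (\<lambda>i j. M.kron i j \<oplus>\<^bsub>RG\<^esub> add_pow RG (p ^ n) (Y i j))"
      unfolding congruence_matrices_def by blast
    have Yc[simp]: "Y i j \<in> carrier RG" for i j using Y(1) by (simp add: M_infinity_def)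
    obtain m where m: "\<And>i j. i \<ge> m \<or> j \<ge> m \<Longrightarrow> Y i j = \<zero>\<^bsub>RG\<^esub>" using Y(1) unfolding M_infinity_def by blast
    have "in_block RG m N" using m unfolding in_block_def Y(2) by auto
    moreover have "N i j \<ominus>\<^bsub>RG\<^esub> M.kron i j \<in> J n" for i j
    proof -
      have "N i j \<ominus>\<^bsub>RG\<^esub> M.kron i j = add_pow RG (p ^ n) (Y i j)"
        unfolding Y(2) by (simp add: RG.minus_eq RG.a_comm RG.a_lcomm RG.r_neg)
      then show ?thesis unfolding J_eq_multiples by simp
    qed
    ultimately show "N \<in> M.congruent_one" unfolding M.congruent_one_def M.carrier_SM by blast
  next
    fix N assume "N \<in> M.congruent_one"
    then have N: "N \<in> carrier M.SM" "\<And>i j. N i j \<ominus>\<^bsub>RG\<^esub> M.kron i j \<in> J n"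
      by (auto simp: M.congruent_one_def)
    obtain m where m: "in_block RG m N" using N(1) M.carrier_SM by blast
    have "\<exists>y\<in>carrier RG. N i j \<ominus>\<^bsub>RG\<^esub> M.kron i j = add_pow RG (p ^ n) y" for i j
      using N(2)[of i j] unfolding J_eq_multiples by blast
    then obtain Y where Y: "\<And>i j. Y i j \<in> carrier RG"
      "\<And>i j. N i j \<ominus>\<^bsub>RG\<^esub> M.kron i j = add_pow RG (p ^ n) (Y i j)" by metis
    let ?Y = "\<lambda>i j. if i \<ge> m \<or> j \<ge> m then \<zero>\<^bsub>RG\<^esub> else Y i j"
    have "?Y \<in> M_infinity RG" using Y(1) by (auto simp: M_infinity_def)
    moreover have "N = (\<lambda>i j. M.kron i j \<oplus>\<^bsub>RG\<^esub> add_pow RG (p ^ n) (?Y i j))"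
    proof (rule ext, rule ext)
      fix i j
      have Nc: "N i j \<in> carrier RG" by (rule M.SM_entry[OF N(1)])
      show "N i j = M.kron i j \<oplus>\<^bsub>RG\<^esub> add_pow RG (p ^ n) (?Y i j)"
      proof (cases "i \<ge> m \<or> j \<ge> m")
        case True
        then show ?thesis using M.in_block_outside[OF m True] by simp
      next
        case False
        have "M.kron i j \<oplus>\<^bsub>RG\<^esub> (N i j \<ominus>\<^bsub>RG\<^esub> M.kron i j) = N i j"
          using Nc by (simp add: RG.minus_eq RG.a_lcomm RG.r_neg)
        then show ?thesis using False Y(2)[of i j] by simp
      qed
    qed
    ultimately show "N \<in> congruence_matrices p RG n"
      unfolding congruence_matrices_def by (intro image_eqI[of _ _ ?Y])
  qed
qed

end

section \<open>Determinants of matrices over a group algebra\<close>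

lemma ring_of_type_algebra_simps [simp]:
  "carrier ring_of_type_algebra = UNIV"
  "a \<otimes>\<^bsub>ring_of_type_algebra\<^esub> b = a * b" "a \<oplus>\<^bsub>ring_of_type_algebra\<^esub> b = a + b"
  "\<one>\<^bsub>ring_of_type_algebra\<^esub> = 1" "\<zero>\<^bsub>ring_of_type_algebra\<^esub> = 0"
  by (simp_all add: ring_of_type_algebra_def)

lemma finsum_ring_of_type_algebra:
  fixes f :: "'i \<Rightarrow> 'a::comm_ring_1"
  shows "finite S \<Longrightarrow> finsum ring_of_type_algebra f S = sum f S"
proof (induction S rule: finite_induct)
  interpret ring "ring_of_type_algebra :: 'a ring" by (rule ring_from_type_algebra)
  case (insert x S)
  then show ?case by (simp add: finsum_insert)
next
  interpret ring "ring_of_type_algebra :: 'a ring" by (rule ring_from_type_algebra)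
  case empty
  show ?case by simp
qed

lemma units_of_field_comm_group: "comm_group (units_of (ring_of_type_algebra :: 'k::field ring))"
  using comm_monoid.units_comm_group cring.axioms(2)[OF cring_from_type_algebra] .

text \<open>Matrix indices below \<open>n * d\<close> are decomposed into the number of a block and a position inside the block.\<close>

lemma sum_div_mod:
  fixes f :: "nat \<Rightarrow> nat \<Rightarrow> 'a::comm_monoid_add"
  shows "(\<Sum>l<n * d. f (l div d) (l mod d)) = (\<Sum>k<n. \<Sum>c<d. f k c)"
proof -
  have "(\<Sum>k<n. \<Sum>c<d. f k c) = (\<Sum>(k,c)\<in>{..<n} \<times> {..<d}. f k c)"
    by (rule sum.cartesian_product)
  also have "\<dots> = (\<Sum>l<n * d. f (l div d) (l mod d))"
  proof (rule sum.reindex_bij_witness[of _ "\<lambda>l. (l div d, l mod d)" "\<lambda>(k,c). k * d + c"])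
    fix x assume "x \<in> {..<n} \<times> {..<d}"
    then obtain k c where x: "x = (k, c)" "k < n" "c < d" by auto
    then have "k * d + c < Suc k * d" by simp
    also have "Suc k * d \<le> n * d" using x by (intro mult_le_mono1) simp
    finally show "(case x of (k, c) \<Rightarrow> k * d + c) \<in> {..<n * d}" using x by simp
  qed (auto simp: less_mult_imp_div_less intro!: mod_less_divisor Nat.gr0I)
  finally show ?thesis by simp
qed

locale finite_group_rep = G: Group.group G for G :: "('g, 'm) monoid_scheme" +
  fixes d :: nat and \<rho> :: "'g \<Rightarrow> 'k::field mat"
  assumes finite_G: "finite (carrier G)" and rep: "matrix_rep G d \<rho>"
begin

abbreviation k_ring :: "'k ring" where "k_ring \<equiv> ring_of_type_algebra"

sublocale kG: finite_group_ring k_ring G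
  using finite_G G.is_group ring_from_type_algebra
  by (simp add: finite_group_ring_def finite_group_ring_axioms_def)

sublocale M: matrix_ring kG.RG by (rule kG.matrix_ring_RG)

lemma rho_carrier: "g \<in> carrier G \<Longrightarrow> \<rho> g \<in> carrier_mat d d"
  using rep Units_def hom_in_carrier unfolding matrix_rep_def
  by (fastforce simp: units_of_carrier Units_def ring_mat_def)

lemma rho_mult: "g \<in> carrier G \<Longrightarrow> h \<in> carrier G \<Longrightarrow> \<rho> (g \<otimes>\<^bsub>G\<^esub> h) = \<rho> g * \<rho> h"
  using rep hom_mult unfolding matrix_rep_def by (fastforce simp: units_of_mult ring_mat_def)

lemma rho_one: "\<rho> \<one>\<^bsub>G\<^esub> = 1\<^sub>m d"
proof -
  interpret mr: ring "ring_mat TYPE('k) d ()" by (rule ring_mat)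
  have "Group.group (units_of (ring_mat TYPE('k) d ()))" by (rule mr.units_group)
  then have "\<rho> \<one>\<^bsub>G\<^esub> = \<one>\<^bsub>units_of (ring_mat TYPE('k) d ())\<^esub>"
    using hom_one[OF rep[unfolded matrix_rep_def] G.is_group] by simp
  then show ?thesis by (simp add: units_of_one ring_mat_def)
qed

text \<open>The entries of the matrix \<open>\<Sum>\<^sub>g a\<^sub>g \<rho>(g)\<close>; these matrices are the blocks in the definition of \<^const>\<open>Det_rep\<close>.\<close>

definition act :: "('g \<Rightarrow> 'k) \<Rightarrow> nat \<Rightarrow> nat \<Rightarrow> 'k" where
  "act a i j = (\<Sum>g\<in>carrier G. a g * \<rho> g $$ (i, j))"

lemma act_mult:
  assumes "i < d" "j < d"
  shows "act (a \<otimes>\<^bsub>kG.RG\<^esub> b) i j = (\<Sum>c<d. act a i c * act b c j)"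
proof -
  have "act (a \<otimes>\<^bsub>kG.RG\<^esub> b) i j
      = (\<Sum>g\<in>carrier G. \<Sum>h\<in>carrier G. a h * b (inv\<^bsub>G\<^esub> h \<otimes>\<^bsub>G\<^esub> g) * \<rho> g $$ (i, j))"
    unfolding act_def
    by (intro sum.cong refl) (simp add: kG.RG_mult_at finsum_ring_of_type_algebra finite_G sum_distrib_right)
  also have "\<dots> = (\<Sum>h\<in>carrier G. \<Sum>g\<in>carrier G. a h * b (inv\<^bsub>G\<^esub> h \<otimes>\<^bsub>G\<^esub> g) * \<rho> g $$ (i, j))"
    by (rule sum.swap)
  also have "\<dots> = (\<Sum>h\<in>carrier G. \<Sum>l\<in>carrier G. a h * b l * \<rho> (h \<otimes>\<^bsub>G\<^esub> l) $$ (i, j))"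
  proof (rule sum.cong[OF refl])
    fix h assume h: "h \<in> carrier G"
    show "(\<Sum>g\<in>carrier G. a h * b (inv\<^bsub>G\<^esub> h \<otimes>\<^bsub>G\<^esub> g) * \<rho> g $$ (i, j))
        = (\<Sum>l\<in>carrier G. a h * b l * \<rho> (h \<otimes>\<^bsub>G\<^esub> l) $$ (i, j))"
      by (rule sum.reindex_bij_witness[of _ "\<lambda>l. h \<otimes>\<^bsub>G\<^esub> l" "\<lambda>g. inv\<^bsub>G\<^esub> h \<otimes>\<^bsub>G\<^esub> g"])
        (use h in \<open>auto simp: G.m_assoc[symmetric]\<close>)
  qed
  also have "\<dots> = (\<Sum>h\<in>carrier G. \<Sum>l\<in>carrier G. \<Sum>c<d. (a h * \<rho> h $$ (i, c)) * (b l * \<rho> l $$ (c, j)))"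
  proof (intro sum.cong refl)
    fix h l assume hl: "h \<in> carrier G" "l \<in> carrier G"
    have "\<rho> (h \<otimes>\<^bsub>G\<^esub> l) $$ (i, j) = (\<Sum>c<d. \<rho> h $$ (i, c) * \<rho> l $$ (c, j))"
      using assms rho_carrier[OF hl(1)] rho_carrier[OF hl(2)] unfolding rho_mult[OF hl]
      by (simp add: scalar_prod_def lessThan_atLeast0)
    then show "a h * b l * \<rho> (h \<otimes>\<^bsub>G\<^esub> l) $$ (i, j)
       = (\<Sum>c<d. (a h * \<rho> h $$ (i, c)) * (b l * \<rho> l $$ (c, j)))"
      by (simp add: sum_distrib_left mult_ac)
  qed
  also have "\<dots> = (\<Sum>h\<in>carrier G. \<Sum>c<d. \<Sum>l\<in>carrier G. (a h * \<rho> h $$ (i, c)) * (b l * \<rho> l $$ (c, j)))"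
    by (rule sum.cong[OF refl], rule sum.swap)
  also have "\<dots> = (\<Sum>c<d. \<Sum>h\<in>carrier G. \<Sum>l\<in>carrier G. (a h * \<rho> h $$ (i, c)) * (b l * \<rho> l $$ (c, j)))"
    by (rule sum.swap)
  also have "\<dots> = (\<Sum>c<d. act a i c * act b c j)"
    unfolding act_def by (simp add: sum_product)
  finally show ?thesis .
qed

lemma act_finsum:
  assumes "finite S" "\<And>s. s \<in> S \<Longrightarrow> F s \<in> carrier kG.RG"
  shows "act (finsum kG.RG F S) i j = (\<Sum>s\<in>S. act (F s) i j)"
  using assms
proof (induction S)
  case empty
  then show ?case by (simp add: act_def kG.RG_simps)
next
  case (insert x S)
  have "finsum kG.RG F (insert x S) = F x \<oplus>\<^bsub>kG.RG\<^esub> finsum kG.RG F S"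
    using insert by (intro kG.RG.finsum_insert) auto
  then have "act (finsum kG.RG F (insert x S)) i j = act (F x) i j + act (finsum kG.RG F S) i j"
    by (simp add: act_def kG.RG_simps(5) distrib_right sum.distrib)
  then show ?case using insert by simp
qed

lemma act_one: "i < d \<Longrightarrow> j < d \<Longrightarrow> act \<one>\<^bsub>kG.RG\<^esub> i j = (if i = j then 1 else 0)"
proof -
  assume ij: "i < d" "j < d"
  have "act \<one>\<^bsub>kG.RG\<^esub> i j = (\<Sum>g\<in>carrier G. if g = \<one>\<^bsub>G\<^esub> then \<rho> g $$ (i, j) else 0)"
    unfolding act_def by (rule sum.cong) (auto simp: kG.RG_simps)
  also have "\<dots> = \<rho> \<one>\<^bsub>G\<^esub> $$ (i, j)" using finite_G by simp
  finally show ?thesis using ij by (simp add: rho_one)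
qed

lemma act_zero: "act \<zero>\<^bsub>kG.RG\<^esub> i j = 0"
  by (simp add: act_def kG.RG_simps)

definition block_mat :: "nat \<Rightarrow> (nat \<Rightarrow> nat \<Rightarrow> 'g \<Rightarrow> 'k) \<Rightarrow> 'k mat" where
  "block_mat n M = mat (n * d) (n * d) (\<lambda>(i, j). act (M (i div d) (j div d)) (i mod d) (j mod d))"

lemma block_mat_carrier [simp]: "block_mat n M \<in> carrier_mat (n * d) (n * d)"
  by (simp add: block_mat_def)

lemma block_mat_mult:
  assumes M: "in_block kG.RG n M" and N: "in_block kG.RG n N"
  shows "block_mat n (M \<otimes>\<^bsub>M.SM\<^esub> N) = block_mat n M * block_mat n N"
proof (rule eq_matI)
  fix i j assume "i < dim_row (block_mat n M * block_mat n N)" "j < dim_col (block_mat n M * block_mat n N)"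
  then have ij: "i < n * d" "j < n * d" by (auto simp: block_mat_def)
  then have d: "d > 0" by (cases "d = 0") auto
  have i': "i div d < n" "i mod d < d" "j div d < n" "j mod d < d"
    using ij d by (auto simp: less_mult_imp_div_less)
  note c = M.in_block_carrier[OF M] M.in_block_carrier[OF N]
  have prod: "(M \<otimes>\<^bsub>M.SM\<^esub> N) (i div d) (j div d)
      = finsum kG.RG (\<lambda>k. M (i div d) k \<otimes>\<^bsub>kG.RG\<^esub> N k (j div d)) {..<n}"
    by (rule M.SM_mult_eq) (use M.in_block_row[OF M, of "i div d"] i' c in auto)
  have "block_mat n (M \<otimes>\<^bsub>M.SM\<^esub> N) $$ (i, j) = act ((M \<otimes>\<^bsub>M.SM\<^esub> N) (i div d) (j div d)) (i mod d) (j mod d)"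
    using ij by (simp add: block_mat_def)
  also have "\<dots> = (\<Sum>k<n. act (M (i div d) k \<otimes>\<^bsub>kG.RG\<^esub> N k (j div d)) (i mod d) (j mod d))"
    unfolding prod by (rule act_finsum) (use c in auto)
  also have "\<dots> = (\<Sum>k<n. \<Sum>c<d. act (M (i div d) k) (i mod d) c * act (N k (j div d)) c (j mod d))"
    by (intro sum.cong refl act_mult i')
  also have "\<dots> = (\<Sum>l<n * d. act (M (i div d) (l div d)) (i mod d) (l mod d) * act (N (l div d) (j div d)) (l mod d) (j mod d))"
    by (rule sum_div_mod[symmetric])
  also have "\<dots> = (block_mat n M * block_mat n N) $$ (i, j)"
    using ij by (simp add: block_mat_def scalar_prod_def lessThan_atLeast0)
  finally show "block_mat n (M \<otimes>\<^bsub>M.SM\<^esub> N) $$ (i, j) = (block_mat n M * block_mat n N) $$ (i, j)" .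
qed (auto simp: block_mat_def)

lemma block_mat_Suc:
  assumes M: "in_block kG.RG n M"
  shows "block_mat (Suc n) M = four_block_mat (block_mat n M) (0\<^sub>m (n * d) d) (0\<^sub>m d (n * d)) (1\<^sub>m d)"
proof (rule eq_matI)
  fix i j assume "i < dim_row (four_block_mat (block_mat n M) (0\<^sub>m (n * d) d) (0\<^sub>m d (n * d)) (1\<^sub>m d))"
    "j < dim_col (four_block_mat (block_mat n M) (0\<^sub>m (n * d) d) (0\<^sub>m d (n * d)) (1\<^sub>m d))"
  then have ij: "i < Suc n * d" "j < Suc n * d" by (auto simp: block_mat_def)
  then have d: "d > 0" by (cases "d = 0") auto
  have split: "(l < n * d \<longrightarrow> l div d < n) \<and> (\<not> l < n * d \<longrightarrow> l div d = n \<and> l mod d = l - n * d \<and> l - n * d < d)"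
    if l: "l < Suc n * d" for l
  proof (cases "l < n * d")
    case False
    then have "l = n * d + (l - n * d)" "l - n * d < d" using l by auto
    then show ?thesis using False d by (metis div_mult_self3 div_less mod_mult_self3 mod_less add.right_neutral
          add.commute neq0_conv)
  qed (simp add: less_mult_imp_div_less)
  note si = split[OF ij(1)] and sj = split[OF ij(2)]
  have L: "block_mat (Suc n) M $$ (i, j) = act (M (i div d) (j div d)) (i mod d) (j mod d)"
    using ij by (simp add: block_mat_def)
  have out: "M k l = (if k = l then \<one>\<^bsub>kG.RG\<^esub> else \<zero>\<^bsub>kG.RG\<^esub>)" if "k \<ge> n \<or> l \<ge> n" for k l
    by (rule M.in_block_outside[OF M that])
  show "block_mat (Suc n) M $$ (i, j)
      = four_block_mat (block_mat n M) (0\<^sub>m (n * d) d) (0\<^sub>m d (n * d)) (1\<^sub>m d) $$ (i, j)"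
  proof (cases "i < n * d \<and> j < n * d")
    case True
    then show ?thesis unfolding L using ij by (simp add: block_mat_def)
  next
    case False
    have R: "four_block_mat (block_mat n M) (0\<^sub>m (n * d) d) (0\<^sub>m d (n * d)) (1\<^sub>m d) $$ (i, j)
        = (if i < n * d \<or> j < n * d then 0 else if i - n * d = j - n * d then 1 else 0)"
      using ij False by (auto simp: block_mat_def)
    show ?thesis
    proof (cases "i < n * d \<or> j < n * d")
      case True
      have "(i div d < n \<and> j div d = n) \<or> (i div d = n \<and> j div d < n)"
        using True False si sj by blast
      then have ne: "i div d \<noteq> j div d" "i div d \<ge> n \<or> j div d \<ge> n"
        by linarith+
      have "M (i div d) (j div d) = \<zero>\<^bsub>kG.RG\<^esub>" using out[OF ne(2)] ne(1) by (simp only: if_False)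
      then show ?thesis unfolding L R using True by (simp only: act_zero if_True)
    next
      case inner: False
      then have "i div d = n" "j div d = n" "i mod d = i - n * d" "j mod d = j - n * d"
        "i - n * d < d" "j - n * d < d" using si sj by blast+
      moreover from this have "M (i div d) (j div d) = \<one>\<^bsub>kG.RG\<^esub>" using out[of n n] by simp
      ultimately show ?thesis unfolding L R using inner by (simp add: act_one)
    qed
  qed
qed (auto simp: block_mat_def)

lemma det_block_mat_stable:
  assumes "in_block kG.RG n M" "n \<le> m" shows "det (block_mat m M) = det (block_mat n M)"
  using assms(2)
proof (induction m rule: dec_induct)
  case (step m)
  have "det (block_mat (Suc m) M) = det (block_mat m M) * det (1\<^sub>m d)"
    unfolding block_mat_Suc[OF M.in_block_mono[OF assms(1) step(1)]]
    by (rule det_four_block_mat_lower_left_zero) auto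
  then show ?case using step by simp
qed simp

text \<open>Enlarging the block only adds an identity block, so the choice of the least admissible size in the
  definition is immaterial, and a common size can be used for a product.\<close>

lemma Det_rep_eq:
  assumes "in_block kG.RG n M" shows "Det_rep G (d, \<rho>) M = det (block_mat n M)"
proof -
  let ?l = "LEAST n. in_block kG.RG n M"
  have l: "in_block kG.RG ?l M" "?l \<le> n" using assms LeastI Least_le by metis+
  have "Det_rep G (d, \<rho>) M = det (block_mat ?l M)"
    by (simp add: Det_rep_def block_mat_def act_def Let_def)
  then show ?thesis using det_block_mat_stable[OF l] by simp
qed

lemma Det_rep_mult:
  assumes "M \<in> carrier M.SM" "N \<in> carrier M.SM"
  shows "Det_rep G (d, \<rho>) (M \<otimes>\<^bsub>M.SM\<^esub> N) = Det_rep G (d, \<rho>) M * Det_rep G (d, \<rho>) N"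
proof -
  obtain n where n: "in_block kG.RG n M" "in_block kG.RG n N" using assms by (rule M.SM_common_block)
  have "det (block_mat n (M \<otimes>\<^bsub>M.SM\<^esub> N)) = det (block_mat n M) * det (block_mat n N)"
    unfolding block_mat_mult[OF n] by (rule det_mult[of _ "n * d"]) simp_all
  then show ?thesis
    unfolding Det_rep_eq[OF n(1)] Det_rep_eq[OF n(2)] Det_rep_eq[OF M.in_block_mult[OF n]] .
qed

lemma Det_rep_one: "Det_rep G (d, \<rho>) \<one>\<^bsub>M.SM\<^esub> = 1"
proof -
  have "block_mat 0 \<one>\<^bsub>M.SM\<^esub> = 1\<^sub>m 0" by (rule eq_matI) (auto simp: block_mat_def)
  then show ?thesis unfolding Det_rep_eq[OF M.in_block_one] by simp
qed

lemma Det_rep_hom: "Det_rep G (d, \<rho>) \<in> hom (GL kG.RG) (units_of k_ring)"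
proof (rule homI)
  fix M assume "M \<in> carrier (GL kG.RG)"
  then obtain N where N: "M \<in> carrier M.SM" "N \<in> carrier M.SM" "M \<otimes>\<^bsub>M.SM\<^esub> N = \<one>\<^bsub>M.SM\<^esub>"
    by (auto simp: M.carrier_GL Units_def)
  have "Det_rep G (d, \<rho>) M * Det_rep G (d, \<rho>) N = 1"
    using Det_rep_mult[OF N(1,2)] N(3) Det_rep_one by simp
  then show "Det_rep G (d, \<rho>) M \<in> carrier (units_of k_ring)"
    by (simp add: units_of_carrier Units_def) (metis mult.commute)
next
  fix M N assume "M \<in> carrier (GL kG.RG)" "N \<in> carrier (GL kG.RG)"
  then show "Det_rep G (d, \<rho>) (M \<otimes>\<^bsub>GL kG.RG\<^esub> N)
     = Det_rep G (d, \<rho>) M \<otimes>\<^bsub>units_of k_ring\<^esub> Det_rep G (d, \<rho>) N"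
    by (simp add: M.mult_GL units_of_mult Det_rep_mult M.GL_SM)
qed

lemma Det_rep_derived:
  assumes "h \<in> M.E" shows "Det_rep G (d, \<rho>) h = 1"
proof -
  interpret U: comm_group "units_of k_ring" by (rule units_of_field_comm_group)
  interpret D: group_hom "GL kG.RG" "units_of k_ring" "Det_rep G (d, \<rho>)"
    using Det_rep_hom M.GL_group U.is_group by (simp add: group_hom_def group_hom_axioms_def)
  have "Det_rep G (d, \<rho>) ` M.E = {\<one>\<^bsub>units_of k_ring\<^esub>}"
    unfolding D.derived_img[OF order.refl, symmetric] by (rule U.derived_eq_singleton) auto
  then show ?thesis using assms by (auto simp: units_of_one)
qed

lemma Det_rep_on_class:
  assumes M: "M \<in> carrier (GL kG.RG)"
  shows "on_cosets (Det_rep G (d, \<rho>)) (K1_class kG.RG M) = Det_rep G (d, \<rho>) M"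
  unfolding K1_class_def
proof (rule normal.on_cosets_rcos[OF M.E_normal M])
  fix h y assume h: "h \<in> M.E" and y: "y \<in> carrier (GL kG.RG)"
  have "h \<in> carrier (GL kG.RG)" using h subgroup.mem_carrier[OF M.E_subgroup] by blast
  then show "Det_rep G (d, \<rho>) (h \<otimes>\<^bsub>GL kG.RG\<^esub> y) = Det_rep G (d, \<rho>) y"
    using y Det_rep_derived[OF h] by (simp add: M.mult_GL Det_rep_mult M.GL_SM)
qed

end

section \<open>Values that are congruent to a constant\<close>

lemma to_closure_simps [simp]:
  "to_closure 0 = 0" "to_closure 1 = 1" "to_closure (a + b) = to_closure a + to_closure b"
  "to_closure (a * b) = to_closure a * to_closure b"
  by (simp_all add: to_closure_def flip: to_ac_add to_ac_mult Zero_fract_def One_fract_def)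

lemma to_closure_module: "Modules.module (\<lambda>(r::'r::idom) x. to_closure r * x)"
  by unfold_locales (simp_all add: algebra_simps)

text \<open>Spans over \<open>R\<close>, which acts on \<open>N\<^sup>c\<close> through \<^const>\<open>to_closure\<close>.\<close>

abbreviation coeff_span :: "'r::idom fract alg_closure set \<Rightarrow> 'r fract alg_closure set" where
  "coeff_span \<equiv> Modules.module.span (\<lambda>r x. to_closure r * x)"

lemma coeff_span_mult:
  assumes "x \<in> coeff_span S" "y \<in> coeff_span T"
  shows "x * y \<in> coeff_span ((\<lambda>(s, t). s * t) ` (S \<times> T))"
proof -
  interpret Modules.module "\<lambda>(r::'a) (x::'a fract alg_closure). to_closure r * x" by (rule to_closure_module)
  let ?P = "(\<lambda>(s, t). s * t) ` (S \<times> T)"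
  have 1: "s * y \<in> span ?P" if s: "s \<in> S" for s
    using assms(2)
  proof (induction rule: span_induct_alt)
    case (step c t z)
    have "s * t \<in> ?P" using step(1) s by force
    then have "to_closure c * (s * t) + s * z \<in> span ?P"
      using step by (simp add: span_add span_scale span_base)
    then show ?case by (simp add: algebra_simps)
  qed (simp add: span_zero)
  show ?thesis using assms(1)
  proof (induction rule: span_induct_alt)
    case (step c s z)
    have "to_closure c * (s * y) + z * y \<in> span ?P"
      using step 1 by (simp add: span_add span_scale)
    then show ?case by (simp add: algebra_simps)
  qed (simp add: span_zero)
qed

text \<open>The family \<open>x\<close> lies in \<open>c + q\<^sub>i S\<close> for one finitely generated \<open>R\<close>-submodule \<open>S\<close> of \<open>N\<^sup>c\<close>. That \<open>S\<close> does not
  depend on \<open>i\<close> is the point: it allows an intersection over all \<open>i\<close>. The relation is compatible with sums and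
  products, hence with determinants of a fixed size.\<close>

definition congruent_to ::
    "('i \<Rightarrow> 'r::idom) \<Rightarrow> 'r fract alg_closure \<Rightarrow> ('i \<Rightarrow> 'r fract alg_closure) \<Rightarrow> bool" where
  "congruent_to q c x \<longleftrightarrow>
     (\<exists>T. finite T \<and> (\<forall>i. \<exists>y\<in>coeff_span T. x i = c + to_closure (q i) * y))"

lemma congruent_to_const: "congruent_to q c (\<lambda>i. c)"
proof -
  interpret Modules.module "\<lambda>(r::'b) (x::'b fract alg_closure). to_closure r * x" by (rule to_closure_module)
  show ?thesis unfolding congruent_to_def by (rule exI[of _ "{}"]) simp
qed

lemma congruent_to_add:
  assumes "congruent_to q c x" "congruent_to q c' x'"
  shows "congruent_to q (c + c') (\<lambda>i. x i + x' i)"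
proof -
  interpret Modules.module "\<lambda>(r::'b) (x::'b fract alg_closure). to_closure r * x" by (rule to_closure_module)
  obtain S where S: "finite S" "\<And>i. \<exists>y\<in>span S. x i = c + to_closure (q i) * y"
    using assms(1) by (auto simp: congruent_to_def)
  obtain T where T: "finite T" "\<And>i. \<exists>y\<in>span T. x' i = c' + to_closure (q i) * y"
    using assms(2) by (auto simp: congruent_to_def)
  show ?thesis unfolding congruent_to_def
  proof (intro exI[of _ "S \<union> T"] conjI allI)
    fix i
    obtain y where y: "y \<in> span S" "x i = c + to_closure (q i) * y" using S(2) by blast
    obtain z where z: "z \<in> span T" "x' i = c' + to_closure (q i) * z" using T(2) by blast
    have "y + z \<in> span (S \<union> T)"
      using y(1) z(1) span_mono[of S "S \<union> T"] span_mono[of T "S \<union> T"] by (intro span_add) auto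
    moreover have "x i + x' i = c + c' + to_closure (q i) * (y + z)"
      using y(2) z(2) by (simp add: algebra_simps)
    ultimately show "\<exists>y\<in>span (S \<union> T). x i + x' i = c + c' + to_closure (q i) * y" by blast
  qed (use S T in simp)
qed

text \<open>\<open>(c + q y) (c' + q z) = c c' + q (c z + c' y + q y z)\<close>, and products of elements of two finitely generated
  submodules lie in a third one.\<close>

lemma congruent_to_mult:
  assumes "congruent_to q c x" "congruent_to q c' x'"
  shows "congruent_to q (c * c') (\<lambda>i. x i * x' i)"
proof -
  interpret Modules.module "\<lambda>(r::'b) (x::'b fract alg_closure). to_closure r * x" by (rule to_closure_module)
  obtain S where S: "finite S" "\<And>i. \<exists>y\<in>span S. x i = c + to_closure (q i) * y"
    using assms(1) by (auto simp: congruent_to_def)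
  obtain T where T: "finite T" "\<And>i. \<exists>y\<in>span T. x' i = c' + to_closure (q i) * y"
    using assms(2) by (auto simp: congruent_to_def)
  let ?P = "\<lambda>S T. (\<lambda>(s, t). s * t) ` (S \<times> T)"
  let ?U = "?P {c} T \<union> ?P {c'} S \<union> ?P S T"
  show ?thesis unfolding congruent_to_def
  proof (intro exI[of _ ?U] conjI allI)
    fix i
    obtain y where y: "y \<in> span S" "x i = c + to_closure (q i) * y" using S(2) by blast
    obtain z where z: "z \<in> span T" "x' i = c' + to_closure (q i) * z" using T(2) by blast
    have "c * z \<in> span (?P {c} T)" by (rule coeff_span_mult[OF span_base z(1)]) simp
    moreover have "c' * y \<in> span (?P {c'} S)" by (rule coeff_span_mult[OF span_base y(1)]) simp
    moreover have "y * z \<in> span (?P S T)" by (rule coeff_span_mult[OF y(1) z(1)])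
    ultimately have "c * z \<in> span ?U" "c' * y \<in> span ?U" "y * z \<in> span ?U"
      using span_mono[of _ ?U] by blast+
    then have "c * z + c' * y + to_closure (q i) * (y * z) \<in> span ?U"
      by (intro span_add span_scale)
    moreover have "x i * x' i = c * c' + to_closure (q i) * (c * z + c' * y + to_closure (q i) * (y * z))"
      using y(2) z(2) by (simp add: algebra_simps)
    ultimately show "\<exists>y\<in>span ?U. x i * x' i = c * c' + to_closure (q i) * y" by blast
  qed (use S T in simp)
qed

lemma congruent_to_sum:
  assumes "finite A" "\<And>k. k \<in> A \<Longrightarrow> congruent_to q (c k) (x k)"
  shows "congruent_to q (\<Sum>k\<in>A. c k) (\<lambda>i. \<Sum>k\<in>A. x k i)"
  using assms by (induction A) (simp_all add: congruent_to_const congruent_to_add)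

lemma congruent_to_prod:
  assumes "finite A" "\<And>k. k \<in> A \<Longrightarrow> congruent_to q (c k) (x k)"
  shows "congruent_to q (\<Prod>k\<in>A. c k) (\<lambda>i. \<Prod>k\<in>A. x k i)"
  using assms by (induction A) (simp_all add: congruent_to_const congruent_to_mult)

lemma congruent_to_det:
  assumes C: "C \<in> carrier_mat n n" and M: "\<And>i. M i \<in> carrier_mat n n"
    and entry: "\<And>j k. j < n \<Longrightarrow> k < n \<Longrightarrow> congruent_to q (C $$ (j, k)) (\<lambda>i. M i $$ (j, k))"
  shows "congruent_to q (det C) (\<lambda>i. det (M i))"
  unfolding det_def'[OF C] det_def'[OF M]
proof (intro congruent_to_sum congruent_to_mult congruent_to_prod congruent_to_const)
  show "finite {\<sigma>. \<sigma> permutes {0..<n}}" by (simp add: finite_permutations)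
  fix \<sigma> j assume "\<sigma> \<in> {\<sigma>. \<sigma> permutes {0..<n}}" "j \<in> {0..<n}"
  then have "\<sigma> j < n" using permutes_in_image by fastforce
  then show "congruent_to q (C $$ (j, \<sigma> j)) (\<lambda>i. M i $$ (j, \<sigma> j))"
    using entry \<open>j \<in> {0..<n}\<close> by simp
qed simp

lemma common_denominator:
  fixes T :: "'r::idom fract set"
  assumes "finite T"
  obtains s where "s \<noteq> 0" "\<And>t. t \<in> T \<Longrightarrow> \<exists>r. t * Fract s 1 = Fract r 1"
proof -
  have "\<exists>s. s \<noteq> 0 \<and> (\<forall>t\<in>T. \<exists>r. t * Fract s 1 = Fract r 1)"
    using assms
  proof (induction T)
    case empty
    show ?case by (rule exI[of _ 1]) simp
  next
    case (insert t T)
    then obtain s where s: "s \<noteq> 0" "\<And>t. t \<in> T \<Longrightarrow> \<exists>r. t * Fract s 1 = Fract r 1" by blast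
    obtain a b where t: "t = Fract a b" "b \<noteq> 0" by (cases t) blast
    have "t * Fract (s * b) 1 = Fract (a * s) 1" using t by (simp add: eq_fract)
    moreover have "\<exists>r. u * Fract (s * b) 1 = Fract r 1" if u: "u \<in> T" for u
    proof -
      obtain r where "u * Fract s 1 = Fract r 1" using s(2)[OF u] by blast
      then have "u * Fract s 1 * Fract b 1 = Fract (r * b) 1" by simp
      then show ?thesis by (auto simp: mult.assoc)
    qed
    ultimately show ?case using s(1) t(2) by (intro exI[of _ "s * b"]) auto
  qed
  then show thesis using that by blast
qed

text \<open>For \<open>x \<noteq> 0\<close> take an \<open>N\<close>-linear functional \<open>f\<close> with \<open>f x = 1\<close> and a common denominator \<open>s\<close> of the finitely
  many values \<open>f t\<close>. Then \<open>s f\<close> maps the span into \<open>R\<close>, so \<open>s = s f(x)\<close> is divisible by every \<open>q n\<close>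
  and therefore zero, a contradiction.\<close>

lemma coeff_span_separated:
  fixes q :: "nat \<Rightarrow> 'r::idom" and x :: "'r fract alg_closure"
  assumes sep: "\<And>r. (\<And>n. n \<ge> 1 \<Longrightarrow> q n dvd r) \<Longrightarrow> r = 0"
    and T: "finite T" and x: "\<And>n. n \<ge> 1 \<Longrightarrow> \<exists>y\<in>coeff_span T. x = to_closure (q n) * y"
  shows "x = 0"
proof (rule ccontr)
  assume x0: "x \<noteq> 0"
  interpret Modules.module "\<lambda>(r::'r) (x::'r fract alg_closure). to_closure r * x" by (rule to_closure_module)
  interpret V: vector_space_pair "\<lambda>(a::'r fract) (x::'r fract alg_closure). to_ac a * x"
    "\<lambda>(a::'r fract) (b::'r fract). a * b"
    by unfold_locales (simp_all add: algebra_simps)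
  have "V.vs1.independent {x}" using x0 by simp
  from V.linear_independent_extend[OF this, of "\<lambda>_. 1"]
  obtain f where f: "Vector_Spaces.linear (\<lambda>a x. to_ac a * x) (*) f" "f x = 1" by auto
  interpret f: Vector_Spaces.linear "\<lambda>a x. to_ac a * x" "(*)" f by (rule f(1))
  have f_scale: "f (to_closure r * z) = Fract r 1 * f z" for r z
    unfolding to_closure_def using f.scale by simp
  obtain s where s: "s \<noteq> 0" "\<And>t. t \<in> f ` T \<Longrightarrow> \<exists>r. t * Fract s 1 = Fract r 1"
    using common_denominator[of "f ` T"] T by blast
  have integral: "\<exists>r. f y * Fract s 1 = Fract r 1" if "y \<in> span T" for y
    using that
  proof (induction rule: span_induct_alt)
    case base
    then show ?case using f.zero by (auto intro!: exI[of _ 0] simp: Zero_fract_def)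
  next
    case (step c t z)
    obtain a where a: "f t * Fract s 1 = Fract a 1" using s(2) step by blast
    obtain b where b: "f z * Fract s 1 = Fract b 1" using step by blast
    have "f (to_closure c * t + z) * Fract s 1 = Fract c 1 * (f t * Fract s 1) + f z * Fract s 1"
      by (simp only: f.add f_scale distrib_right mult.assoc)
    also have "\<dots> = Fract (c * a + b) 1" unfolding a b by simp
    finally show ?case by blast
  qed
  have "q n dvd s" if n: "n \<ge> 1" for n
  proof -
    obtain y where y: "y \<in> span T" "x = to_closure (q n) * y" using x[OF n] by blast
    obtain r where r: "f y * Fract s 1 = Fract r 1" using integral[OF y(1)] by blast
    have "Fract s 1 = f x * Fract s 1" using f(2) by simp
    also have "\<dots> = Fract (q n) 1 * (f y * Fract s 1)" unfolding y(2) f_scale by (simp only: mult.assoc)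
    also have "\<dots> = Fract (q n * r) 1" unfolding r by (simp only: mult_fract mult_1_right)
    finally show ?thesis by (simp add: eq_fract)
  qed
  then show False using sep s(1) by blast
qed

section \<open>The determinant on the K1 group of the group ring\<close>

lemma add_pow_ring_of_type_algebra:
  "add_pow (ring_of_type_algebra :: 'a::comm_ring_1 ring) (k::nat) x = of_nat k * x"
proof -
  interpret ring "ring_of_type_algebra :: 'a ring" by (rule ring_from_type_algebra)
  show ?thesis
  proof (induction k)
    case (Suc k)
    have "add_pow (ring_of_type_algebra :: 'a ring) (Suc k) x
        = add_pow (ring_of_type_algebra :: 'a ring) k x + x"
      by (simp add: add.nat_pow_Suc)
    then show ?case using Suc by (simp add: algebra_simps)
  qed simp
qed

locale p_complete_domain_group_ring = p_complete_group_ring R p G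
  for R :: "'r::idom ring" and p :: nat and G :: "('g, 'm) monoid_scheme" +
  assumes R_eq: "R = ring_of_type_algebra"
begin

abbreviation k_ring :: "'r fract alg_closure ring" where "k_ring \<equiv> ring_of_type_algebra"

abbreviation "kG \<equiv> group_ring k_ring G"

abbreviation chosen_rep :: "('g \<Rightarrow> 'r fract alg_closure) \<Rightarrow> nat \<times> ('g \<Rightarrow> 'r fract alg_closure mat)" where
  "chosen_rep \<chi> \<equiv> (SOME d\<rho>. affords G \<chi> d\<rho>)"

sublocale kG: finite_group_ring k_ring G
  using finite_G G.is_group ring_from_type_algebra
  by (simp add: finite_group_ring_def finite_group_ring_axioms_def)

lemma R_ops: "\<one>\<^bsub>R\<^esub> = 1" "\<zero>\<^bsub>R\<^esub> = 0" "x \<oplus>\<^bsub>R\<^esub> y = x + y"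
  by (simp_all add: R_eq)

lemma to_closure_hom: "to_closure \<in> Ring.ring_hom R k_ring"
  by (rule ring_hom_memI) (simp_all add: R_eq)

sublocale cl: matrix_ring_hom RG kG "group_ring_map G to_closure"
  by (rule matrix_ring_hom_group_ring_map[OF finite_group_ring_axioms kG.finite_group_ring_axioms to_closure_hom])

abbreviation (input) "cl \<equiv> (\<lambda>M i j. group_ring_map G to_closure (M i j))"

lemma chosen_rep:
  assumes "\<chi> \<in> irr_characters G"
  obtains d \<rho> where "chosen_rep \<chi> = (d, \<rho>)" "finite_group_rep G d \<rho>"
proof -
  obtain d \<rho> where d: "chosen_rep \<chi> = (d, \<rho>)" by (cases "chosen_rep \<chi>") blast
  have "affords G \<chi> (chosen_rep \<chi>)"
    using assms unfolding irr_characters_def by (auto intro: someI)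
  then have "matrix_rep G d \<rho>" unfolding d by (simp add: affords_def irreducible_rep_def)
  then have "finite_group_rep G d \<rho>"
    using finite_G G.is_group by (simp add: finite_group_rep_def finite_group_rep_axioms_def)
  then show thesis using that d by blast
qed

lemma Det_class:
  assumes M: "M \<in> carrier (GL RG)"
  shows "Det G (K1_class RG M) = (\<lambda>\<chi>\<in>irr_characters G. Det_rep G (chosen_rep \<chi>) (cl M))"
  unfolding Det_def R_eq[symmetric] cl.K1_map_class[OF M] Det_alg_closed_def
proof (rule restrict_ext)
  fix \<chi> :: "'g \<Rightarrow> 'r fract alg_closure" assume "\<chi> \<in> irr_characters G"
  then obtain d \<rho> where d: "chosen_rep \<chi> = (d, \<rho>)" "finite_group_rep G d \<rho>" by (rule chosen_rep)
  show "on_cosets (Det_rep G (chosen_rep \<chi>)) (K1_class kG (cl M)) = Det_rep G (chosen_rep \<chi>) (cl M)"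
    unfolding d(1) using finite_group_rep.Det_rep_on_class[OF d(2) cl.mmap_GL[OF M]] .
qed

lemma Det_rep_cl_hom:
  assumes "\<chi> \<in> irr_characters G"
  shows "Det_rep G (chosen_rep \<chi>) \<in> hom (GL kG) (units_of k_ring)"
  using chosen_rep[OF assms] finite_group_rep.Det_rep_hom by metis

lemma Det_codomain_comm_group: "comm_group (Det_codomain G :: (('g \<Rightarrow> 'r fract alg_closure) \<Rightarrow> _) monoid)"
proof (rule group.group_comm_groupI)
  show "Group.group (Det_codomain G :: (('g \<Rightarrow> 'r fract alg_closure) \<Rightarrow> _) monoid)"
    unfolding Det_codomain_def by (rule product_group) (rule comm_group.axioms(2)[OF units_of_field_comm_group])
  fix x y :: "('g \<Rightarrow> 'r fract alg_closure) \<Rightarrow> 'r fract alg_closure"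
  show "x \<otimes>\<^bsub>Det_codomain G\<^esub> y = y \<otimes>\<^bsub>Det_codomain G\<^esub> x"
    by (simp add: Det_codomain_def units_of_mult mult.commute)
qed

lemma K1_cases:
  assumes "Y \<in> carrier (K1 RG)"
  obtains M where "M \<in> carrier (GL RG)" "Y = K1_class RG M"
  using assms cl.A.carrier_K1 by blast

lemma Det_hom: "Det G \<in> hom (K1 RG) (Det_codomain G)"
proof (rule homI)
  fix Y assume "Y \<in> carrier (K1 RG)"
  then obtain M where M: "M \<in> carrier (GL RG)" "Y = K1_class RG M" by (rule K1_cases)
  show "Det G Y \<in> carrier (Det_codomain G)"
    unfolding M(2) Det_class[OF M(1)]
    by (simp add: Det_codomain_def hom_in_carrier[OF Det_rep_cl_hom] cl.mmap_GL[OF M(1)])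
  fix Z assume "Z \<in> carrier (K1 RG)"
  then obtain N where N: "N \<in> carrier (GL RG)" "Z = K1_class RG N" by (rule K1_cases)
  have MN: "M \<otimes>\<^bsub>GL RG\<^esub> N \<in> carrier (GL RG)" using M(1) N(1) by (rule cl.A.GL.m_closed)
  have "Det G (Y \<otimes>\<^bsub>K1 RG\<^esub> Z) = Det G (K1_class RG (M \<otimes>\<^bsub>GL RG\<^esub> N))"
    unfolding M(2) N(2) by (simp only: cl.A.class_hom.hom_mult[OF M(1) N(1)])
  also have "\<dots> = Det G Y \<otimes>\<^bsub>Det_codomain G\<^esub> Det G Z"
    unfolding M(2) N(2) Det_class[OF M(1)] Det_class[OF N(1)] Det_class[OF MN]
      cl.GLmap.hom_mult[OF M(1) N(1)] Det_codomain_def mult_product_group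
    by (rule restrict_ext) (simp add: hom_mult[OF Det_rep_cl_hom] cl.mmap_GL[OF M(1)] cl.mmap_GL[OF N(1)])
  finally show "Det G (Y \<otimes>\<^bsub>K1 RG\<^esub> Z) = Det G Y \<otimes>\<^bsub>Det_codomain G\<^esub> Det G Z" .
qed

lemma Det_codomain_group_hom: "group_hom (K1 RG) (Det_codomain G) (Det G)"
  using Det_hom comm_group.axioms(2)[OF Det_codomain_comm_group] cl.A.K1.is_group
  by (simp add: group_hom_def group_hom_axioms_def)

lemma Det_K1_comm_group: "comm_group (Det_K1 R G)"
proof (rule group.group_comm_groupI)
  interpret C: comm_group "Det_codomain G :: (('g \<Rightarrow> 'r fract alg_closure) \<Rightarrow> 'r fract alg_closure) monoid"
    by (rule Det_codomain_comm_group)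
  have sub: "subgroup (Det G ` carrier (K1 RG)) (Det_codomain G)"
    by (rule group_hom.img_is_subgroup[OF Det_codomain_group_hom])
  show "Group.group (Det_K1 R G)"
    unfolding Det_K1_def using subgroup.subgroup_is_group[OF sub C.is_group] .
  fix x y assume "x \<in> carrier (Det_K1 R G)" "y \<in> carrier (Det_K1 R G)"
  then show "x \<otimes>\<^bsub>Det_K1 R G\<^esub> y = y \<otimes>\<^bsub>Det_K1 R G\<^esub> x"
    using C.m_comm subgroup.mem_carrier[OF sub] by (simp add: Det_K1_def)
qed

lemma Det_K1_group_hom: "group_hom (K1 RG) (Det_K1 R G) (Det G)"
proof -
  have "Det G \<in> hom (K1 RG) (Det_K1 R G)"
    using hom_mult[OF Det_hom] by (intro homI) (simp_all add: Det_K1_def)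
  then show ?thesis
    using comm_group.axioms(2)[OF Det_K1_comm_group] cl.A.K1.is_group
    by (simp add: group_hom_def group_hom_axioms_def)
qed

sublocale D: comm_group "Det_K1 R G" by (rule Det_K1_comm_group)
sublocale Det: group_hom "K1 RG" "Det_K1 R G" "Det G" by (rule Det_K1_group_hom)

text \<open>The class of the unit \<open>1 + a\<close>, regarded as a matrix of size one.\<close>

abbreviation unit_class :: "('g \<Rightarrow> 'r) \<Rightarrow> (nat \<Rightarrow> nat \<Rightarrow> 'g \<Rightarrow> 'r) set" where
  "unit_class a \<equiv> K1_class RG (cl.A.diag 0 a)"

text \<open>The second description needs units of \<open>R[G]\<close> only instead of matrices; it comes from the elimination of columns.\<close>

lemma Det_congruence_eq:
  assumes n: "n \<ge> 1"
  shows "Det_congruence p R G n = Det G ` kernel (K1 RG) (K1_level p R G n) (K1_reduction p R G n)"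
    and "Det_congruence p R G n = (\<lambda>a. Det G (unit_class a)) ` J n"
proof -
  interpret S: radical_surjection RG "level n" "group_ring_map G (reduction p R n)"
    by (rule reduction_radical_surjection[OF n])
  interpret I: radical_ideal RG "J n" by (rule radical_ideal_J[OF n])
  have K: "kernel (K1 RG) (K1_level p R G n) (K1_reduction p R G n) = K1_class RG ` I.congruent_one"
    unfolding K1_level_def K1_reduction_def J_eq_kernel by (rule S.K1_map_kernel)
  show 1: "Det_congruence p R G n = Det G ` kernel (K1 RG) (K1_level p R G n) (K1_reduction p R G n)"
    unfolding K Det_congruence_def congruence_matrices_eq[OF n] image_image ..
  have "K1_class RG ` I.congruent_one = unit_class ` J n"
    using I.congruent_one_class I.diag_congruent_one by blast
  then show "Det_congruence p R G n = (\<lambda>a. Det G (unit_class a)) ` J n"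
    unfolding 1 K by (simp add: image_image)
qed

lemma unit_class_carrier: "a \<in> J 1 \<Longrightarrow> unit_class a \<in> carrier (K1 RG)"
  using cl.A.diag_GL[of a 0] one_plus_J_unit[of a] J_carrier[of 1 a] cl.A.class_hom.hom_closed by simp

lemma unit_class_mult:
  assumes "a \<in> J 1" "b \<in> J 1"
  shows "unit_class a \<otimes>\<^bsub>K1 RG\<^esub> unit_class b = unit_class ((\<one>\<^bsub>RG\<^esub> \<oplus>\<^bsub>RG\<^esub> a) \<otimes>\<^bsub>RG\<^esub> (\<one>\<^bsub>RG\<^esub> \<oplus>\<^bsub>RG\<^esub> b) \<ominus>\<^bsub>RG\<^esub> \<one>\<^bsub>RG\<^esub>)"
proof -
  have c: "a \<in> carrier RG" "b \<in> carrier RG" using assms J_carrier[of 1] by auto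
  have "(\<one>\<^bsub>RG\<^esub> \<oplus>\<^bsub>RG\<^esub> a) \<otimes>\<^bsub>RG\<^esub> (\<one>\<^bsub>RG\<^esub> \<oplus>\<^bsub>RG\<^esub> b) \<ominus>\<^bsub>RG\<^esub> \<one>\<^bsub>RG\<^esub> = b \<oplus>\<^bsub>RG\<^esub> a \<oplus>\<^bsub>RG\<^esub> a \<otimes>\<^bsub>RG\<^esub> b"
    using c by (simp add: RG.l_distr RG.r_distr RG.minus_eq RG.a_ac RG.r_neg RG.r_neg2 RG.r_neg_cancel)
  then show ?thesis
    using cl.A.class_diag_mult[OF c(1) one_plus_J_unit[OF assms(1)] c(2) one_plus_J_unit[OF assms(2)], of 0]
    by simp
qed

text \<open>Consecutive \<open>d n\<close> differ by \<open>Det(1 + a\<^sub>n)\<close> with \<open>a\<^sub>n \<in> J n\<close>. If \<open>v\<close> is the limit of the products of the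
  \<open>1 + a\<^sub>n\<close>, then \<open>Det(v) d\<^sub>1\<close> is the required element, since \<open>v\<close> differs from the \<open>n\<close>-th partial product by a
  factor in \<open>1 + J n\<close>.\<close>

lemma Det_complete:
  assumes d: "\<And>n. n \<ge> 1 \<Longrightarrow> d n \<in> carrier (Det_K1 R G)"
    and dS: "\<And>n. n \<ge> 1 \<Longrightarrow> d (Suc n) \<in> Det_congruence p R G n #>\<^bsub>Det_K1 R G\<^esub> d n"
  shows "\<exists>e\<in>carrier (Det_K1 R G). \<forall>n\<ge>1. e \<in> Det_congruence p R G n #>\<^bsub>Det_K1 R G\<^esub> d n"
proof -
  let ?m = "\<lambda>x y. x \<otimes>\<^bsub>Det_K1 R G\<^esub> y"
  have "\<exists>a. n \<ge> 1 \<longrightarrow> a \<in> J n \<and> d (Suc n) = ?m (Det G (unit_class a)) (d n)" for n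
    using dS[of n] Det_congruence_eq(2)[of n] unfolding r_coset_def by auto
  then obtain a where a: "\<And>n. n \<ge> 1 \<Longrightarrow> a n \<in> J n"
      "\<And>n. n \<ge> 1 \<Longrightarrow> d (Suc n) = ?m (Det G (unit_class (a n))) (d n)"
    by metis
  \<comment> \<open>the products start at index \<open>1\<close>; the value at \<open>0\<close> is a default\<close>
  define u where "u = rec_nat \<one>\<^bsub>RG\<^esub> (\<lambda>n x. if n = 0 then \<one>\<^bsub>RG\<^esub> else x \<otimes>\<^bsub>RG\<^esub> (\<one>\<^bsub>RG\<^esub> \<oplus>\<^bsub>RG\<^esub> a n))"
  have u1: "u 1 = \<one>\<^bsub>RG\<^esub>" by (simp add: u_def)
  have uS: "u (Suc n) = u n \<otimes>\<^bsub>RG\<^esub> (\<one>\<^bsub>RG\<^esub> \<oplus>\<^bsub>RG\<^esub> a n)" if "n \<ge> 1" for n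
    using that by (simp add: u_def)
  obtain v where v: "v \<in> Units RG" "v \<ominus>\<^bsub>RG\<^esub> \<one>\<^bsub>RG\<^esub> \<in> J 1"
    "\<And>n. n \<ge> 1 \<Longrightarrow> u n \<in> Units RG \<and> u n \<ominus>\<^bsub>RG\<^esub> \<one>\<^bsub>RG\<^esub> \<in> J 1 \<and> (\<exists>b\<in>J n. v = u n \<otimes>\<^bsub>RG\<^esub> (\<one>\<^bsub>RG\<^esub> \<oplus>\<^bsub>RG\<^esub> b))"
    using infinite_product[of a u] a(1) u1 uS by metis
  have cancel: "\<one>\<^bsub>RG\<^esub> \<oplus>\<^bsub>RG\<^esub> (w \<ominus>\<^bsub>RG\<^esub> \<one>\<^bsub>RG\<^esub>) = w" if "w \<in> carrier RG" for w
    using that by (simp add: RG.minus_eq RG.a_lcomm RG.r_neg)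
  let ?e = "\<lambda>w. Det G (unit_class (w \<ominus>\<^bsub>RG\<^esub> \<one>\<^bsub>RG\<^esub>))"
  have e_mult: "?e (w \<otimes>\<^bsub>RG\<^esub> (\<one>\<^bsub>RG\<^esub> \<oplus>\<^bsub>RG\<^esub> b)) = ?m (Det G (unit_class b)) (?e w)"
    if w: "w \<in> carrier RG" "w \<ominus>\<^bsub>RG\<^esub> \<one>\<^bsub>RG\<^esub> \<in> J 1" and b: "b \<in> J 1" for w b
  proof -
    have "unit_class (w \<otimes>\<^bsub>RG\<^esub> (\<one>\<^bsub>RG\<^esub> \<oplus>\<^bsub>RG\<^esub> b) \<ominus>\<^bsub>RG\<^esub> \<one>\<^bsub>RG\<^esub>) = unit_class (w \<ominus>\<^bsub>RG\<^esub> \<one>\<^bsub>RG\<^esub>) \<otimes>\<^bsub>K1 RG\<^esub> unit_class b"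
      unfolding unit_class_mult[OF w(2) b] cancel[OF w(1)] ..
    also have "\<dots> = unit_class b \<otimes>\<^bsub>K1 RG\<^esub> unit_class (w \<ominus>\<^bsub>RG\<^esub> \<one>\<^bsub>RG\<^esub>)"
      by (rule cl.A.K1.m_comm[OF unit_class_carrier[OF w(2)] unit_class_carrier[OF b]])
    finally show ?thesis
      by (simp only: Det.hom_mult[OF unit_class_carrier[OF b] unit_class_carrier[OF w(2)]])
  qed
  have ec: "?e w \<in> carrier (Det_K1 R G)" if "w \<ominus>\<^bsub>RG\<^esub> \<one>\<^bsub>RG\<^esub> \<in> J 1" for w
    by (rule Det.hom_closed[OF unit_class_carrier[OF that]])
  have bc: "Det G (unit_class b) \<in> carrier (Det_K1 R G)" if "b \<in> J 1" for b
    by (rule Det.hom_closed[OF unit_class_carrier[OF that]])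
  have d1: "d 1 \<in> carrier (Det_K1 R G)" by (rule d) simp
  have dn: "d n = ?m (?e (u n)) (d 1)" if "n \<ge> 1" for n
    using that
  proof (induction n rule: dec_induct)
    case base
    have "\<one>\<^bsub>RG\<^esub> \<ominus>\<^bsub>RG\<^esub> \<one>\<^bsub>RG\<^esub> = \<zero>\<^bsub>RG\<^esub>" by simp
    moreover have "cl.A.diag 0 \<zero>\<^bsub>RG\<^esub> = \<one>\<^bsub>GL RG\<^esub>"
      by (simp add: cl.A.diag_def cl.A.column_matrix_zero cl.A.one_GL)
    ultimately have "?e (u 1) = \<one>\<^bsub>Det_K1 R G\<^esub>"
      unfolding u1 by (simp only: cl.A.class_hom.hom_one Det.hom_one)
    then show ?case using d1 by simp
  next
    case (step n)
    have un: "u n \<in> carrier RG" "u n \<ominus>\<^bsub>RG\<^esub> \<one>\<^bsub>RG\<^esub> \<in> J 1" using v(3)[OF step(1)] by auto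
    have an: "a n \<in> J 1" using a(1)[OF step(1)] J_le_1[OF step(1)] by blast
    have "d (Suc n) = ?m (Det G (unit_class (a n))) (?m (?e (u n)) (d 1))"
      using a(2)[OF step(1)] step.IH by simp
    also have "\<dots> = ?m (?e (u (Suc n))) (d 1)"
      unfolding uS[OF step(1)] e_mult[OF un an]
      by (rule D.m_assoc[OF bc[OF an] ec[OF un(2)] d1, symmetric])
    finally show ?case .
  qed
  show ?thesis
  proof (intro bexI[of _ "?m (?e v) (d 1)"] allI impI)
    show "?m (?e v) (d 1) \<in> carrier (Det_K1 R G)" using ec[OF v(2)] d1 by (rule D.m_closed)
    fix n :: nat assume n: "n \<ge> 1"
    obtain b where b: "b \<in> J n" "v = u n \<otimes>\<^bsub>RG\<^esub> (\<one>\<^bsub>RG\<^esub> \<oplus>\<^bsub>RG\<^esub> b)" using v(3)[OF n] by blast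
    have un: "u n \<in> carrier RG" "u n \<ominus>\<^bsub>RG\<^esub> \<one>\<^bsub>RG\<^esub> \<in> J 1" using v(3)[OF n] by auto
    have b1: "b \<in> J 1" using b(1) J_le_1[OF n] by blast
    have "?m (?e v) (d 1) = ?m (Det G (unit_class b)) (d n)"
      unfolding b(2) e_mult[OF un b1] dn[OF n]
      by (rule D.m_assoc[OF bc[OF b1] ec[OF un(2)] d1])
    moreover have "Det G (unit_class b) \<in> Det_congruence p R G n"
      unfolding Det_congruence_eq(2)[OF n] using b(1) by blast
    ultimately show "?m (?e v) (d 1) \<in> Det_congruence p R G n #>\<^bsub>Det_K1 R G\<^esub> d n"
      unfolding r_coset_def by blast
  qed
qed

text \<open>The entries of \<open>1 + p\<^sup>n \<Sum> b\<^sub>g \<rho>(g)\<close> are congruent to those of the identity, with errors in \<open>p\<^sup>n\<close> times the span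
  of the entries of the \<open>\<rho>(g)\<close>; the family is indexed by all pairs \<open>(n, b)\<close>. The determinant inherits
  the congruence, which makes \<open>T\<close> independent of \<open>n\<close> and \<open>b\<close>.\<close>

lemma Det_rep_unit_class:
  assumes "finite_group_rep G d \<rho>"
  obtains T where "finite T"
    "\<And>n b. b \<in> carrier RG \<Longrightarrow>
      \<exists>y\<in>coeff_span T. Det_rep G (d, \<rho>) (cl (cl.A.diag 0 (add_pow RG (p ^ n) b))) = 1 + to_closure (of_nat (p ^ n)) * y"
proof -
  interpret rep: finite_group_rep G d \<rho> by (rule assms)
  interpret Modules.module "\<lambda>(r::'r) (x::'r fract alg_closure). to_closure r * x" by (rule to_closure_module)
  define q :: "nat \<times> ('g \<Rightarrow> 'r) \<Rightarrow> 'r" where "q = (\<lambda>(n, b). of_nat (p ^ n))"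
  define S where "S = (\<lambda>(i::nat \<times> ('g \<Rightarrow> 'r)) j k. \<Sum>g\<in>carrier G. to_closure (snd i g) * \<rho> g $$ (j, k))"
  define M where "M = (\<lambda>i. mat d d (\<lambda>(j, k). (if j = k then 1 else 0) + to_closure (q i) * S i j k))"
  have "congruent_to q (det (1\<^sub>m d)) (\<lambda>i. det (M i))"
  proof (rule congruent_to_det)
    fix j k assume jk: "j < d" "k < d"
    have "S i j k \<in> span ((\<lambda>g. \<rho> g $$ (j, k)) ` carrier G)" for i
      unfolding S_def by (intro span_sum span_scale span_base) auto
    then show "congruent_to q (1\<^sub>m d $$ (j, k)) (\<lambda>i. M i $$ (j, k))"
      unfolding congruent_to_def using jk finite_G
      by (intro exI[of _ "(\<lambda>g. \<rho> g $$ (j, k)) ` carrier G"]) (auto simp: M_def)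
  qed (simp_all add: M_def)
  then obtain T where T: "finite T" "\<And>i. \<exists>y\<in>span T. det (M i) = 1 + to_closure (q i) * y"
    by (auto simp: congruent_to_def)
  have "Det_rep G (d, \<rho>) (cl (cl.A.diag 0 (add_pow RG (p ^ n) b))) = det (M (n, b))"
    if b: "b \<in> carrier RG" for n b
  proof -
    let ?a = "add_pow RG (p ^ n) b" and ?D = "cl.A.diag 0 (add_pow RG (p ^ n) b)"
    have a: "?a \<in> carrier RG" using b by simp
    have "in_block RG 1 ?D"
      using a by (auto simp: in_block_def cl.A.diag_def cl.A.column_matrix_def)
    then have blk: "in_block kG 1 (cl ?D)" by (rule cl.in_block_map)
    have coeff: "cl ?D 0 0 g = (if g = \<one>\<^bsub>G\<^esub> then 1 else 0) + to_closure (of_nat (p ^ n)) * to_closure (b g)"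
      if g: "g \<in> carrier G" for g
    proof -
      have "?a g = of_nat (p ^ n) * b g"
        using RG_add_pow_at[OF b g, of "p ^ n"] by (simp add: R_eq add_pow_ring_of_type_algebra)
      moreover have "?D 0 0 = \<one>\<^bsub>RG\<^esub> \<oplus>\<^bsub>RG\<^esub> ?a" by (simp add: cl.A.diag_def cl.A.column_matrix_def)
      then have "?D 0 0 g = \<one>\<^bsub>RG\<^esub> g + ?a g" using g by (simp only: RG_simps(5) restrict_apply' R_ops)
      ultimately show ?thesis using g by (simp add: group_ring_map_def RG_simps(3) R_ops)
    qed
    have "rep.act (cl ?D 0 0) j k = (if j = k then 1 else 0) + to_closure (of_nat (p ^ n)) * S (n, b) j k"
      if jk: "j < d" "k < d" for j k
    proof -
      have "rep.act (cl ?D 0 0) j k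
          = (\<Sum>g\<in>carrier G. (if g = \<one>\<^bsub>G\<^esub> then \<rho> g $$ (j, k) else 0)
             + to_closure (of_nat (p ^ n)) * (to_closure (b g) * \<rho> g $$ (j, k)))"
        unfolding rep.act_def
      proof (rule sum.cong[OF refl])
        fix g assume g: "g \<in> carrier G"
        show "cl ?D 0 0 g * \<rho> g $$ (j, k) = (if g = \<one>\<^bsub>G\<^esub> then \<rho> g $$ (j, k) else 0)
             + to_closure (of_nat (p ^ n)) * (to_closure (b g) * \<rho> g $$ (j, k))"
          unfolding coeff[OF g] distrib_right mult.assoc by (cases "g = \<one>\<^bsub>G\<^esub>") simp_all
      qed
      also have "\<dots> = \<rho> \<one>\<^bsub>G\<^esub> $$ (j, k) + to_closure (of_nat (p ^ n)) * S (n, b) j k"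
        using finite_G by (simp add: sum.distrib S_def sum_distrib_left)
      finally show ?thesis using jk by (simp add: rep.rho_one)
    qed
    then have "rep.block_mat 1 (cl ?D) = M (n, b)"
      by (intro eq_matI) (auto simp: rep.block_mat_def M_def q_def)
    then show ?thesis using rep.Det_rep_eq[OF blk] by simp
  qed
  then have "\<exists>y\<in>coeff_span T. Det_rep G (d, \<rho>) (cl (cl.A.diag 0 (add_pow RG (p ^ n) b))) = 1 + to_closure (of_nat (p ^ n)) * y"
    if "b \<in> carrier RG" for n b
    using T(2)[of "(n, b)"] that by (simp add: q_def)
  then show thesis using that T(1) by blast
qed

text \<open>At each character \<open>\<chi>\<close> the difference \<open>x \<chi> - 1\<close> lies in \<open>p\<^sup>nS\<close> for all \<open>n\<close> and a single finitely generated
  \<open>S\<close>, hence vanishes.\<close>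

lemma Det_separated:
  assumes x: "\<And>n. n \<ge> 1 \<Longrightarrow> x \<in> Det_congruence p R G n"
  shows "x = \<one>\<^bsub>Det_K1 R G\<^esub>"
proof -
  have "\<exists>b. n \<ge> 1 \<longrightarrow> b \<in> carrier RG \<and> x = Det G (unit_class (add_pow RG (p ^ n) b))" for n
    using x[of n] Det_congruence_eq(2)[of n] unfolding J_eq_multiples by auto
  then obtain b where b: "\<And>n. n \<ge> 1 \<Longrightarrow> b n \<in> carrier RG"
    "\<And>n. n \<ge> 1 \<Longrightarrow> x = Det G (unit_class (add_pow RG (p ^ n) (b n)))" by metis
  have D: "cl.A.diag 0 (add_pow RG (p ^ n) (b n)) \<in> carrier (GL RG)" if n: "n \<ge> 1" for n
  proof (rule cl.A.diag_GL)
    have "add_pow RG (p ^ n) (b n) \<in> J n" unfolding J_eq_multiples using b(1)[OF n] by blast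
    then show "\<one>\<^bsub>RG\<^esub> \<oplus>\<^bsub>RG\<^esub> add_pow RG (p ^ n) (b n) \<in> Units RG"
      using one_plus_J_unit J_le_1[OF n] by blast
  qed (use b(1)[OF n] in simp)
  have x_eq: "x = (\<lambda>\<chi>\<in>irr_characters G. Det_rep G (chosen_rep \<chi>) (cl (cl.A.diag 0 (add_pow RG (p ^ n) (b n)))))"
    if n: "n \<ge> 1" for n
    using b(2)[OF n] Det_class[OF D[OF n]] by simp
  have sep: "r = 0" if r: "\<And>n. n \<ge> 1 \<Longrightarrow> of_nat (p ^ n) dvd r" for r :: 'r
  proof -
    have "r = \<zero>\<^bsub>R\<^esub>"
    proof (rule R.I_separated)
      fix n :: nat assume "n \<ge> 1"
      then obtain s where "r = of_nat (p ^ n) * s" using r by blast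
      then show "r \<in> R.I n" unfolding R.I_iff by (auto simp: R_eq add_pow_ring_of_type_algebra)
    qed (simp add: R_eq)
    then show ?thesis by (simp add: R_eq)
  qed
  have val: "x \<chi> = 1" if chi: "\<chi> \<in> irr_characters G" for \<chi>
  proof -
    obtain d \<rho> where d: "chosen_rep \<chi> = (d, \<rho>)" "finite_group_rep G d \<rho>" using chi by (rule chosen_rep)
    obtain T where T: "finite T" "\<And>n b. b \<in> carrier RG \<Longrightarrow>
      \<exists>y\<in>coeff_span T. Det_rep G (d, \<rho>) (cl (cl.A.diag 0 (add_pow RG (p ^ n) b))) = 1 + to_closure (of_nat (p ^ n)) * y"
      using Det_rep_unit_class[OF d(2)] by blast
    have "x \<chi> - 1 = 0"
    proof (rule coeff_span_separated[OF sep T(1)])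
      fix n :: nat assume n: "n \<ge> 1"
      have "x \<chi> = Det_rep G (d, \<rho>) (cl (cl.A.diag 0 (add_pow RG (p ^ n) (b n))))"
        using fun_cong[OF x_eq[OF n], of \<chi>] chi by (simp add: d(1))
      then show "\<exists>y\<in>coeff_span T. x \<chi> - 1 = to_closure (of_nat (p ^ n)) * y"
        using T(2)[OF b(1)[OF n], of n] by auto
    qed
    then show ?thesis by simp
  qed
  show ?thesis
  proof (rule extensionalityI)
    show "x \<in> extensional (irr_characters G)" by (subst x_eq[of 1]) simp_all
    show "\<one>\<^bsub>Det_K1 R G\<^esub> \<in> extensional (irr_characters G)"
      by (simp add: Det_K1_def Det_codomain_def)
    show "x \<chi> = \<one>\<^bsub>Det_K1 R G\<^esub> \<chi>" if "\<chi> \<in> irr_characters G" for \<chi>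
      using that val by (simp add: Det_K1_def Det_codomain_def units_of_one)
  qed
qed

lemma K1_reduction_compat:
  assumes n: "n \<ge> 1" and Y: "Y \<in> carrier (K1 RG)"
  shows "K1_trans p R G n (K1_reduction p R G (Suc n) Y) = K1_reduction p R G n Y"
proof -
  interpret r: matrix_ring_hom RG "level n" "group_ring_map G (reduction p R n)" by (rule reduction_matrix_hom)
  interpret r': matrix_ring_hom RG "level (Suc n)" "group_ring_map G (reduction p R (Suc n))" by (rule reduction_matrix_hom)
  interpret t: matrix_ring_hom "level (Suc n)" "level n" "group_ring_map G (ppow_trans p R n)" by (rule trans_matrix_hom)
  obtain M where M: "M \<in> carrier (GL RG)" "Y = K1_class RG M" using Y by (rule K1_cases)
  have "group_ring_map G (ppow_trans p R n) (group_ring_map G (reduction p R (Suc n)) (M i j))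
      = group_ring_map G (reduction p R n) (M i j)" for i j
    using RG_coeff[OF cl.A.SM_entry[OF cl.A.GL_SM[OF M(1)], of i j]]
    by (auto simp: group_ring_map_def R.ppow_trans_reduction intro!: restrict_ext)
  then show ?thesis
    unfolding M(2) K1_trans_def K1_reduction_def r'.K1_map_class[OF M(1)] r.K1_map_class[OF M(1)]
      t.K1_map_class[OF r'.mmap_GL[OF M(1)]] by simp
qed

lemma tower: "congruence_tower (K1 RG) (Det_K1 R G) (Det G) (K1_level p R G) (K1_reduction p R G)
    (K1_trans p R G) (Det_congruence p R G)"
proof (intro congruence_tower.intro congruence_tower_axioms.intro)
  show "comm_group (K1 RG)" by (rule cl.A.K1_comm_group)
  show "comm_group (Det_K1 R G)" by (rule Det_K1_comm_group)
  show "group_hom (K1 RG) (Det_K1 R G) (Det G)" by (rule Det_K1_group_hom)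
  show "Det G ` carrier (K1 RG) = carrier (Det_K1 R G)" by (simp add: Det_K1_def)
next
  fix n :: nat assume n: "n \<ge> 1"
  interpret S: radical_surjection RG "level n" "group_ring_map G (reduction p R n)"
    by (rule reduction_radical_surjection[OF n])
  show "Group.group (K1_level p R G n)" unfolding K1_level_def by (rule S.B.K1.is_group)
  show "K1_reduction p R G n \<in> hom (K1 RG) (K1_level p R G n)"
    unfolding K1_level_def K1_reduction_def by (rule S.K1_map_hom)
  show "K1_reduction p R G n ` carrier (K1 RG) = carrier (K1_level p R G n)"
    unfolding K1_level_def K1_reduction_def by (rule S.K1_map_surj)
qed (rule K1_reduction_compat Det_congruence_eq(1) Det_separated Det_complete; assumption?)+

end

section \<open>The completed exact sequence\<close>

theorem proposition1p3:
  fixes p :: nat and R :: "'r::idom ring" and G :: "'g monoid"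
  assumes "Factorial_Ring.prime p"
    and "R = ring_of_type_algebra"
    and "hypothesis_H p R"
    and "group G" and "finite (carrier G)"
  shows "Det_to_Det_hat p R G \<in> iso (Det_K1 R G) (Det_hat p R G) \<and>
    short_exact (SK1_hat p R G) (\<lambda>x. x) (K1_hat p R G)
      (K1_hat_to_Det_hat p R G) (Det_hat p R G)"
proof -
  have cr: "cring R" unfolding assms(2) by (rule cring_from_type_algebra)
  have "p_complete_domain_group_ring R p G"
    using assms(2-5) cr cring.axioms(1)[OF cr] unfolding hypothesis_H_def
    by (simp add: p_complete_domain_group_ring_def p_complete_domain_group_ring_axioms_def
        p_complete_group_ring_def p_complete_ring_def p_complete_ring_axioms_def
        finite_group_ring_def finite_group_ring_axioms_def)
  then interpret p_complete_domain_group_ring R p G .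
  interpret T: congruence_tower "K1 RG" "Det_K1 R G" "Det G" "K1_level p R G" "K1_reduction p R G"
    "K1_trans p R G" "Det_congruence p R G" by (rule tower)
  have hat: "Det_hat p R G = T.D_hat"
    unfolding Det_hat_def Det_proj_def[abs_def] ..
  have "Det_to_Det_hat p R G = (\<lambda>x. \<lambda>n\<in>{1..}. T.proj n x)"
    by (simp add: Det_to_Det_hat_def Det_proj_def fun_eq_iff)
  moreover have "SK1_hat p R G = inverse_limit_group
      (\<lambda>n. (K1_level p R G n)\<lparr>carrier := K1_reduction p R G n ` kernel (K1 RG) (Det_K1 R G) (Det G)\<rparr>)
      (K1_trans p R G)"
    by (simp add: SK1_hat_def SK1_def kernel_def Det_K1_def)
  moreover have "K1_hat_to_Det_hat p R G = (\<lambda>x. \<lambda>n\<in>{1..}. T.level_map n (x n))"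
    by (simp add: K1_hat_to_Det_hat_def T.level_map_def Det_proj_def fun_eq_iff)
  moreover have "K1_hat p R G = inverse_limit_group (K1_level p R G) (K1_trans p R G)"
    by (simp add: K1_hat_def)
  ultimately show ?thesis
    using T.to_D_hat_iso T.tower_short_exact unfolding hat by simp
qed

end
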